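(* Let $L\in\mathcal R_0$. Let $\sigma$ be a finite positive Borel measure on $[0,+\infty]$, let $\gamma\in\mathbb R$, and let $v:(-1,0)\to\mathbb R$ be given by $$v\left(\frac{z}{1-z}\right)=\gamma+\int_{[0,+\infty]}\frac{1+tz}{z-t}\,\sigma(\mathrm dt),\qquad z<0 .$$ (i) The following two conditions are equivalent: $$\sigma\big([0,x)\big)\sim x\,L(1/x)\quad\text{as }x\to0^+,\qquad\qquad x\mapsto v(-1/x)\in\Pi_L(-1).$$ (ii) If $d:=\lim_{x\to+\infty}L(x)\in[0,+\infty]$ exists, then each of these equivalent conditions implies that $$x\mapsto\frac{1}{S_{\mu_\boxtimes^{\gamma,\sigma}}(-1/x)}\in\begin{cases}K\mathcal R_\infty,&\text{if }d=+\infty,\\ \mathcal R_d,&\text{if }d\in(0,+\infty),\\ \Pi_M(1),&\text{if }d=0,\end{cases}\qquad(\ast)$$ where $M(x):=L(x)/S_{\mu_\boxtimes^{\gamma,\sigma}}(-1/x)$. (iii) Suppose the limit $d$ from (ii) exists and, if $d=0$, assume additionally that $\int_{(0,+\infty)}t^{-1}\sigma(\mathrm dt)=+\infty$. Then $(\ast)$ implies that $$x\mapsto\mu_\boxtimes^{\gamma,\sigma}\big((x,+\infty)\big)\in\mathcal R_{-1/(1+d)},$$ where $1/(1+d)=0$ if $d=+\infty$.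
   Context: $f\sim g$ means that $f/g\to1$ in the indicated limit. For $\rho\in\mathbb R$, $\mathcal R_\rho$ is the class of regularly varying functions of index $\rho$: (positive, measurable) $f$ on a neighborhood of $+\infty$ with $f(\lambda x)/f(x)\to\lambda^\rho$ as $x\to+\infty$ for every $\lambda>0$; elements of $\mathcal R_0$ are slowly varying. For $L\in\mathcal R_0$ and $c\in\mathbb R$, $f\in\Pi_L(c)$ means $\lim_{x\to+\infty}\frac{f(\lambda x)-f(x)}{L(x)}=c\log\lambda$ for all $\lambda>0$ (the notation presupposes that the subscript is slowly varying). $K\mathcal R_\infty$ is the class of measurable (positive) functions $f$ such that for every $a\in\mathbb R$, $\liminf_{x\to+\infty}\inf_{\lambda\ge1}\frac{f(\lambda x)}{\lambda^a f(x)}\ge1$. In the integral defining $v$, the integrand equals $1/z$ at $t=0$ and $-z$ at $t=+\infty$. For a Borel probability measure $\mu\ne\delta_0$ on $[0,+\infty)$ put $\delta=\mu(\{0\})$ and $\psi_\mu(z)=\int_{[0,+\infty)}\frac{zt}{1-zt}\,\mu(\mathrm dt)$, $z<0$; $\psi_\mu:(-\infty,0)\to(\delta-1,0)$ is invertible with inverse $\chi_\mu$ and the $S$-transform is $S_\mu(z)=\frac{z+1}{z}\chi_\mu(z)$, $z\in(\delta-1,0)$. It determines $\mu$ uniquely. $\mu_\boxtimes^{\gamma,\sigma}$ denotes the probability measure on $[0,+\infty)$ with $S$-transform $S(z)=\exp(v(z))$, $z\in(-1,0)$. By a theorem of Bercovici and Voiculescu such a measure exists for each pair $(\gamma,\sigma)$,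 and these are exactly the measures infinitely divisible with respect to free multiplicative convolution $\boxtimes$. *)

theory Defs
  imports "HOL-Probability.Probability" "HOL-Library.Landau_Symbols"
begin

section \<open>Regular variation and related classes\<close>

text \<open>Functions defined near \<open>+\<infinity>\<close> are modelled by total functions whose values away from
  \<open>+\<infinity>\<close> are irrelevant.\<close>

definition pos_meas_at_top :: "(real \<Rightarrow> real) \<Rightarrow> bool" where
  "pos_meas_at_top f \<longleftrightarrow> (\<exists>X. set_borel_measurable borel {X..} f \<and> (\<forall>x\<ge>X. 0 < f x))"

definition reg_var :: "real \<Rightarrow> (real \<Rightarrow> real) set" where
  "reg_var \<rho> = {f. pos_meas_at_top f \<and>
     (\<forall>l>0. ((\<lambda>x. f (l * x) / f x) \<longlongrightarrow> l powr \<rho>) at_top)}"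

text \<open>Membership in the class below includes slow variation of the auxiliary function \<open>L\<close>.\<close>

definition Pi_class :: "(real \<Rightarrow> real) \<Rightarrow> real \<Rightarrow> (real \<Rightarrow> real) set" where
  "Pi_class L c = {f. L \<in> reg_var 0 \<and>
     (\<forall>l>0. ((\<lambda>x. (f (l * x) - f x) / L x) \<longlongrightarrow> c * ln l) at_top)}"

definition KR_infinity :: "(real \<Rightarrow> real) set" where
  "KR_infinity = {f. pos_meas_at_top f \<and>
     (\<forall>a::real. 1 \<le> Liminf at_top (\<lambda>x. INF l\<in>{1..}. ereal (f (l * x) / (l powr a * f x))))}"

section \<open>The S-transform\<close>

text \<open>A Borel measure on \<open>[0,+\<infinity>)\<close> is a Borel measure on the reals that does not charge
  the negative half-line.\<close>

definition prob_on_nonneg :: "real measure \<Rightarrow> bool" where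
  "prob_on_nonneg \<mu> \<longleftrightarrow> prob_space \<mu> \<and> sets \<mu> = sets borel \<and> emeasure \<mu> {..<0} = 0"

definition psi :: "real measure \<Rightarrow> real \<Rightarrow> real" where
  "psi \<mu> z = (LINT t:{0..}|\<mu>. z * t / (1 - z * t))"

definition chi :: "real measure \<Rightarrow> real \<Rightarrow> real" where
  "chi \<mu> = the_inv_into {..<0} (psi \<mu>)"

text \<open>The following is meaningful only for \<open>\<mu> \<noteq> \<delta>\<^sub>0\<close> and \<open>z\<close> in the interval
  \<open>(\<mu>({0}) - 1, 0)\<close>, which is the range of \<open>psi \<mu>\<close> on the negative half-line.\<close>

definition S_transform :: "real measure \<Rightarrow> real \<Rightarrow> real" where
  "S_transform \<mu> z = (z + 1) / z * chi \<mu> z"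

text \<open>Equality of the S-transform with a function \<open>S\<close> on \<open>D\<close> as partial functions,
  that is, including equality of the domains.\<close>

definition has_S_transform :: "real measure \<Rightarrow> real set \<Rightarrow> (real \<Rightarrow> real) \<Rightarrow> bool" where
  "has_S_transform \<mu> D S \<longleftrightarrow> prob_on_nonneg \<mu> \<and> \<mu> \<noteq> return borel 0 \<and>
     {measure \<mu> {0} - 1<..<0} = D \<and> (\<forall>z\<in>D. S_transform \<mu> z = S z)"

section \<open>The integrand in the free Levy--Khintchine representation\<close>

text \<open>The value at \<open>t = 0\<close> is \<open>1 / z\<close>; the value at \<open>t = +\<infinity>\<close> is the limit \<open>- z\<close>.\<close>

definition lk_kernel :: "real \<Rightarrow> ennreal \<Rightarrow> real" where
  "lk_kernel z t = (if t = \<infinity> then - z else (1 + enn2real t * z) / (z - enn2real t))"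

section \<open>The trichotomy according to the limit of L\<close>

definition inv_S_class ::
  "ereal \<Rightarrow> (real \<Rightarrow> real) \<Rightarrow> real measure \<Rightarrow> (real \<Rightarrow> real) set" where
  "inv_S_class d L \<mu> =
     (if d = \<infinity> then KR_infinity
      else if 0 < d then reg_var (real_of_ereal d)
      else Pi_class (\<lambda>x. L x / S_transform \<mu> (- 1 / x)) 1)"

end

theory Submission
  imports Defs "HOL-Real_Asymp.Real_Asymp"
begin

text \<open>
  Put \<open>U y = - \<integral> lk_kernel (- 1 / y) d\<sigma>\<close>, so that \<open>v (- 1 / x) = \<gamma> - U (x - 1)\<close>. Up to an error
  of order \<open>1 / y\<close>, the increment \<open>U (l y) - U y\<close> is the integral of
  \<open>(l - 1) y / ((1 + l t y) (1 + t y))\<close> over the finite \<open>t\<close>. The substitution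
  \<open>x = t y / (1 + t y) \<in> [0, 1)\<close> turns this kernel into \<open>(l - 1) / (1 + (l - 1) x)\<close> against a
  measure that depends on \<open>y\<close> only. Hence the increments for all \<open>l\<close> near \<open>1\<close>, divided by \<open>L y\<close>,
  form a generating function of the moments of measures on the unit interval, and if they tend to
  \<open>ln l\<close>, these measures tend to Lebesgue measure, because
  \<open>\<integral>\<^sub>0\<^sup>1 dx / (1 + m x) = ln (1 + m) / m\<close>. Evaluating the limit on
  \<open>[0, 1/2)\<close>, which corresponds to \<open>t < 1 / y\<close>, gives \<open>\<sigma> [0, 1 / y) \<sim> L y / y\<close>
  (\<open>log_tauberian\<close>, \<open>mass_below_of_increment\<close>). The converse is an integration by parts and
  dominated convergence; the dominating function comes from iterating
  \<open>\<sigma> [0, 2 x) \<le> 2\<^bsup>3/2\<^esup> \<sigma> [0, x)\<close> (\<open>increment_of_mass\<close>). All functions compared in this way are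
  monotone, which is why limits for each fixed \<open>l\<close> suffice.

  The second claim follows by exponentiating: \<open>T x = 1 / S (- 1 / x) = exp (- v (- 1 / x))\<close>, so
  \<open>T (l x) / T x = exp (L x (ln l + o(1)))\<close>.

  For the third claim let \<open>\<Phi> q = \<integral> t / (q + t) d\<mu> = - \<psi> (- 1 / q)\<close>. The definition of the
  S-transform says that \<open>\<Phi> (h x) = 1 / x\<close> for \<open>h x = (x - 1) T x\<close>, that is, \<open>1 / \<Phi>\<close> is the
  inverse function of \<open>h\<close>. If \<open>d > 0\<close>, then \<open>h\<close> varies regularly with index \<open>1 + d\<close> (rapidly if
  \<open>d = \<infinity>\<close>), so \<open>\<Phi>\<close> varies with index \<open>- \<alpha>\<close> where \<open>\<alpha> = 1 / (1 + d) < 1\<close>. With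
  \<open>x = q / (q + t)\<close> the ratio \<open>\<Phi> (l q) / \<Phi> q\<close> is again a generating function of moments on
  \<open>[0, 1]\<close>, and the same argument shows that \<open>\<mu> (q, \<infinity>)\<close> is asymptotically a positive multiple of
  \<open>\<Phi> q\<close> (\<open>tail_reg_var_power\<close>). If \<open>d = 0\<close>, the index is \<open>- 1\<close> and this comparison breaks down.
  Instead \<open>Q q = q \<Phi> q\<close> inherits membership in a class \<open>\<Pi>\<close> from \<open>T\<close>, and its increments have
  the kernel of the first claim with \<open>1 / t\<close> in place of \<open>t\<close>, so that \<open>log_tauberian\<close> applies once
  more (\<open>tail_reg_var_slow\<close>).
\<close>

section \<open>A Tauberian principle on the unit interval\<close>

text \<open>The measures with density \<open>W y\<close> with respect to \<open>M\<close>, transported to \<open>[0, 1]\<close> by \<open>X y\<close>, are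
  compared with the law of \<open>Y\<close> under \<open>N\<close>. Weights and transports are kept explicit so that
  rescaled measures need not be constructed. Convergence of the integrals of \<open>1 / (1 + m x)\<close> for
  small \<open>m\<close> is convergence of moment generating series, and it implies weak convergence.\<close>
locale stieltjes_limit = N: finite_measure N
  for N :: "'b measure" and M :: "'a measure" and F :: "'c filter"
    and W X :: "'c \<Rightarrow> 'a \<Rightarrow> real" and Y :: "'b \<Rightarrow> real" +
  assumes family: "\<forall>\<^sub>F y in F. integrable M (W y) \<and> X y \<in> borel_measurable M \<and>
      (\<forall>t\<in>space M. 0 \<le> W y t \<and> 0 \<le> X y t \<and> X y t \<le> 1)"
    and Y_meas [measurable]: "Y \<in> borel_measurable N"
    and Y_range: "\<And>s. s \<in> space N \<Longrightarrow> 0 \<le> Y s \<and> Y s \<le> 1"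
    and transform_lim: "\<And>m. 0 < \<bar>m\<bar> \<Longrightarrow> \<bar>m\<bar> < 1 / 2 \<Longrightarrow>
      ((\<lambda>y. LINT t|M. W y t / (1 + m * X y t)) \<longlongrightarrow> (LINT s|N. 1 / (1 + m * Y s))) F"
begin

lemma integrable_W:
  assumes "integrable M (W y)" "X y \<in> borel_measurable M"
    "\<forall>t\<in>space M. 0 \<le> W y t \<and> 0 \<le> X y t \<and> X y t \<le> 1"
    and [measurable]: "f \<in> borel_measurable borel" and f: "\<And>x. 0 \<le> x \<Longrightarrow> x \<le> 1 \<Longrightarrow> \<bar>f x\<bar> \<le> (B::real)"
  shows "integrable M (\<lambda>t. W y t * f (X y t))"
proof (rule Bochner_Integration.integrable_bound)
  show "integrable M (\<lambda>t. B * W y t)" using assms(1) by simp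
  show "(\<lambda>t. W y t * f (X y t)) \<in> borel_measurable M"
    using assms(1,2) by measurable
  show "AE t in M. norm (W y t * f (X y t)) \<le> norm (B * W y t)"
  proof (rule AE_I2)
    fix t assume t: "t \<in> space M"
    then have "\<bar>f (X y t)\<bar> \<le> B" "0 \<le> W y t" using f assms(3) by auto
    moreover then have "0 \<le> B" by linarith
    ultimately have "\<bar>W y t\<bar> * \<bar>f (X y t)\<bar> \<le> \<bar>W y t\<bar> * \<bar>B\<bar>"
      by (intro mult_left_mono) auto
    then show "norm (W y t * f (X y t)) \<le> norm (B * W y t)"
      by (simp add: abs_mult mult.commute)
  qed
qed

lemma integrable_Y:
  assumes [measurable]: "f \<in> borel_measurable borel" and f: "\<And>x. 0 \<le> x \<Longrightarrow> x \<le> 1 \<Longrightarrow> \<bar>f x\<bar> \<le> (B::real)"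
  shows "integrable N (\<lambda>t. f (Y t))"
  by (rule N.integrable_const_bound[where B = B]) (use f Y_range in auto)

lemma denom_bounds:
  fixes m x :: real
  assumes "\<bar>m\<bar> < 1 / 2" "0 \<le> x" "x \<le> 1"
  shows "1 / 2 < 1 + m * x" "1 + m * x < 3 / 2"
proof -
  have "\<bar>m * x\<bar> \<le> \<bar>m\<bar> * 1" unfolding abs_mult using assms by (intro mult_left_mono) auto
  then have "\<bar>m * x\<bar> < 1 / 2" using assms by linarith
  then show "1 / 2 < 1 + m * x" "1 + m * x < 3 / 2" by linarith+
qed

text \<open>The total masses stay bounded because \<open>1 / (1 + x / 4)\<close> is bounded below on \<open>[0, 1]\<close>.\<close>
lemma mass_bounded: "\<exists>B>0. \<forall>\<^sub>F y in F. (LINT t|M. W y t) \<le> B"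
proof -
  define c where "c = (LINT s|N. 1 / (1 + (1/4) * Y s))"
  have "((\<lambda>y. LINT t|M. W y t / (1 + (1/4) * X y t)) \<longlongrightarrow> c) F"
    unfolding c_def by (rule transform_lim) auto
  then have "\<forall>\<^sub>F y in F. (LINT t|M. W y t / (1 + (1/4) * X y t)) < \<bar>c\<bar> + 1"
    by (rule order_tendstoD) auto
  with family have "\<forall>\<^sub>F y in F. (LINT t|M. W y t) \<le> 2 * (\<bar>c\<bar> + 1)"
  proof eventually_elim
    case (elim y)
    have int: "integrable M (\<lambda>t. W y t * (1 / (1 + (1/4) * X y t)))"
      if "integrable M (W y)"
      by (rule integrable_W[where B = 2 and f = "\<lambda>x. 1 / (1 + (1/4) * x)"]) (use elim in \<open>auto simp: divide_simps\<close>)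
    have "(LINT t|M. W y t) \<le> (LINT t|M. 2 * (W y t * (1 / (1 + (1/4) * X y t))))"
    proof (rule integral_mono)
      fix t assume t: "t \<in> space M"
      have "W y t * 1 \<le> W y t * (2 * (1 / (1 + (1/4) * X y t)))"
        using elim t by (intro mult_left_mono) (auto simp: divide_simps)
      then show "W y t \<le> 2 * (W y t * (1 / (1 + (1/4) * X y t)))"
        by (simp only: mult_1_right mult.left_commute[of "W y t" 2])
    qed (use elim in simp, intro integrable_mult_right int, use elim in simp)
    also have "\<dots> = 2 * (LINT t|M. W y t * (1 / (1 + (1/4) * X y t)))"
      by (rule integral_mult_right_zero)
    also have "\<dots> = 2 * (LINT t|M. W y t / (1 + (1/4) * X y t))" by simp
    also have "\<dots> \<le> 2 * (\<bar>c\<bar> + 1)"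
      using elim by (intro mult_left_mono less_imp_le) auto
    finally show ?case .
  qed
  then show ?thesis by (intro exI[of _ "2 * (\<bar>c\<bar> + 1)"]) auto
qed

lemma remainder_identity:
  fixes m x :: real
  assumes "\<bar>m\<bar> < 1 / 2" "0 \<le> x" "x \<le> 1"
  shows "x ^ k - x ^ k / (1 + m * x) = m * (x ^ Suc k / (1 + m * x))"
  using denom_bounds[OF assms] by (simp add: field_simps)

lemma remainder_bound:
  fixes m x :: real
  assumes "\<bar>m\<bar> < 1 / 2" "0 \<le> x" "x \<le> 1"
  shows "\<bar>x ^ k / (1 + m * x)\<bar> \<le> 2"
proof -
  have "x ^ k \<le> 1" "0 \<le> x ^ k" using assms by (auto simp: power_le_one)
  then show ?thesis using denom_bounds[OF assms] by (simp add: divide_simps)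
qed

text \<open>The coefficients of the power series in \<open>m\<close> are recovered one at a time. If the integrals
  of \<open>X\<^sup>k / (1 + m X)\<close> converge for all small \<open>m \<noteq> 0\<close>, letting \<open>m \<rightarrow> 0\<close> gives the \<open>k\<close>-th moment,
  as the error is bounded by a multiple of \<open>m\<close> uniformly in \<open>y\<close>; subtracting that moment and
  dividing by \<open>- m\<close> gives the integrals for \<open>k + 1\<close>.\<close>
lemma moment_tendsto: "((\<lambda>y. LINT t|M. W y t * X y t ^ k) \<longlongrightarrow> (LINT s|N. Y s ^ k)) F"
proof -
  let ?G = "\<lambda>k m y. LINT t|M. W y t * (X y t ^ k / (1 + m * X y t))"
  let ?H = "\<lambda>k m. LINT s|N. Y s ^ k / (1 + m * Y s)"
  let ?g = "\<lambda>k y. LINT t|M. W y t * X y t ^ k"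
  let ?h = "\<lambda>k. LINT s|N. Y s ^ k"
  obtain B where B: "B > 0" "\<forall>\<^sub>F y in F. (LINT t|M. W y t) \<le> B"
    using mass_bounded by blast
  have power_abs_le: "\<bar>x ^ j\<bar> \<le> 1" if "0 \<le> x" "x \<le> 1" for x :: real and j
    using that by (auto simp: power_le_one)
  have diffG: "\<forall>\<^sub>F y in F. ?g j y - ?G j m y = m * ?G (Suc j) m y"
    if m: "\<bar>m\<bar> < 1/2" for j m
    using family
  proof eventually_elim
    case (elim y)
    have I1: "integrable M (\<lambda>t. W y t * X y t ^ j)"
      by (rule integrable_W[where B = 1 and f = "\<lambda>x. x ^ j"]) (use elim power_abs_le in auto)
    have I2: "integrable M (\<lambda>t. W y t * (X y t ^ j / (1 + m * X y t)))"
      by (rule integrable_W[where B = 2 and f = "\<lambda>x. x ^ j / (1 + m * x)"])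
         (use elim remainder_bound[OF m] in auto)
    have "?g j y - ?G j m y = (LINT t|M. W y t * X y t ^ j - W y t * (X y t ^ j / (1 + m * X y t)))"
      using I1 I2 by simp
    also have "\<dots> = (LINT t|M. m * (W y t * (X y t ^ Suc j / (1 + m * X y t))))"
    proof (rule Bochner_Integration.integral_cong[OF refl])
      fix t assume "t \<in> space M"
      then have "X y t ^ j - X y t ^ j / (1 + m * X y t) = m * (X y t ^ Suc j / (1 + m * X y t))"
        using elim by (intro remainder_identity m) auto
      then show "W y t * X y t ^ j - W y t * (X y t ^ j / (1 + m * X y t))
          = m * (W y t * (X y t ^ Suc j / (1 + m * X y t)))"
        by (metis mult.left_commute right_diff_distrib)
    qed
    also have "\<dots> = m * ?G (Suc j) m y" by (rule integral_mult_right_zero)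
    finally show ?case .
  qed
  have diffH: "?h j - ?H j m = m * ?H (Suc j) m" if m: "\<bar>m\<bar> < 1/2" for j m
  proof -
    have "?h j - ?H j m = (LINT s|N. Y s ^ j - Y s ^ j / (1 + m * Y s))"
      by (intro Bochner_Integration.integral_diff[symmetric]
            integrable_Y[where f = "\<lambda>x. x ^ j" and B = 1]
            integrable_Y[where f = "\<lambda>x. x ^ j / (1 + m * x)" and B = 2])
         (use power_abs_le remainder_bound[OF m] in auto)
    also have "\<dots> = (LINT s|N. m * (Y s ^ Suc j / (1 + m * Y s)))"
      by (intro Bochner_Integration.integral_cong[OF refl] remainder_identity m) (use Y_range in auto)
    finally show ?thesis by (simp only: integral_mult_right_zero)
  qed
  have boundG: "\<forall>\<^sub>F y in F. \<bar>?G j m y\<bar> \<le> 2 * B" if m: "\<bar>m\<bar> < 1/2" for j m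
    using family B(2)
  proof eventually_elim
    case (elim y)
    have I2: "integrable M (\<lambda>t. W y t * (X y t ^ j / (1 + m * X y t)))"
      by (rule integrable_W[where B = 2 and f = "\<lambda>x. x ^ j / (1 + m * x)"])
         (use elim remainder_bound[OF m] in auto)
    have "\<bar>?G j m y\<bar> \<le> (LINT t|M. \<bar>W y t * (X y t ^ j / (1 + m * X y t))\<bar>)"
      by (rule integral_abs_bound)
    also have "\<dots> \<le> (LINT t|M. 2 * W y t)"
    proof (rule integral_mono)
      fix t assume t: "t \<in> space M"
      have "\<bar>W y t\<bar> * \<bar>X y t ^ j / (1 + m * X y t)\<bar> \<le> \<bar>W y t\<bar> * 2"
        using elim t by (intro mult_left_mono remainder_bound m) auto
      then show "\<bar>W y t * (X y t ^ j / (1 + m * X y t))\<bar> \<le> 2 * W y t"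
        using elim t by (simp add: abs_mult)
    qed (rule integrable_abs[OF I2], use elim in auto)
    finally show ?case using elim by simp
  qed
  define BH where "BH = 2 * measure N (space N)"
  have boundH: "\<bar>?H j m\<bar> \<le> BH" if m: "\<bar>m\<bar> < 1/2" for j m
  proof -
    have I: "integrable N (\<lambda>s. Y s ^ j / (1 + m * Y s))"
      by (rule integrable_Y[where f = "\<lambda>x. x ^ j / (1 + m * x)" and B = 2])
         (use remainder_bound[OF m] in auto)
    have "\<bar>?H j m\<bar> \<le> (LINT s|N. \<bar>Y s ^ j / (1 + m * Y s)\<bar>)"
      by (rule integral_abs_bound)
    also have "\<dots> \<le> (LINT s|N. 2)"
      by (rule integral_mono, rule integrable_abs[OF I]) (use Y_range remainder_bound[OF m] in auto)
    finally show ?thesis by (simp add: BH_def)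
  qed
  have step: "(?g j \<longlongrightarrow> ?h j) F"
    if IH: "\<And>m. 0 < \<bar>m\<bar> \<Longrightarrow> \<bar>m\<bar> < 1/2 \<Longrightarrow> (?G j m \<longlongrightarrow> ?H j m) F" for j
  proof (rule tendstoI)
    fix e :: real assume e: "e > 0"
    \<comment> \<open>Passing from \<open>X ^ j / (1 + m X)\<close> to \<open>X ^ j\<close> costs a multiple of \<open>m\<close>, uniformly in \<open>y\<close>.\<close>
    define K where "K = 2 * B + BH + 1"
    have K: "K > 0" "2 * B + BH < K" using B by (auto simp: K_def BH_def intro!: add_pos_nonneg)
    define m where "m = min (1/4) (e / (2 * K))"
    have m: "0 < m" "m < 1/2" "m * K \<le> e / 2"
      using e K by (auto simp: m_def min_def field_simps split: if_splits)
    have "\<forall>\<^sub>F y in F. dist (?G j m y) (?H j m) < e / 2"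
      using IH[of m] m e by (intro tendstoD) auto
    moreover have "\<bar>m\<bar> < 1/2" using m by simp
    note diffG[OF this, of j] boundG[OF this, of "Suc j"]
    ultimately show "\<forall>\<^sub>F y in F. dist (?g j y) (?h j) < e"
    proof eventually_elim
      case (elim y)
      have "?h j - ?H j m = m * ?H (Suc j) m" using diffH m by simp
      moreover have "\<bar>m * ?H (Suc j) m\<bar> \<le> m * BH" "\<bar>m * ?G (Suc j) m y\<bar> \<le> m * (2 * B)"
        using boundH[of m "Suc j"] m elim by (auto simp: abs_mult intro!: mult_left_mono)
      moreover have "m * (2 * B) + m * BH < m * K" 
        using m K by (simp flip: distrib_left)
      ultimately show ?case using elim m unfolding dist_real_def by linarith
    qed
  qed
  have rem: "\<forall>m. 0 < \<bar>m\<bar> \<longrightarrow> \<bar>m\<bar> < 1/2 \<longrightarrow> (?G j m \<longlongrightarrow> ?H j m) F" for j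
  proof (induction j)
    case 0
    then show ?case using transform_lim by (simp add: )
  next
    case (Suc j)
    show ?case
    proof (intro allI impI)
      fix m :: real assume m: "0 < \<bar>m\<bar>" "\<bar>m\<bar> < 1/2"
      have "((\<lambda>y. (?g j y - ?G j m y) / m) \<longlongrightarrow> (?h j - ?H j m) / m) F"
        using Suc step[of j] m by (intro tendsto_intros) auto
      moreover have "(?h j - ?H j m) / m = ?H (Suc j) m" using diffH[OF m(2)] m by simp
      moreover have "\<forall>\<^sub>F y in F. (?g j y - ?G j m y) / m = ?G (Suc j) m y"
        using diffG[OF m(2), of j] m by (auto elim!: eventually_mono)
      ultimately show "(?G (Suc j) m \<longlongrightarrow> ?H (Suc j) m) F"
        by (simp add: tendsto_cong)
    qed
  qed
  from step[of k] rem[of k] show "(?g k \<longlongrightarrow> ?h k) F" by blast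
qed

lemma continuous_bounded_unit:
  fixes f :: "real \<Rightarrow> real"
  assumes "continuous_on UNIV f"
  obtains B where "\<And>x. 0 \<le> x \<Longrightarrow> x \<le> 1 \<Longrightarrow> \<bar>f x\<bar> \<le> (B::real)"
proof -
  have "compact (f ` {0..1})"
    using assms by (intro compact_continuous_image continuous_on_subset[OF assms]) auto
  then obtain B where "\<And>y. y \<in> f ` {0..1} \<Longrightarrow> norm y \<le> B"
    using compact_imp_bounded bounded_iff by metis
  then show ?thesis by (intro that[of B]) auto
qed

text \<open>Weierstrass approximation extends the convergence from moments to continuous integrands.\<close>
lemma continuous_tendsto:
  assumes f: "continuous_on UNIV f"
  shows "((\<lambda>y. LINT t|M. W y t * f (X y t)) \<longlongrightarrow> (LINT s|N. f (Y s))) F"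
proof (rule tendstoI)
  fix e :: real assume e: "e > 0"
  obtain B where B: "B > 0" "\<forall>\<^sub>F y in F. (LINT t|M. W y t) \<le> B"
    using mass_bounded by blast
  obtain Bf where Bf: "\<And>x. 0 \<le> x \<Longrightarrow> x \<le> 1 \<Longrightarrow> \<bar>f x\<bar> \<le> Bf"
    using continuous_bounded_unit[OF f] by blast
  have fm[measurable]: "f \<in> borel_measurable borel" using f by (rule borel_measurable_continuous_onI)
  define K where "K = B + measure N (space N) + 1"
  have K: "K > 0" using B by (auto simp: K_def intro!: add_pos_nonneg)
  obtain g where g: "real_polynomial_function g" "\<And>x. x \<in> {0..1} \<Longrightarrow> \<bar>f x - g x\<bar> < e / (2 * K)"
    using Stone_Weierstrass_real_polynomial_function[of "{0..1}" f "e / (2 * K)"]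
      continuous_on_subset[OF f] e K by auto
  obtain a n where ga: "g = (\<lambda>x. \<Sum>i\<le>n. a i * x ^ i)"
    using g(1) real_polynomial_function_iff_sum by blast
  have gm[measurable]: "g \<in> borel_measurable borel" unfolding ga by measurable
  have gc: "continuous_on UNIV g" unfolding ga by (intro continuous_intros)
  obtain Bg where Bg: "\<And>x. 0 \<le> x \<Longrightarrow> x \<le> 1 \<Longrightarrow> \<bar>g x\<bar> \<le> Bg"
    using continuous_bounded_unit[OF gc] by blast
  have pow1: "\<bar>x ^ i\<bar> \<le> 1" if "0 \<le> x" "x \<le> 1" for x :: real and i
    using that by (auto simp: power_le_one)
  have gN: "(LINT s|N. g (Y s)) = (\<Sum>i\<le>n. a i * (LINT s|N. Y s ^ i))"
    unfolding ga by (subst Bochner_Integration.integral_sum)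
      (auto intro!: integrable_mult_right integrable_Y[where f = "\<lambda>x. x ^ _" and B = 1] pow1)
  have "((\<lambda>y. \<Sum>i\<le>n. a i * (LINT t|M. W y t * X y t ^ i)) \<longlongrightarrow> (LINT s|N. g (Y s))) F"
    unfolding gN by (intro tendsto_intros moment_tendsto)
  moreover have "\<forall>\<^sub>F y in F. (\<Sum>i\<le>n. (a i * (LINT t|M. W y t * X y t ^ i))) = (LINT t|M. W y t * g (X y t))"
    using family
  proof eventually_elim
    case (elim y)
    have I: "integrable M (\<lambda>t. W y t * X y t ^ j)" for j
      by (rule integrable_W[where B = 1 and f = "\<lambda>x. x ^ j"]) (use elim pow1 in auto)
    have "(LINT t|M. W y t * g (X y t)) = (LINT t|M. (\<Sum>i\<le>n. a i * (W y t * X y t ^ i)))"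
      unfolding ga by (simp add: sum_distrib_left mult_ac)
    also have "\<dots> = (\<Sum>i\<le>n. a i * (LINT t|M. W y t * X y t ^ i))"
      using I by (subst Bochner_Integration.integral_sum) auto
    finally show ?case ..
  qed
  ultimately have "((\<lambda>y. LINT t|M. W y t * g (X y t)) \<longlongrightarrow> (LINT s|N. g (Y s))) F"
    by (simp add: tendsto_cong)
  then have "\<forall>\<^sub>F y in F. dist (LINT t|M. W y t * g (X y t)) (LINT s|N. g (Y s)) < e / 2"
    using e by (intro tendstoD) auto
  with family B(2) show "\<forall>\<^sub>F y in F. dist (LINT t|M. W y t * f (X y t)) (LINT s|N. f (Y s)) < e"
  proof eventually_elim
    case (elim y)
    have If: "integrable M (\<lambda>t. W y t * f (X y t))"
      by (rule integrable_W[where B = Bf]) (use elim Bf in auto)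
    have Ig: "integrable M (\<lambda>t. W y t * g (X y t))"
      by (rule integrable_W[where B = Bg]) (use elim Bg in auto)
    have Jf: "integrable N (\<lambda>t. f (Y t))" by (rule integrable_Y[where B = Bf]) (use Bf in auto)
    have Jg: "integrable N (\<lambda>t. g (Y t))" by (rule integrable_Y[where B = Bg]) (use Bg in auto)
    have "\<bar>(LINT t|M. W y t * f (X y t)) - (LINT t|M. W y t * g (X y t))\<bar>
        = \<bar>LINT t|M. W y t * f (X y t) - W y t * g (X y t)\<bar>" using If Ig by simp
    also have "\<dots> \<le> (LINT t|M. \<bar>W y t * f (X y t) - W y t * g (X y t)\<bar>)"
      by (rule integral_abs_bound)
    also have "\<dots> \<le> (LINT t|M. e / (2 * K) * W y t)"
    proof (rule integral_mono)
      fix t assume t: "t \<in> space M"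
      have "\<bar>W y t\<bar> * \<bar>f (X y t) - g (X y t)\<bar> \<le> \<bar>W y t\<bar> * (e / (2 * K))"
        using elim t g(2)[of "X y t"] by (intro mult_left_mono) auto
      then show "\<bar>W y t * f (X y t) - W y t * g (X y t)\<bar> \<le> e / (2 * K) * W y t"
        using elim t by (simp add: abs_mult mult.commute flip: right_diff_distrib)
    qed (use elim If Ig in auto)
    also have "\<dots> \<le> e / (2 * K) * B"
      using elim e K by (subst integral_mult_right_zero, intro mult_left_mono) auto
    finally have 1: "\<bar>(LINT t|M. W y t * f (X y t)) - (LINT t|M. W y t * g (X y t))\<bar> \<le> e / (2 * K) * B" .
    have "\<bar>(LINT t|N. f (Y t)) - (LINT t|N. g (Y t))\<bar> = \<bar>LINT t|N. f (Y t) - g (Y t)\<bar>"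
      using Jf Jg by simp
    also have "\<dots> \<le> (LINT t|N. \<bar>f (Y t) - g (Y t)\<bar>)" by (rule integral_abs_bound)
    also have "\<dots> \<le> (LINT t|N. e / (2 * K))"
      by (rule integral_mono) (use Jf Jg Y_range g(2) in \<open>auto intro!: less_imp_le\<close>)
    finally have 2: "\<bar>(LINT t|N. f (Y t)) - (LINT t|N. g (Y t))\<bar> \<le> e / (2 * K) * measure N (space N)"
      by (simp add: mult.commute)
    have "e / (2 * K) * B + e / (2 * K) * measure N (space N) < e / (2 * K) * K"
      using e K unfolding distrib_left[symmetric] by (intro mult_strict_left_mono) (auto simp: K_def)
    also have "\<dots> = e / 2" using K by simp
    finally show ?case using 1 2 elim unfolding dist_real_def by linarith
  qed
qed

text \<open>The indicator of \<open>{..<c}\<close> is squeezed between the continuous functions \<open>l n\<close> and \<open>u n\<close>, whose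
  limits differ only at \<open>c\<close>, where the limit law has no mass.\<close>
lemma truncated_tendsto:
  assumes f: "continuous_on UNIV f" and f_nonneg: "\<And>x. 0 \<le> f x"
    and no_atom: "measure N {s \<in> space N. Y s = c} = 0"
  shows "((\<lambda>y. LINT t|M. W y t * (f (X y t) * indicator {..<c} (X y t)))
           \<longlongrightarrow> (LINT s|N. f (Y s) * indicator {..<c} (Y s))) F"
proof -
  have fm[measurable]: "f \<in> borel_measurable borel" using f by (rule borel_measurable_continuous_onI)
  obtain Bf where Bf: "\<And>x. 0 \<le> x \<Longrightarrow> x \<le> 1 \<Longrightarrow> \<bar>f x\<bar> \<le> Bf"
    using continuous_bounded_unit[OF f] by blast
  define l where "l n x = min 1 (max 0 (real n * (c - x)))" for n x
  define u where "u n x = min 1 (max 0 (1 + real n * (c - x)))" for n x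
  have lu_cont: "continuous_on UNIV (\<lambda>x. f x * l n x)" "continuous_on UNIV (\<lambda>x. f x * u n x)" for n
    unfolding l_def u_def by (intro continuous_intros f)+
  have lu_meas[measurable]: "l n \<in> borel_measurable borel" "u n \<in> borel_measurable borel" for n
    unfolding l_def u_def by measurable
  have lu01: "0 \<le> l n x" "l n x \<le> 1" "0 \<le> u n x" "u n x \<le> 1" for n x by (auto simp: l_def u_def)
  have l_le: "l n x \<le> indicator {..<c} x" for n x
    by (auto simp: l_def indicator_def mult_nonneg_nonpos)
  have u_ge: "indicator {..<c} x \<le> u n x" for n x
    by (auto simp: u_def indicator_def)
  have l_lim: "(\<lambda>n. l n x) \<longlonglongrightarrow> indicator {..<c} x" for x
  proof (cases "x < c")
    case True
    have "\<forall>\<^sub>F n in sequentially. real n * (c - x) > 1"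
      using True by real_asymp
    then have "\<forall>\<^sub>F n in sequentially. l n x = 1" by eventually_elim (auto simp: l_def)
    then show ?thesis using True by (simp add: tendsto_eventually)
  next
    case False
    then have "l n x = 0" for n by (auto simp: l_def mult_nonneg_nonpos)
    then show ?thesis using False by simp
  qed
  have u_lim: "(\<lambda>n. u n x) \<longlonglongrightarrow> indicator {..<c} x" if "x \<noteq> c" for x
  proof (cases "x < c")
    case True
    then have "u n x = 1" for n by (auto simp: u_def)
    then show ?thesis using True by simp
  next
    case False
    with that have "x > c" by simp
    then have "\<forall>\<^sub>F n in sequentially. 1 + real n * (c - x) < 0"
      by real_asymp
    then have "\<forall>\<^sub>F n in sequentially. u n x = 0" by eventually_elim (auto simp: u_def)
    then show ?thesis using False by (simp add: tendsto_eventually)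
  qed
  have abs_le: "\<bar>f x * r\<bar> \<le> Bf" if "0 \<le> x" "x \<le> 1" "0 \<le> r" "r \<le> 1" for x r
  proof -
    have "\<bar>f x\<bar> * \<bar>r\<bar> \<le> Bf * 1" using Bf[OF that(1,2)] that(3,4) by (intro mult_mono) auto
    then show ?thesis by (simp add: abs_mult)
  qed
  have ind01: "0 \<le> (indicator {..<c} x :: real)" "(indicator {..<c} x :: real) \<le> 1" for x by auto
  let ?I = "LINT s|N. f (Y s) * indicator {..<c} (Y s)"
  have "{s \<in> space N. Y s = c} \<in> null_sets N"
    using no_atom by (auto simp: null_sets_def N.emeasure_eq_measure)
  then have ae: "AE s in N. Y s \<noteq> c" by (rule AE_I') auto
  have IN: "(\<lambda>n. LINT s|N. f (Y s) * l n (Y s)) \<longlonglongrightarrow> ?I"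
    by (rule integral_dominated_convergence[where w = "\<lambda>_. Bf"])
       (auto intro!: AE_I2 tendsto_mult l_lim abs_le lu01 conjunct1[OF Y_range] conjunct2[OF Y_range])
  have UN: "(\<lambda>n. LINT s|N. f (Y s) * u n (Y s)) \<longlonglongrightarrow> ?I"
  proof (rule integral_dominated_convergence[where w = "\<lambda>_. Bf"])
    show "AE s in N. (\<lambda>n. f (Y s) * u n (Y s)) \<longlonglongrightarrow> f (Y s) * indicator {..<c} (Y s)"
      using ae by eventually_elim (intro tendsto_mult tendsto_const u_lim)
    show "AE s in N. norm (f (Y s) * u n (Y s)) \<le> Bf" for n
      unfolding real_norm_def
      by (intro AE_I2 abs_le lu01 conjunct1[OF Y_range] conjunct2[OF Y_range])
  qed simp_all
  show ?thesis
  proof (rule tendstoI)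
    fix e :: real assume e: "e > 0"
    have "\<forall>\<^sub>F n in sequentially. dist (LINT s|N. f (Y s) * l n (Y s)) ?I < e / 2 \<and>
        dist (LINT s|N. f (Y s) * u n (Y s)) ?I < e / 2"
      using e by (intro eventually_conj tendstoD[OF IN] tendstoD[OF UN]) auto
    then obtain n where n: "dist (LINT s|N. f (Y s) * l n (Y s)) ?I < e / 2"
        "dist (LINT s|N. f (Y s) * u n (Y s)) ?I < e / 2"
      using eventually_happens[of _ sequentially] by auto
    have "\<forall>\<^sub>F y in F. dist (LINT t|M. W y t * (f (X y t) * l n (X y t))) (LINT s|N. f (Y s) * l n (Y s)) < e / 2"
      "\<forall>\<^sub>F y in F. dist (LINT t|M. W y t * (f (X y t) * u n (X y t))) (LINT s|N. f (Y s) * u n (Y s)) < e / 2"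
      using e by (intro tendstoD continuous_tendsto[OF lu_cont(1)] continuous_tendsto[OF lu_cont(2)]; simp)+
    with family show "\<forall>\<^sub>F y in F. dist (LINT t|M. W y t * (f (X y t) * indicator {..<c} (X y t))) ?I < e"
    proof eventually_elim
      case (elim y)
      have I: "integrable M (\<lambda>t. W y t * (f (X y t) * l n (X y t)))"
        "integrable M (\<lambda>t. W y t * (f (X y t) * u n (X y t)))"
        "integrable M (\<lambda>t. W y t * (f (X y t) * indicator {..<c} (X y t)))"
        using elim 
        by (intro integrable_W[where B = Bf and f = "\<lambda>x. f x * l n x"] 
           integrable_W[where B = Bf and f = "\<lambda>x. f x * u n x"]
           integrable_W[where B = Bf and f = "\<lambda>x. f x * indicator {..<c} x"] abs_le lu01 ind01; force)+
      have "(LINT t|M. W y t * (f (X y t) * l n (X y t))) \<le> (LINT t|M. W y t * (f (X y t) * indicator {..<c} (X y t)))"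
        "(LINT t|M. W y t * (f (X y t) * indicator {..<c} (X y t))) \<le> (LINT t|M. W y t * (f (X y t) * u n (X y t)))"
        using elim f_nonneg by (intro integral_mono I mult_left_mono l_le u_ge; force)+
      then show ?case using n elim unfolding dist_real_def by linarith
    qed
  qed
qed

end

section \<open>Slow variation and the class \<open>\<Pi>\<close>\<close>
lemma pos_meas_at_top_eventually_pos:
  assumes "pos_meas_at_top f" shows "\<forall>\<^sub>F x in at_top. 0 < f x"
  using assms unfolding pos_meas_at_top_def by (meson eventually_at_top_linorderI)

lemma slowly_varying_pos: "L \<in> reg_var 0 \<Longrightarrow> \<forall>\<^sub>F x in at_top. 0 < L x"
  by (auto simp: reg_var_def intro: pos_meas_at_top_eventually_pos)

lemma slowly_varyingD:
  assumes "L \<in> reg_var 0" "0 < l" shows "((\<lambda>x. L (l * x) / L x) \<longlongrightarrow> 1) at_top"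
proof -
  have "((\<lambda>x. L (l * x) / L x) \<longlongrightarrow> l powr 0) at_top"
    using assms by (simp add: reg_var_def del: powr_zero_eq_one)
  then show ?thesis using assms(2) by simp
qed

lemma eventually_at_top_scale:
  fixes l :: real
  assumes "eventually P at_top" "0 < l" shows "\<forall>\<^sub>F x in at_top. P (l * x)"
proof -
  have "filterlim (\<lambda>x. l * x) at_top at_top"
    using assms(2) by (intro filterlim_tendsto_pos_mult_at_top[OF tendsto_const] filterlim_ident)
  then show ?thesis using assms(1) by (simp add: filterlim_iff)
qed

lemma tendsto_at_top_scale:
  fixes l :: real
  assumes "(f \<longlongrightarrow> c) at_top" "0 < l" shows "((\<lambda>x. f (l * x)) \<longlongrightarrow> c) at_top"
proof -
  have "filterlim (\<lambda>x. l * x) at_top at_top"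
    using assms(2) by (intro filterlim_tendsto_pos_mult_at_top[OF tendsto_const] filterlim_ident)
  then show ?thesis using assms(1) by (rule filterlim_compose[rotated])
qed

text \<open>For a monotone function, \<open>V (x + s)\<close> lies between \<open>V (x / l)\<close> and \<open>V (l x)\<close> for every \<open>l > 1\<close>
  and large \<open>x\<close>, and the increments to these are of size \<open>\<bar>c\<bar> ln l\<close> on the scale \<open>L\<close>.\<close>
lemma Pi_shift_negligible:
  fixes V L :: "real \<Rightarrow> real"
  assumes mono: "mono_on {a<..} V"
    and L_pos: "\<forall>\<^sub>F x in at_top. 0 < L x"
    and Pi: "\<And>l. 0 < l \<Longrightarrow> ((\<lambda>x. (V (l * x) - V x) / L x) \<longlongrightarrow> c * ln l) at_top"
  shows "((\<lambda>x. (V (x + s) - V x) / L x) \<longlongrightarrow> 0) at_top"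
proof (rule tendstoI)
  fix e :: real assume e: "e > 0"
  define l where "l = exp (e / (2 * (\<bar>c\<bar> + 1)))"
  have l: "1 < l" using e by (simp add: l_def)
  have "\<bar>c * ln l\<bar> < e"
  proof -
    have "\<bar>c * ln l\<bar> = \<bar>c\<bar> / (\<bar>c\<bar> + 1) * (e / 2)"
      using e by (simp add: l_def abs_mult field_simps)
    also have "\<dots> \<le> 1 * (e / 2)" using e by (intro mult_right_mono) (auto simp: field_simps)
    finally show ?thesis using e by linarith
  qed
  then have c: "c * ln l < e" "- e < c * ln (1 / l)" using l by (auto simp: ln_div)
  have "\<forall>\<^sub>F x in at_top. (V (l * x) - V x) / L x < e"
    using Pi[of l] c l by (intro order_tendstoD) auto
  moreover have "\<forall>\<^sub>F x in at_top. - e < (V (1 / l * x) - V x) / L x"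
    using Pi[of "1 / l"] c l by (intro order_tendstoD) auto
  moreover have "\<forall>\<^sub>F x in at_top. x + s \<le> l * x" "\<forall>\<^sub>F x in at_top. 1 / l * x \<le> x + s"
      "\<forall>\<^sub>F x in at_top. a < 1 / l * x" "\<forall>\<^sub>F x in at_top. a < l * x" "\<forall>\<^sub>F x in at_top. a < x + s"
    using l by real_asymp+
  ultimately show "\<forall>\<^sub>F x in at_top. dist ((V (x + s) - V x) / L x) 0 < e"
    using L_pos
  proof eventually_elim
    case (elim x)
    have "V (x + s) \<le> V (l * x)" "V (1 / l * x) \<le> V (x + s)"
      using elim by (auto intro!: mono_onD[OF mono])
    then have "(V (x + s) - V x) / L x \<le> (V (l * x) - V x) / L x"
        "(V (1 / l * x) - V x) / L x \<le> (V (x + s) - V x) / L x"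
      using elim by (auto intro!: divide_right_mono)
    then show ?case using elim by (auto simp: dist_real_def abs_less_iff)
  qed
qed

text \<open>This passes between \<open>U\<close> and \<open>x \<mapsto> U (x - 1)\<close>, the function in terms of which \<open>v\<close> is expressed.\<close>
lemma Pi_shift:
  fixes V L :: "real \<Rightarrow> real"
  assumes mono: "mono_on {a<..} V"
    and L: "L \<in> reg_var 0"
    and Pi: "\<And>l. 0 < l \<Longrightarrow> ((\<lambda>x. (V (l * x) - V x) / L x) \<longlongrightarrow> c * ln l) at_top"
    and l: "0 < l"
  shows "((\<lambda>x. (V (l * x + s) - V (x + s)) / L x) \<longlongrightarrow> c * ln l) at_top"
proof -
  note Lp = slowly_varying_pos[OF L]
  have s: "((\<lambda>x. (V (x + s) - V x) / L x) \<longlongrightarrow> 0) at_top"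
    by (rule Pi_shift_negligible[OF mono Lp Pi])
  have "((\<lambda>x. (V (l * x + s) - V (l * x)) / L (l * x) * (L (l * x) / L x)
      + (V (l * x) - V x) / L x - (V (x + s) - V x) / L x) \<longlongrightarrow> 0 * 1 + c * ln l - 0) at_top"
    by (intro tendsto_intros s Pi l slowly_varyingD[OF L] tendsto_at_top_scale[OF s l])
  moreover have "\<forall>\<^sub>F x in at_top. (V (l * x + s) - V (l * x)) / L (l * x) * (L (l * x) / L x)
      + (V (l * x) - V x) / L x - (V (x + s) - V x) / L x = (V (l * x + s) - V (x + s)) / L x"
    using Lp eventually_at_top_scale[OF Lp l] by eventually_elim (simp add: field_simps)
  ultimately show ?thesis by (simp add: tendsto_cong)
qed

text \<open>Along \<open>2\<^sup>n X\<close> the function grows at least geometrically.\<close>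
lemma doubling_tendsto_at_top:
  fixes f :: "real \<Rightarrow> real"
  assumes mono: "mono_on {a<..} f" and pos: "\<forall>\<^sub>F x in at_top. 0 < f x"
    and lim: "((\<lambda>x. f (2 * x) / f x) \<longlongrightarrow> A) at_top" and A: "1 < A"
  shows "filterlim f at_top at_top"
proof -
  define r where "r = (1 + A) / 2"
  have r: "1 < r" "r < A" using A by (auto simp: r_def)
  have "\<forall>\<^sub>F x in at_top. r < f (2 * x) / f x" by (rule order_tendstoD(1)[OF lim r(2)])
  then have "\<forall>\<^sub>F x in at_top. r < f (2 * x) / f x \<and> 0 < f x \<and> a < x \<and> 0 < x"
    using pos eventually_gt_at_top[of a] eventually_gt_at_top[of "0::real"] by eventually_elim auto
  then obtain X where X: "\<And>x. X \<le> x \<Longrightarrow> r < f (2 * x) / f x \<and> 0 < f x \<and> a < x \<and> 0 < x"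
    by (auto simp: eventually_at_top_linorder)
  have le: "r ^ n * f X \<le> f (2 ^ n * X)" for n
  proof (induction n)
    case (Suc n)
    have ge: "X \<le> 2 ^ n * X" using X[of X] by simp
    have "r ^ Suc n * f X \<le> r * f (2 ^ n * X)" using Suc r by simp
    also have "\<dots> \<le> f (2 * (2 ^ n * X))"
      using X[OF ge] pos_less_divide_eq less_imp_le by blast
    finally show ?case by (simp add: mult_ac)
  qed auto
  show ?thesis unfolding filterlim_at_top
  proof
    fix Z :: real
    obtain n where "Z / f X < r ^ n" using real_arch_pow[OF r(1)] by blast
    then have "Z < r ^ n * f X" using X[of X] by (simp add: field_simps)
    then have Z: "Z \<le> f (2 ^ n * X)" using le[of n] by linarith
    have ge: "X \<le> 2 ^ n * X" using X[of X] by simp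
    show "\<forall>\<^sub>F x in at_top. Z \<le> f x"
      using eventually_ge_at_top[of "2 ^ n * X"]
    proof eventually_elim
      case (elim x)
      have "f (2 ^ n * X) \<le> f x" using X[OF ge] elim by (intro mono_onD[OF mono]) auto
      then show ?case using Z by linarith
    qed
  qed
qed

section \<open>The potential of a Levy measure\<close>

text \<open>The increasing function \<open>U\<close> with \<open>v (- 1 / x) = \<gamma> - U (x - 1)\<close>. For
  \<open>z / (1 - z) = - 1 / x\<close> one has \<open>z = - 1 / (x - 1)\<close>.\<close>
definition levy_potential :: "ennreal measure \<Rightarrow> real \<Rightarrow> real" where
  "levy_potential \<sigma> y = - (LINT t|\<sigma>. lk_kernel (- (1 / y)) t)"

lemma lk_kernel_reciprocal:
  assumes "0 < y"
  shows "lk_kernel (- (1 / y)) t = (if t = \<infinity> then 1 / y else (enn2real t - y) / (1 + enn2real t * y))"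
proof -
  have "1 + enn2real t * y > 0" using assms by (intro add_pos_nonneg) auto
  then show ?thesis using assms by (auto simp: lk_kernel_def divide_simps) (auto simp: algebra_simps)
qed

lemma lk_kernel_diff:
  assumes "0 < y" "0 < z"
  shows "lk_kernel (- (1 / y)) t - lk_kernel (- (1 / z)) t =
    (if t = \<infinity> then 1 / y - 1 / z
     else (z - y) * (1 + (enn2real t)\<^sup>2) / ((1 + enn2real t * z) * (1 + enn2real t * y)))"
proof -
  have "1 + enn2real t * y > 0" "1 + enn2real t * z > 0"
    using assms by (auto intro!: add_pos_nonneg)
  then show ?thesis using assms
    by (simp add: lk_kernel_reciprocal divide_simps) (simp add: algebra_simps power2_eq_square)
qed

locale levy_measure = finite_measure \<sigma> for \<sigma> :: "ennreal measure" +
  assumes sets_levy [measurable_cong]: "sets \<sigma> = sets borel"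
begin

lemma space_levy [simp]: "space \<sigma> = UNIV"
  using sets_eq_imp_space_eq[OF sets_levy] by simp

lemma lk_kernel_integrable: assumes "0 < y" shows "integrable \<sigma> (lk_kernel (- (1 / y)))"
proof (rule integrable_const_bound[where B = "max y (1 / y)"])
  show "lk_kernel (- (1 / y)) \<in> borel_measurable \<sigma>"
    unfolding lk_kernel_def[abs_def] by measurable
  show "AE t in \<sigma>. norm (lk_kernel (- (1 / y)) t) \<le> max y (1 / y)"
  proof (rule AE_I2)
    fix t
    define r where "r = enn2real t"
    have r: "r \<ge> 0" by (simp add: r_def)
    then have p: "1 + r * y > 0" using assms by (intro add_pos_nonneg) auto
    have "(r - y) / (1 + r * y) \<le> 1 / y" "(y - r) / (1 + r * y) \<le> y"
      using p assms r by (auto simp: divide_simps algebra_simps)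
    then have "\<bar>(r - y) / (1 + r * y)\<bar> \<le> max y (1 / y)" 
      using minus_divide_left[of "r - y" "1 + r * y"] by (intro abs_leI) auto
    then show "norm (lk_kernel (- (1 / y)) t) \<le> max y (1 / y)"
      using assms by (auto simp: lk_kernel_reciprocal r_def)
  qed
qed

lemma levy_potential_diff:
  assumes "0 < y" "0 < z"
  shows "levy_potential \<sigma> z - levy_potential \<sigma> y = (LINT t|\<sigma>. lk_kernel (- (1 / y)) t - lk_kernel (- (1 / z)) t)"
  using lk_kernel_integrable[OF assms(1)] lk_kernel_integrable[OF assms(2)]
  by (simp add: levy_potential_def)

lemma levy_potential_mono: "mono_on {0<..} (levy_potential \<sigma>)"
proof (rule mono_onI)
  fix y z :: real assume yz: "y \<in> {0<..}" "z \<in> {0<..}" "y \<le> z"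
  have "0 \<le> (LINT t|\<sigma>. lk_kernel (- (1 / y)) t - lk_kernel (- (1 / z)) t)"
    using yz by (intro integral_nonneg_AE AE_I2)
      (auto simp: lk_kernel_diff frac_le intro!: divide_nonneg_nonneg mult_nonneg_nonneg add_nonneg_nonneg)
  then show "levy_potential \<sigma> y \<le> levy_potential \<sigma> z"
    using levy_potential_diff[of y z] yz by auto
qed

text \<open>The part of the increment \<open>U (l y) - U y\<close> that matters, without its factor \<open>(l - 1) y\<close>.\<close>
definition kernel_integral :: "real \<Rightarrow> real \<Rightarrow> real" where
  "kernel_integral l y = (LINT t|\<sigma>. indicator {..<\<infinity>} t / ((1 + l * (y * enn2real t)) * (1 + y * enn2real t)))"

lemma kernel_integral_integrable:
  assumes "0 < y" "0 < l"
  shows "integrable \<sigma> (\<lambda>t. indicator {..<\<infinity>} t / ((1 + l * (y * enn2real t)) * (1 + y * enn2real t)))"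
proof (rule integrable_const_bound[where B = 1])
  show "AE t in \<sigma>. norm (indicator {..<\<infinity>} t / ((1 + l * (y * enn2real t)) * (1 + y * enn2real t))) \<le> 1"
  proof (rule AE_I2)
    fix t
    have "1 * 1 \<le> (1 + l * (y * enn2real t)) * (1 + y * enn2real t)"
      using assms by (intro mult_mono) auto
    then show "norm (indicator {..<\<infinity>} t / ((1 + l * (y * enn2real t)) * (1 + y * enn2real t))) \<le> 1"
      by (auto simp: indicator_def divide_simps abs_mult)
  qed
qed measurable

text \<open>The kernel of the increment is \<open>(l - 1) (1 + t\<^sup>2) y / ((1 + l t y) (1 + t y))\<close> for finite \<open>t\<close>. The
  summand with \<open>t\<^sup>2\<close> is at most \<open>\<bar>l - 1\<bar> / (l y)\<close>, which is also the modulus of the kernel at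
  \<open>t = \<infinity>\<close>.\<close>
lemma levy_potential_increment:
  assumes y: "0 < y" and l: "0 < l"
  shows "\<bar>(levy_potential \<sigma> (l * y) - levy_potential \<sigma> y) - (l - 1) * y * kernel_integral l y\<bar>
    \<le> \<bar>l - 1\<bar> * measure \<sigma> UNIV / (l * y)"
proof -
  let ?k = "\<lambda>t. indicator {..<\<infinity>} t / ((1 + l * (y * enn2real t)) * (1 + y * enn2real t))"
  let ?d = "\<lambda>t. (lk_kernel (- (1 / y)) t - lk_kernel (- (1 / (l * y))) t) - (l - 1) * y * ?k t"
  have ly: "0 < l * y" using y l by simp
  have I: "integrable \<sigma> (\<lambda>t. lk_kernel (- (1 / y)) t - lk_kernel (- (1 / (l * y))) t)"
    using lk_kernel_integrable[OF y] lk_kernel_integrable[OF ly] by simp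
  have I': "integrable \<sigma> (\<lambda>t. (l - 1) * y * ?k t)"
    using kernel_integral_integrable[OF y l] by (rule integrable_mult_right)
  have b: "\<bar>?d t\<bar> \<le> \<bar>l - 1\<bar> / (l * y)" for t
  proof (cases "t = \<infinity>")
    case True
    have "1 / y - 1 / (l * y) = (l - 1) / (l * y)" using y l by (simp add: field_simps)
    then show ?thesis using True y l by (simp add: lk_kernel_reciprocal)
  next
    case False
    define r where "r = enn2real t"
    have r: "r \<ge> 0" by (simp add: r_def)
    have p: "1 + r * y > 0" "1 + r * (l * y) > 0" using r y l by (auto intro!: add_pos_nonneg)
    have "?d t = (l - 1) * (r\<^sup>2 * y / ((1 + r * (l * y)) * (1 + r * y)))"
    proof -
      have "indicator {..<\<infinity>} t = (1::real)" using False by (simp add: top.not_eq_extremum)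
      moreover have "lk_kernel (- (1 / y)) t - lk_kernel (- (1 / (l * y))) t
          = (l * y - y) * (1 + r\<^sup>2) / ((1 + r * (l * y)) * (1 + r * y))"
        using False by (simp add: lk_kernel_diff[OF y ly] r_def)
      ultimately show ?thesis
        using p unfolding r_def[symmetric]
        by (simp add: divide_simps mult_ac) (simp add: algebra_simps)
    qed
    moreover have "0 \<le> r\<^sup>2 * y / ((1 + r * (l * y)) * (1 + r * y))" using p y by simp
    moreover have "r\<^sup>2 * y / ((1 + r * (l * y)) * (1 + r * y)) \<le> 1 / (l * y)"
    proof -
      have "r\<^sup>2 * y * (l * y) = (r * (l * y)) * (r * y)" by (simp add: power2_eq_square)
      also have "\<dots> \<le> (1 + r * (l * y)) * (1 + r * y)"
        using r y l by (intro mult_mono) auto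
      finally show ?thesis using p y l by (simp add: divide_simps)
    qed
    ultimately have "\<bar>?d t\<bar> \<le> \<bar>l - 1\<bar> * (1 / (l * y))"
      by (simp only: abs_mult[of "l - 1"] abs_of_nonneg) (intro mult_left_mono, auto)
    then show ?thesis by simp
  qed
  have eq: "(levy_potential \<sigma> (l * y) - levy_potential \<sigma> y) - (l - 1) * y * kernel_integral l y = (LINT t|\<sigma>. ?d t)"
    unfolding levy_potential_diff[OF y ly] kernel_integral_def
    by (subst integral_mult_right_zero[symmetric], rule Bochner_Integration.integral_diff[OF I I', symmetric])
  have "\<bar>LINT t|\<sigma>. ?d t\<bar> \<le> (LINT t|\<sigma>. \<bar>?d t\<bar>)" by (rule integral_abs_bound)
  also have "\<dots> \<le> (LINT t|\<sigma>. \<bar>l - 1\<bar> / (l * y))"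
    by (rule integral_mono[OF integrable_abs[OF Bochner_Integration.integrable_diff[OF I I']] _ b]) simp
  finally show ?thesis unfolding eq by (simp add: mult.commute)
qed

lemma kernel_integral_of_increment:
  assumes yL: "filterlim (\<lambda>y. y * L y) at_top at_top" and l: "0 < l"
  shows "((\<lambda>y. (levy_potential \<sigma> (l * y) - levy_potential \<sigma> y) / L y) \<longlongrightarrow> c) at_top
    \<longleftrightarrow> ((\<lambda>y. (l - 1) * (y * kernel_integral l y / L y)) \<longlongrightarrow> c) at_top"
proof -
  let ?d = "\<lambda>y. (levy_potential \<sigma> (l * y) - levy_potential \<sigma> y) / L y - (l - 1) * (y * kernel_integral l y / L y)"
  define C where "C = \<bar>l - 1\<bar> * measure \<sigma> UNIV / l"
  have z: "(?d \<longlongrightarrow> 0) at_top"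
  proof (rule Lim_null_comparison)
    show "((\<lambda>y. C / (y * L y)) \<longlongrightarrow> 0) at_top"
      by (rule tendsto_divide_0[OF tendsto_const filterlim_at_top_imp_at_infinity[OF yL]])
    have "\<forall>\<^sub>F y in at_top. 0 < y * L y" using yL by (simp add: filterlim_at_top_dense)
    then show "\<forall>\<^sub>F y in at_top. norm (?d y) \<le> C / (y * L y)"
      using eventually_gt_at_top[of 0]
    proof eventually_elim
      case (elim y)
      then have L: "0 < L y" by (simp add: zero_less_mult_iff)
      have "?d y = ((levy_potential \<sigma> (l * y) - levy_potential \<sigma> y) - (l - 1) * y * kernel_integral l y) / L y"
        by (simp add: diff_divide_distrib)
      then have "norm (?d y) = \<bar>(levy_potential \<sigma> (l * y) - levy_potential \<sigma> y) - (l - 1) * y * kernel_integral l y\<bar> / L y"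
        using L by simp
      also have "\<dots> \<le> (\<bar>l - 1\<bar> * measure \<sigma> UNIV / (l * y)) / L y"
        using L elim l by (intro divide_right_mono levy_potential_increment) auto
      also have "\<dots> = C / (y * L y)" by (simp add: C_def)
      finally show ?case .
    qed
  qed
  show ?thesis
  proof
    assume "((\<lambda>y. (levy_potential \<sigma> (l * y) - levy_potential \<sigma> y) / L y) \<longlongrightarrow> c) at_top"
    from tendsto_diff[OF this z] show "((\<lambda>y. (l - 1) * (y * kernel_integral l y / L y)) \<longlongrightarrow> c) at_top" by simp
  next
    assume "((\<lambda>y. (l - 1) * (y * kernel_integral l y / L y)) \<longlongrightarrow> c) at_top"
    from tendsto_add[OF this z]
    show "((\<lambda>y. (levy_potential \<sigma> (l * y) - levy_potential \<sigma> y) / L y) \<longlongrightarrow> c) at_top" by simp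
  qed
qed

text \<open>The error term in \<open>levy_potential_increment\<close> is negligible on the scale \<open>L\<close>. Indeed \<open>E y = y (U (2 y) - U y)\<close> is
  increasing, because each of its kernels is, and it is asymptotic to \<open>ln 2\<close> times \<open>y L y\<close>. Since
  \<open>L\<close> varies slowly, \<open>E (2 y) / E y \<rightarrow> 2\<close>, so \<open>E\<close> cannot stay bounded.\<close>
lemma times_slowly_varying_at_top:
  assumes L: "L \<in> reg_var 0"
    and Pi: "\<And>l. 0 < l \<Longrightarrow> ((\<lambda>y. (levy_potential \<sigma> (l * y) - levy_potential \<sigma> y) / L y) \<longlongrightarrow> ln l) at_top"
  shows "filterlim (\<lambda>y. y * L y) at_top at_top"
proof -
  define E where "E y = y * (levy_potential \<sigma> (2 * y) - levy_potential \<sigma> y)" for y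
  have E_int: "E y = (LINT t|\<sigma>. y * (lk_kernel (- (1 / y)) t - lk_kernel (- (1 / (2 * y))) t))" if "0 < y" for y
    unfolding E_def using that by (subst levy_potential_diff) auto
  have E_mono: "mono_on {0<..} E"
  proof (rule mono_onI)
    fix y z :: real assume yz: "y \<in> {0<..}" "z \<in> {0<..}" "y \<le> z"
    have I: "integrable \<sigma> (\<lambda>t. y * (lk_kernel (- (1 / y)) t - lk_kernel (- (1 / (2 * y))) t))" if "0 < y" for y
      using that by (intro integrable_mult_right Bochner_Integration.integrable_diff lk_kernel_integrable) auto
    have *: "y * (lk_kernel (- (1 / y)) t - lk_kernel (- (1 / (2 * y))) t)
       \<le> z * (lk_kernel (- (1 / z)) t - lk_kernel (- (1 / (2 * z))) t)" for t
    proof (cases "t = \<infinity>")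
      case True
      then show ?thesis using yz by (simp add: lk_kernel_reciprocal field_simps)
    next
      case False
      define r where "r = enn2real t"
      have r: "r \<ge> 0" by (simp add: r_def)
      have eq: "x * (lk_kernel (- (1 / x)) t - lk_kernel (- (1 / (2 * x))) t)
          = (1 + r\<^sup>2) * (x / (1 + r * (2 * x)) * (x / (1 + r * x)))" if "0 < x" for x
        using that False by (simp add: lk_kernel_diff r_def power2_eq_square)
      have mono: "y / (1 + k * y) \<le> z / (1 + k * z)" if "0 \<le> k" for k
      proof -
        have "0 < 1 + k * y" "0 < 1 + k * z" using yz that by (auto intro!: add_pos_nonneg)
        then show ?thesis using yz by (simp add: divide_simps algebra_simps)
      qed
      have "y / (1 + r * (2 * y)) * (y / (1 + r * y)) \<le> z / (1 + r * (2 * z)) * (z / (1 + r * z))"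
        using mono[of r] mono[of "2 * r"] yz r
        by (intro mult_mono) (auto simp: mult_ac intro!: divide_nonneg_nonneg)
      then have "(1 + r\<^sup>2) * (y / (1 + r * (2 * y)) * (y / (1 + r * y)))
          \<le> (1 + r\<^sup>2) * (z / (1 + r * (2 * z)) * (z / (1 + r * z)))"
        by (rule mult_left_mono) simp
      then show ?thesis using yz eq[of y] eq[of z] by simp
    qed
    have "(LINT t|\<sigma>. y * (lk_kernel (- (1 / y)) t - lk_kernel (- (1 / (2 * y))) t))
        \<le> (LINT t|\<sigma>. z * (lk_kernel (- (1 / z)) t - lk_kernel (- (1 / (2 * z))) t))"
      using yz by (intro integral_mono I *) auto
    then show "E y \<le> E z" using yz E_int[of y] E_int[of z] by simp
  qed
  note Lp = slowly_varying_pos[OF L]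
  have EL: "((\<lambda>y. E y / (y * L y)) \<longlongrightarrow> ln 2) at_top"
  proof (rule Lim_transform_eventually[OF Pi[of 2]])
    show "\<forall>\<^sub>F y in at_top. (levy_potential \<sigma> (2 * y) - levy_potential \<sigma> y) / L y = E y / (y * L y)"
      using eventually_gt_at_top[of 0] by eventually_elim (simp add: E_def)
  qed simp
  have "\<forall>\<^sub>F y in at_top. 0 < E y / (y * L y)" by (rule order_tendstoD[OF EL]) simp
  then have E_pos: "\<forall>\<^sub>F y in at_top. 0 < E y"
    using Lp eventually_gt_at_top[of 0] by eventually_elim (auto simp: zero_less_divide_iff zero_less_mult_iff mult_less_0_iff)
  have "((\<lambda>y. 2 * (E (2 * y) / (2 * y * L (2 * y))) * (L (2 * y) / L y) / (E y / (y * L y)))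
      \<longlongrightarrow> 2 * ln 2 * 1 / ln 2) at_top"
    by (intro tendsto_intros EL slowly_varyingD[OF L] tendsto_at_top_scale[OF EL]) auto
  moreover have "\<forall>\<^sub>F y in at_top. 2 * (E (2 * y) / (2 * y * L (2 * y))) * (L (2 * y) / L y) / (E y / (y * L y))
      = E (2 * y) / E y"
    using Lp eventually_at_top_scale[OF Lp, of 2, simplified] eventually_gt_at_top[of 0]
    by eventually_elim (simp add: field_simps)
  ultimately have "((\<lambda>y. E (2 * y) / E y) \<longlongrightarrow> 2) at_top"
    by (rule Lim_transform_eventually[THEN tendsto_eq_rhs]) simp
  from doubling_tendsto_at_top[OF E_mono E_pos this] have Einf: "filterlim E at_top at_top" by simp
  have "((\<lambda>y. inverse (E y / (y * L y))) \<longlongrightarrow> inverse (ln 2)) at_top"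
    by (intro tendsto_inverse EL) simp
  then have "filterlim (\<lambda>y. inverse (E y / (y * L y)) * E y) at_top at_top"
    by (rule filterlim_tendsto_pos_mult_at_top) (use Einf in auto)
  moreover have "\<forall>\<^sub>F y in at_top. inverse (E y / (y * L y)) * E y = y * L y"
    using E_pos by eventually_elim simp
  ultimately show ?thesis by (simp add: filterlim_cong)
qed

end

section \<open>The logarithmic Tauberian theorem\<close>
lemma LINT_unit_interval:
  fixes f :: "real \<Rightarrow> real"
  shows "(LINT s|restrict_space lborel {0..1}. f s) = (LINT s|lborel. f s * indicator {0..1} s)"
  by (subst integral_restrict_space) (auto simp: mult.commute)

lemma unit_interval_transform:
  fixes m :: real
  assumes "0 < \<bar>m\<bar>" "\<bar>m\<bar> < 1 / 2"
  shows "(LINT s|restrict_space lborel {0..1}. 1 / (1 + m * s)) = ln (1 + m) / m"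
proof -
  have pos: "1 + m * s > 0" if "0 \<le> s" "s \<le> 1" for s
  proof -
    have "\<bar>m * s\<bar> \<le> \<bar>m\<bar> * 1" unfolding abs_mult using that by (intro mult_left_mono) auto
    then show ?thesis using assms by linarith
  qed
  have "(LINT s|lborel. 1 / (1 + m * s) * indicator {0..1} s) = ln (1 + m * 1) / m - ln (1 + m * 0) / m"
    by (rule integral_FTC_Icc_real)
       (use pos assms in \<open>auto intro!: derivative_eq_intros continuous_intros simp: less_imp_neq[symmetric]\<close>)
  then show ?thesis by (simp add: LINT_unit_interval)
qed

lemma unit_interval_half:
  "(LINT s|restrict_space lborel {0..1::real}. 1 / (max (1 - s) (1 / 2))\<^sup>2 * indicator {..<1 / 2} s) = 1"
proof -
  have "(LINT s|lborel. 1 / (max (1 - s) (1 / 2))\<^sup>2 * indicator {..<1 / 2} s * indicator {0..1} s)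
      = (LINT s|lborel. 1 / (1 - s)\<^sup>2 * indicator {0..1 / 2} s :: real)"
    using AE_lborel_singleton[of "1 / 2 :: real"]
    by (intro integral_cong_AE) (auto elim!: eventually_mono simp: indicator_def max_def)
  also have "\<dots> = 1 / (1 - 1 / 2) - 1 / (1 - 0)"
    by (rule integral_FTC_Icc_real)
       (auto intro!: derivative_eq_intros continuous_intros simp: power2_eq_square)
  finally show ?thesis by (simp add: LINT_unit_interval)
qed

text \<open>The limit law is Lebesgue measure on the unit interval. The function \<open>1 / (1 - x)\<^sup>2\<close> undoes the
  weight in the applications; the maximum with \<open>1 / 2\<close> only makes it continuous on \<open>[0, 1]\<close> and has
  no effect where \<open>x < 1 / 2\<close>.\<close>
lemma log_tauberian:
  fixes W X :: "'c \<Rightarrow> 'a \<Rightarrow> real"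
  assumes family: "\<forall>\<^sub>F y in F. integrable M (W y) \<and> X y \<in> borel_measurable M \<and>
      (\<forall>t\<in>space M. 0 \<le> W y t \<and> 0 \<le> X y t \<and> X y t \<le> 1)"
    and lim: "\<And>l. 0 < l \<Longrightarrow> ((\<lambda>y. (l - 1) * (LINT t|M. W y t / (1 + (l - 1) * X y t))) \<longlongrightarrow> ln l) F"
  shows "((\<lambda>y. LINT t|M. W y t * (1 / (max (1 - X y t) (1 / 2))\<^sup>2 * indicator {..<1 / 2} (X y t))) \<longlongrightarrow> 1) F"
proof -
  interpret finite_measure "restrict_space lborel {0..1::real}"
    by (rule finite_measureI) (simp add: emeasure_restrict_space space_restrict_space)
  interpret stieltjes_limit "restrict_space lborel {0..1::real}" M F W X "\<lambda>s. s"
  proof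
    fix m :: real assume m: "0 < \<bar>m\<bar>" "\<bar>m\<bar> < 1 / 2"
    have "((\<lambda>y. (1 + m - 1) * (LINT t|M. W y t / (1 + (1 + m - 1) * X y t)) / m) \<longlongrightarrow> ln (1 + m) / m) F"
      using m by (intro tendsto_divide lim tendsto_const) auto
    then show "((\<lambda>y. LINT t|M. W y t / (1 + m * X y t)) \<longlongrightarrow> (LINT s|restrict_space lborel {0..1}. 1 / (1 + m * s))) F"
      using m by (simp add: unit_interval_transform)
  qed (use family in \<open>auto intro: measurable_restrict_space1\<close>)
  have "((\<lambda>y. LINT t|M. W y t * (1 / (max (1 - X y t) (1 / 2))\<^sup>2 * indicator {..<1 / 2} (X y t)))
      \<longlongrightarrow> (LINT s|restrict_space lborel {0..1}. 1 / (max (1 - s) (1 / 2))\<^sup>2 * indicator {..<1 / 2} s)) F"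
  proof (rule truncated_tendsto)
    show "continuous_on UNIV (\<lambda>x. 1 / (max (1 - x) (1 / 2))\<^sup>2 :: real)"
      by (intro continuous_intros) (auto simp: max_def)
    have "{s \<in> space (restrict_space lborel {0..1::real}). s = 1 / 2} = {1 / 2}" by auto
    then show "measure (restrict_space lborel {0..1}) {s \<in> space (restrict_space lborel {0..1::real}). s = 1 / 2} = 0"
      by (simp add: measure_restrict_space)
  qed auto
  then show ?thesis by (simp only: unit_interval_half)
qed

section \<open>Mass near zero and increments of the potential\<close>

text \<open>The kernel of \<open>kernel_integral\<close> in the variable \<open>s = t y\<close>.\<close>
definition log_kernel :: "real \<Rightarrow> real \<Rightarrow> real" where
  "log_kernel l s = 1 / ((1 + l * s) * (1 + s))"

text \<open>Minus the derivative of \<open>log_kernel\<close>, which makes \<open>log_kernel\<close> a mixture of indicators of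
  intervals \<open>[0, s)\<close>.\<close>
definition log_kernel_density :: "real \<Rightarrow> real \<Rightarrow> real" where
  "log_kernel_density l s = l / ((1 + l * s)\<^sup>2 * (1 + s)) + 1 / ((1 + l * s) * (1 + s)\<^sup>2)"

lemma log_kernel_density_measurable [measurable]: "log_kernel_density l \<in> borel_measurable borel"
  unfolding log_kernel_density_def[abs_def] by measurable

lemma log_kernel_density_nonneg: "0 < l \<Longrightarrow> 0 \<le> s \<Longrightarrow> 0 \<le> log_kernel_density l s"
  unfolding log_kernel_density_def by (intro add_nonneg_nonneg divide_nonneg_nonneg) auto

lemma log_kernel_deriv:
  assumes "0 < l" "0 \<le> s" shows "((\<lambda>s. - log_kernel l s) has_real_derivative log_kernel_density l s) (at s)"
proof -
  have "1 + l * s > 0" "1 + s > 0" using assms by (auto intro!: add_pos_nonneg)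
  then show ?thesis unfolding log_kernel_def log_kernel_density_def
    by (auto intro!: derivative_eq_intros simp: divide_simps power2_eq_square)
qed

lemma log_kernel_tail:
  assumes "0 < l" "0 \<le> a"
  shows "(\<integral>\<^sup>+ s. ennreal (log_kernel_density l s) * indicator {a<..} s \<partial>lborel) = ennreal (log_kernel l a)"
proof -
  have "(\<integral>\<^sup>+ s. ennreal (log_kernel_density l s) * indicator {a<..} s \<partial>lborel)
      = (\<integral>\<^sup>+ s. ennreal (log_kernel_density l s) * indicator {a..} s \<partial>lborel)"
    using AE_lborel_singleton[of a]
    by (intro nn_integral_cong_AE) (auto elim!: eventually_mono simp: indicator_def)
  also have "\<dots> = ennreal (0 - (- log_kernel l a))"
  proof (rule nn_integral_FTC_atLeast)
    show "((\<lambda>s. - log_kernel l s) \<longlongrightarrow> 0) at_top" unfolding log_kernel_def using assms by real_asymp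
  qed (use assms in \<open>auto intro!: log_kernel_deriv log_kernel_density_nonneg\<close>)
  finally show ?thesis by simp
qed

text \<open>This is the integral of \<open>log_kernel l\<close> over \<open>{0..}\<close>, integrated by parts: if the mass below \<open>s\<close>
  is \<open>s\<close> itself, the kernel integral is \<open>ln l / (l - 1)\<close>.\<close>
lemma log_kernel_density_moment:
  assumes l: "0 < l" "l \<noteq> 1"
  shows "(\<integral>\<^sup>+ s. ennreal (s * log_kernel_density l s) * indicator {0..} s \<partial>lborel) = ennreal (ln l / (l - 1))"
proof -
  let ?G = "\<lambda>s. s * (- log_kernel l s) + (ln (1 + l * s) - ln (1 + s)) / (l - 1)"
  have "(\<integral>\<^sup>+ s. ennreal (s * log_kernel_density l s) * indicator {0..} s \<partial>lborel) = ennreal (ln l / (l - 1) - ?G 0)"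
  proof (rule nn_integral_FTC_atLeast)
    fix s :: real assume s: "0 \<le> s"
    have p: "1 + l * s > 0" "1 + s > 0" using l s by (auto intro!: add_pos_nonneg)
    have "((\<lambda>s. (ln (1 + l * s) - ln (1 + s)) / (l - 1)) has_real_derivative
        (l / (1 + l * s) - 1 / (1 + s)) / (l - 1)) (at s)"
      using p l by (auto intro!: derivative_eq_intros)
    from DERIV_add[OF DERIV_mult'[OF DERIV_ident log_kernel_deriv[OF l(1) s]] this]
    have "(?G has_real_derivative (s * log_kernel_density l s + 1 * (- log_kernel l s)) + (l / (1 + l * s) - 1 / (1 + s)) / (l - 1)) (at s)" .
    moreover have "(l / (1 + l * s) - 1 / (1 + s)) / (l - 1) = log_kernel l s"
      using p l unfolding log_kernel_def by (simp add: divide_simps) (simp add: algebra_simps)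
    ultimately show "(?G has_real_derivative s * log_kernel_density l s) (at s)" by (simp add: mult.commute)
  next
    have "((\<lambda>s. ln (1 + l * s) - ln (1 + s)) \<longlongrightarrow> ln l) at_top" using l by real_asymp
    moreover have "((\<lambda>s. s * (- log_kernel l s)) \<longlongrightarrow> 0) at_top" unfolding log_kernel_def using l by real_asymp
    ultimately have "(?G \<longlongrightarrow> 0 + ln l / (l - 1)) at_top" using l by (intro tendsto_intros) auto
    then show "(?G \<longlongrightarrow> ln l / (l - 1)) at_top" by simp
  qed (use l in \<open>auto intro!: mult_nonneg_nonneg log_kernel_density_nonneg\<close>)
  then show ?thesis by simp
qed

lemma log_kernel_density_bound:
  assumes "0 < l" obtains C where "\<And>s. 0 \<le> s \<Longrightarrow> log_kernel_density l s \<le> C / (1 + s) ^ 3"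
proof
  fix s :: real assume s: "0 \<le> s"
  define m where "m = min 1 l"
  have m: "0 < m" "m \<le> 1" "m \<le> l" using assms by (auto simp: m_def)
  have ge: "m * (1 + s) \<le> 1 + l * s"
    using m s by (simp add: distrib_left add_mono mult_right_mono)
  have p: "0 < m * (1 + s)" using m s by simp
  have q: "0 < 1 + l * s" using ge p by linarith
  have "l / ((1 + l * s)\<^sup>2 * (1 + s)) \<le> l / ((m * (1 + s))\<^sup>2 * (1 + s))"
    using ge p q s m assms by (intro divide_left_mono mult_right_mono power_mono mult_pos_pos zero_less_power) auto
  moreover have "1 / ((1 + l * s) * (1 + s)\<^sup>2) \<le> 1 / ((m * (1 + s)) * (1 + s)\<^sup>2)"
    using ge p q s m by (intro divide_left_mono mult_right_mono mult_pos_pos) auto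
  ultimately have "log_kernel_density l s \<le> l / ((m * (1 + s))\<^sup>2 * (1 + s)) + 1 / ((m * (1 + s)) * (1 + s)\<^sup>2)"
    unfolding log_kernel_density_def by linarith
  also have "\<dots> = (l / m\<^sup>2 + 1 / m) / (1 + s) ^ 3"
    using m s by (simp add: power2_eq_square power3_eq_cube add_divide_distrib mult_ac)
  finally show "log_kernel_density l s \<le> (l / (min 1 l)\<^sup>2 + 1 / min 1 l) / (1 + s) ^ 3" unfolding m_def .
qed

lemma integrable_power_tail: "integrable lborel (\<lambda>s. indicator {0..} s * (C * (1 + s) powr (- 3 / 2)) :: real)"
proof -
  have "(\<integral>\<^sup>+ s. ennreal ((1 + s) powr (- 3 / 2)) * indicator {0..} s \<partial>lborel) = ennreal (0 - (- 2 * (1 + 0) powr (- 1 / 2)))"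
  proof (rule nn_integral_FTC_atLeast)
    show "((\<lambda>s::real. - 2 * (1 + s) powr (- 1 / 2)) \<longlongrightarrow> 0) at_top" by real_asymp
  qed (auto intro!: derivative_eq_intros)
  then have "integrable lborel (\<lambda>s. indicator {0..} s * ((1 + s) powr (- 3 / 2)) :: real)"
    by (intro integrableI_nonneg)
       (auto simp: ennreal_mult'' ennreal_indicator mult.commute[of "indicator _ _"])
  from integrable_mult_right[OF this, of C] show ?thesis by (simp add: mult_ac)
qed

context levy_measure begin

definition mass_below :: "real \<Rightarrow> real" where "mass_below x = measure \<sigma> {0..<ennreal x}"

lemma mass_below_mono: "x \<le> y \<Longrightarrow> mass_below x \<le> mass_below y"
  unfolding mass_below_def by (intro finite_measure_mono) (auto intro!: less_le_trans ennreal_leI)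

lemma mass_below_bounded: "mass_below x \<le> measure \<sigma> UNIV"
  unfolding mass_below_def by (intro finite_measure_mono) auto

lemma mass_below_nonneg: "0 \<le> mass_below x" by (simp add: mass_below_def)

lemma less_ennreal_iff: "0 < y \<Longrightarrow> t \<in> {0..<ennreal (s / y)} \<longleftrightarrow> t < \<infinity> \<and> y * enn2real t < s"
  by (cases t) (auto simp: ennreal_less_iff pos_less_divide_eq mult.commute)

text \<open>Substitute \<open>X = t y / (1 + t y)\<close> with weight \<open>y / ((1 + t y)\<^sup>2 L y)\<close>; then \<open>X < 1 / 2\<close> means
  \<open>t < 1 / y\<close>, and \<open>1 / (1 - X)\<^sup>2 = (1 + t y)\<^sup>2\<close> cancels the weight. At \<open>t = \<infinity>\<close> the weight vanishes;
  there \<open>X\<close> is \<open>0\<close> by the convention for \<open>enn2real\<close>.\<close>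
lemma mass_below_of_increment:
  assumes L: "L \<in> reg_var 0"
    and Pi: "\<And>l. 0 < l \<Longrightarrow> ((\<lambda>y. (levy_potential \<sigma> (l * y) - levy_potential \<sigma> y) / L y) \<longlongrightarrow> ln l) at_top"
  shows "((\<lambda>y. y * mass_below (1 / y) / L y) \<longlongrightarrow> 1) at_top"
proof -
  note yL = times_slowly_varying_at_top[OF L Pi]
  define W where "W y t = y / L y * (indicator {..<\<infinity>} t / ((1 + y * enn2real t) * (1 + y * enn2real t)))" for y t
  define X where "X y t = y * enn2real t / (1 + y * enn2real t)" for y t
  have XW: "1 + (l - 1) * X y t = (1 + l * (y * enn2real t)) / (1 + y * enn2real t)" if "0 < y" for l y t
  proof -
    have "0 < 1 + y * enn2real t" using that by (intro add_pos_nonneg) auto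
    then show ?thesis by (simp add: X_def divide_simps) (simp add: algebra_simps)
  qed
  have J: "y * kernel_integral l y / L y = (LINT t|\<sigma>. W y t / (1 + (l - 1) * X y t))" if y: "0 < y" for l y
  proof -
    have "(LINT t|\<sigma>. W y t / (1 + (l - 1) * X y t))
       = (LINT t|\<sigma>. y / L y * (indicator {..<\<infinity>} t / ((1 + l * (y * enn2real t)) * (1 + y * enn2real t))))"
    proof (rule Bochner_Integration.integral_cong[OF refl])
      fix t
      have "0 < 1 + y * enn2real t" using y by (intro add_pos_nonneg) auto
      then show "W y t / (1 + (l - 1) * X y t) = y / L y * (indicator {..<\<infinity>} t / ((1 + l * (y * enn2real t)) * (1 + y * enn2real t)))"
        unfolding XW[OF y] by (simp add: W_def mult_ac)
    qed
    also have "\<dots> = y / L y * kernel_integral l y" unfolding kernel_integral_def by (rule integral_mult_right_zero)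
    finally show ?thesis by simp
  qed
  have "((\<lambda>y. LINT t|\<sigma>. W y t * (1 / (max (1 - X y t) (1 / 2))\<^sup>2 * indicator {..<1 / 2} (X y t))) \<longlongrightarrow> 1) at_top"
  proof (rule log_tauberian)
    show "\<forall>\<^sub>F y in at_top. integrable \<sigma> (W y) \<and> X y \<in> borel_measurable \<sigma> \<and>
      (\<forall>t\<in>space \<sigma>. 0 \<le> W y t \<and> 0 \<le> X y t \<and> X y t \<le> 1)"
      using slowly_varying_pos[OF L] eventually_gt_at_top[of 0]
    proof eventually_elim
      case (elim y)
      have "integrable \<sigma> (W y)"
        unfolding W_def[abs_def] using kernel_integral_integrable[of y 1] elim by (intro integrable_mult_right) auto
      moreover have "X y \<in> borel_measurable \<sigma>" unfolding X_def[abs_def] by measurable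
      moreover have "0 \<le> W y t \<and> 0 \<le> X y t \<and> X y t \<le> 1" for t
      proof -
        define r where "r = y * enn2real t"
        have r: "0 \<le> r" using elim by (simp add: r_def)
        then have "r / (1 + r) \<le> 1" by (simp add: divide_le_eq_1)
        then show ?thesis using elim r unfolding W_def X_def r_def[symmetric]
          by (auto intro!: mult_nonneg_nonneg divide_nonneg_nonneg)
      qed
      ultimately show ?case by simp
    qed
    fix l :: real assume l: "0 < l"
    have "((\<lambda>y. (l - 1) * (y * kernel_integral l y / L y)) \<longlongrightarrow> ln l) at_top"
      using kernel_integral_of_increment[OF yL l] Pi[OF l] by simp
    then show "((\<lambda>y. (l - 1) * (LINT t|\<sigma>. W y t / (1 + (l - 1) * X y t))) \<longlongrightarrow> ln l) at_top"
      by (rule Lim_transform_eventually)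
         (rule eventually_mono[OF eventually_gt_at_top[of 0]], simp only: J)
  qed
  moreover have "\<forall>\<^sub>F y in at_top.
     (LINT t|\<sigma>. W y t * (1 / (max (1 - X y t) (1 / 2))\<^sup>2 * indicator {..<1 / 2} (X y t))) = y * mass_below (1 / y) / L y"
    using eventually_gt_at_top[of 0]
  proof eventually_elim
    case (elim y)
    have "(LINT t|\<sigma>. W y t * (1 / (max (1 - X y t) (1 / 2))\<^sup>2 * indicator {..<1 / 2} (X y t)))
        = (LINT t|\<sigma>. y / L y * indicator {0..<ennreal (1 / y)} t)"
    proof (rule Bochner_Integration.integral_cong[OF refl])
      fix t
      define r where "r = y * enn2real t"
      have r: "0 \<le> r" using elim by (simp add: r_def)
      have X: "X y t = r / (1 + r)" by (simp add: X_def r_def)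
      have X1: "1 - X y t = 1 / (1 + r)" and X2: "indicator {..<1 / 2} (X y t) = (if r < 1 then 1 else 0 :: real)"
        using r by (auto simp: X field_simps indicator_def)
      have "indicator {0..<ennreal (1 / y)} t = (if t < \<infinity> \<and> r < 1 then 1 else 0 :: real)"
        using less_ennreal_iff[OF elim, of t 1] by (auto simp: indicator_def r_def)
      moreover have "max (1 / (1 + r)) (1 / 2) = 1 / (1 + r)" if "r < 1"
        using that r by (auto simp: max_def divide_simps)
      ultimately show "W y t * (1 / (max (1 - X y t) (1 / 2))\<^sup>2 * indicator {..<1 / 2} (X y t))
          = y / L y * indicator {0..<ennreal (1 / y)} t"
        using r unfolding X1 X2 W_def r_def[symmetric]
        by (auto simp: indicator_def power2_eq_square)
    qed
    also have "\<dots> = y / L y * mass_below (1 / y)" by (simp add: mass_below_def)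
    finally show ?case by simp
  qed
  ultimately show ?thesis by (simp add: tendsto_cong)
qed

text \<open>Integration by parts, in the form of Fubini's theorem for the mixture \<open>log_kernel_density\<close>.\<close>
lemma kernel_integral_as_integral_of_mass:
  assumes y: "0 < y" and l: "0 < l"
  shows "kernel_integral l y = (LINT s|lborel. indicator {0<..} s * log_kernel_density l s * mass_below (s / y))"
proof -
  interpret P: pair_sigma_finite lborel \<sigma>
    by (intro pair_sigma_finite.intro lborel.sigma_finite_measure_axioms sigma_finite_measure_axioms)
  have "kernel_integral l y = enn2real (\<integral>\<^sup>+ t. ennreal (indicator {..<\<infinity>} t / ((1 + l * (y * enn2real t)) * (1 + y * enn2real t))) \<partial>\<sigma>)"
    unfolding kernel_integral_def using y l by (intro integral_eq_nn_integral) (auto intro!: AE_I2)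
  also have "(\<integral>\<^sup>+ t. ennreal (indicator {..<\<infinity>} t / ((1 + l * (y * enn2real t)) * (1 + y * enn2real t))) \<partial>\<sigma>)
     = (\<integral>\<^sup>+ t. \<integral>\<^sup>+ s. indicator {..<\<infinity>} t * (ennreal (log_kernel_density l s) * indicator {y * enn2real t<..} s) \<partial>lborel \<partial>\<sigma>)"
  proof (rule nn_integral_cong)
    fix t
    have "(\<integral>\<^sup>+ s. indicator {..<\<infinity>} t * (ennreal (log_kernel_density l s) * indicator {y * enn2real t<..} s) \<partial>lborel)
        = indicator {..<\<infinity>} t * ennreal (log_kernel l (y * enn2real t))"
      using y l by (subst nn_integral_cmult) (auto simp: log_kernel_tail)
    then show "ennreal (indicator {..<\<infinity>} t / ((1 + l * (y * enn2real t)) * (1 + y * enn2real t)))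
      = (\<integral>\<^sup>+ s. indicator {..<\<infinity>} t * (ennreal (log_kernel_density l s) * indicator {y * enn2real t<..} s) \<partial>lborel)"
      by (simp add: log_kernel_def indicator_def)
  qed
  also have "\<dots> = (\<integral>\<^sup>+ s. \<integral>\<^sup>+ t. indicator {..<\<infinity>} t * (ennreal (log_kernel_density l s) * (if y * enn2real t < s then 1 else 0)) \<partial>\<sigma> \<partial>lborel)"
    by (subst P.Fubini'[symmetric]) (auto simp: indicator_def intro!: nn_integral_cong)
  also have "\<dots> = (\<integral>\<^sup>+ s. ennreal (indicator {0<..} s * log_kernel_density l s * mass_below (s / y)) \<partial>lborel)"
  proof (rule nn_integral_cong)
    fix s :: real
    show "(\<integral>\<^sup>+ t. indicator {..<\<infinity>} t * (ennreal (log_kernel_density l s) * (if y * enn2real t < s then 1 else 0)) \<partial>\<sigma>)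
      = ennreal (indicator {0<..} s * log_kernel_density l s * mass_below (s / y))"
    proof (cases "0 < s")
      case True
      have "(\<integral>\<^sup>+ t. indicator {..<\<infinity>} t * (ennreal (log_kernel_density l s) * (if y * enn2real t < s then 1 else 0)) \<partial>\<sigma>)
        = (\<integral>\<^sup>+ t. ennreal (log_kernel_density l s) * indicator {0..<ennreal (s / y)} t \<partial>\<sigma>)"
        using less_ennreal_iff[OF y, of _ s] by (intro nn_integral_cong) (auto simp: indicator_def)
      also have "\<dots> = ennreal (log_kernel_density l s) * emeasure \<sigma> {0..<ennreal (s / y)}"
        by (subst nn_integral_cmult_indicator) auto
      also have "\<dots> = ennreal (log_kernel_density l s * mass_below (s / y))"
        using l True by (simp add: mass_below_def emeasure_eq_measure ennreal_mult log_kernel_density_nonneg)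
      finally show ?thesis using True by simp
    next
      case False
      then have "\<not> y * enn2real t < s" for t using y by (auto simp: not_less intro: order_trans[of _ 0])
      then show ?thesis using False by simp
    qed
  qed
  also have "enn2real \<dots> = (LINT s|lborel. indicator {0<..} s * log_kernel_density l s * mass_below (s / y))"
  proof (rule integral_eq_nn_integral[symmetric])
    have "mono (\<lambda>s. mass_below (s / y))" using y by (auto intro!: monoI mass_below_mono divide_right_mono)
    then have [measurable]: "(\<lambda>s. mass_below (s / y)) \<in> borel_measurable borel" by (rule borel_measurable_mono)
    show "(\<lambda>s. indicator {0<..} s * log_kernel_density l s * mass_below (s / y)) \<in> borel_measurable lborel" by measurable
  qed (use l in \<open>auto intro!: AE_I2 mult_nonneg_nonneg mass_below_nonneg log_kernel_density_nonneg simp: indicator_def\<close>)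
  finally show ?thesis .
qed

context
  fixes L :: "real \<Rightarrow> real"
  assumes L: "L \<in> reg_var 0" and FL: "((\<lambda>y. y * mass_below (1 / y) / L y) \<longlongrightarrow> 1) at_top"
begin

lemma mass_below_scaled:
  assumes s: "0 < s" shows "((\<lambda>y. mass_below (s / y) * (y / L y)) \<longlongrightarrow> s) at_top"
proof -
  have s': "0 < 1 / s" using s by simp
  note Lp = slowly_varying_pos[OF L]
  have "((\<lambda>y. s * ((1 / s * y) * mass_below (1 / (1 / s * y)) / L (1 / s * y) * (L (1 / s * y) / L y))) \<longlongrightarrow> s * (1 * 1)) at_top"
    by (intro tendsto_intros tendsto_at_top_scale[OF FL s'] slowly_varyingD[OF L s'])
  moreover have "\<forall>\<^sub>F y in at_top. s * ((1 / s * y) * mass_below (1 / (1 / s * y)) / L (1 / s * y) * (L (1 / s * y) / L y))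
      = mass_below (s / y) * (y / L y)"
    using Lp eventually_at_top_scale[OF Lp s'] by eventually_elim (use s in \<open>simp add: field_simps\<close>)
  ultimately show ?thesis by (rule Lim_transform_eventually[THEN tendsto_eq_rhs]) simp
qed

lemma mass_below_pos: "\<forall>\<^sub>F y in at_top. 0 < mass_below (1 / y)"
proof -
  have "\<forall>\<^sub>F y in at_top. 0 < y * mass_below (1 / y) / L y" by (rule order_tendstoD[OF FL]) simp
  then show ?thesis using slowly_varying_pos[OF L] eventually_gt_at_top[of 0]
    by eventually_elim (auto simp: zero_less_divide_iff zero_less_mult_iff mult_less_0_iff)
qed

text \<open>A bound of Potter type. As the mass is monotone and doubling the argument multiplies it by
  about \<open>2 < 2\<^bsup>3/2\<^esup>\<close> near zero, it can be proved by repeated halving; beyond the range of that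
  estimate the total mass is used. The exponent \<open>3 / 2\<close> is large enough to allow for the error and
  small enough to be integrable against \<open>log_kernel_density\<close>, which decays like \<open>s\<^bsup>-3\<^esup>\<close>.\<close>
lemma mass_below_potter:
  "\<exists>C x0. 0 < C \<and> 0 < x0 \<and> (\<forall>y\<ge>x0. \<forall>s\<ge>1. mass_below (s / y) \<le> C * s powr (3 / 2) * mass_below (1 / y)) \<and> (\<forall>y\<ge>x0. 0 < mass_below (1 / y))"
proof -
  define A :: real where "A = 2 powr (3 / 2)"
  have "2 powr 1 < A" unfolding A_def by (intro powr_less_mono) auto
  then have A: "2 < A" by simp
  note Lp = slowly_varying_pos[OF L]
  have "((\<lambda>y. (mass_below (2 / y) * (y / L y)) / (mass_below (1 / y) * (y / L y))) \<longlongrightarrow> 2 / 1) at_top"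
    by (intro tendsto_divide mass_below_scaled) auto
  then have "\<forall>\<^sub>F y in at_top. (mass_below (2 / y) * (y / L y)) / (mass_below (1 / y) * (y / L y)) < A"
    using A by (intro order_tendstoD) auto
  then have "\<forall>\<^sub>F y in at_top. mass_below (2 / y) \<le> A * mass_below (1 / y) \<and> 0 < mass_below (1 / y) \<and> 0 < y"
    using Lp mass_below_pos eventually_gt_at_top[of 0]
  proof eventually_elim
    case (elim y)
    then have "mass_below (2 / y) / mass_below (1 / y) < A" by simp
    then show ?case using elim by (simp add: pos_divide_less_eq)
  qed
  then obtain x0 where x0: "\<And>y. x0 \<le> y \<Longrightarrow> mass_below (2 / y) \<le> A * mass_below (1 / y) \<and> 0 < mass_below (1 / y) \<and> 0 < y"
    by (auto simp: eventually_at_top_linorder)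
  have x0p: "0 < x0" using x0[of x0] by simp
  \<comment> \<open>Halve \<open>s\<close> until it lies in \<open>[1, 2]\<close>, staying in the range where doubling costs a factor \<open>A\<close>.\<close>
  have dyadic: "mass_below (s / y) \<le> A * s powr (3 / 2) * mass_below (1 / y)"
    if "1 \<le> s" "s \<le> 2 ^ n" "x0 * s \<le> y" for n s y
    using that
  proof (induction n arbitrary: s)
    case 0
    then have "s = 1" by simp
    then show ?case using A x0[of y] 0 by simp
  next
    case (Suc n)
    have xy: "x0 \<le> y" using Suc.prems x0p
      by (metis dual_order.trans less_imp_le mult.right_neutral mult_left_mono)
    note y = x0[OF xy]
    show ?case
    proof (cases "s \<le> 2")
      case True
      have "mass_below (s / y) \<le> mass_below (2 / y)" using True y by (intro mass_below_mono divide_right_mono) auto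
      also have "\<dots> \<le> A * mass_below (1 / y)" using y by simp
      also have "\<dots> \<le> A * s powr (3 / 2) * mass_below (1 / y)"
        using Suc.prems A y by (simp add: ge_one_powr_ge_zero)
      finally show ?thesis .
    next
      case False
      have "0 < x0 * s" using x0p False by simp
      moreover have "x0 * (s / 2) = x0 * s / 2" by simp
      ultimately have half: "x0 * (s / 2) \<le> y" using Suc.prems(3) by linarith
      then have "x0 \<le> y / (s / 2)" using False by (subst pos_le_divide_eq) auto
      from x0[OF this] have "mass_below (s / y) \<le> A * mass_below ((s / 2) / y)" using False by (simp add: field_simps)
      also have "mass_below ((s / 2) / y) \<le> A * (s / 2) powr (3 / 2) * mass_below (1 / y)"
        using half Suc.prems False by (intro Suc.IH) auto
      also have "A * (s / 2) powr (3 / 2) = s powr (3 / 2)"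
        using False by (simp add: A_def powr_divide)
      finally show ?thesis using A by (simp add: mult_ac)
    qed
  qed
  have dyadic': "mass_below (s / y) \<le> A * s powr (3 / 2) * mass_below (1 / y)" if "1 \<le> s" "x0 * s \<le> y" for s y
  proof -
    obtain n where "s < 2 ^ n" using real_arch_pow[of 2 s] by auto
    then show ?thesis using dyadic[of s n y] that by simp
  qed
  define K where "K = max 1 (measure \<sigma> UNIV / mass_below (1 / x0))"
  have F0: "0 < mass_below (1 / x0)" using x0[of x0] by simp
  have K: "1 \<le> K" "measure \<sigma> UNIV \<le> K * mass_below (1 / x0)"
    using F0 by (auto simp: K_def max_def field_simps)
  have "mass_below (s / y) \<le> K * A * s powr (3 / 2) * mass_below (1 / y)" if y: "x0 \<le> y" and s: "1 \<le> s" for s y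
  proof (cases "x0 * s \<le> y")
    case True
    have "mass_below (s / y) \<le> 1 * (A * s powr (3 / 2) * mass_below (1 / y))" using dyadic'[OF s True] by simp
    also have "\<dots> \<le> K * (A * s powr (3 / 2) * mass_below (1 / y))"
      using K A by (intro mult_right_mono) (auto simp: mass_below_nonneg)
    finally show ?thesis by (simp add: mult_ac)
  next
    case False
    have yp: "0 < y" using x0p y by simp
    have s0: "1 \<le> y / x0" "y / x0 \<le> s" using y False x0p by (auto simp: field_simps)
    have "mass_below (s / y) \<le> K * mass_below (1 / x0)" using mass_below_bounded[of "s / y"] K by linarith
    also have "mass_below (1 / x0) = mass_below ((y / x0) / y)" using yp by simp
    also have "\<dots> \<le> A * (y / x0) powr (3 / 2) * mass_below (1 / y)"
      using s0 x0p by (intro dyadic') auto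
    also have "\<dots> \<le> A * s powr (3 / 2) * mass_below (1 / y)"
      using s0 A by (intro mult_right_mono mult_left_mono powr_mono2) (auto simp: mass_below_nonneg)
    finally show ?thesis using K by (simp add: mult_ac)
  qed
  then show ?thesis using x0 x0p K A by (intro exI[of _ "K * A"] exI[of _ x0]) auto
qed

text \<open>Taking \<open>s = y / x0\<close> in the Potter bound gives a lower bound for the mass near zero, namely
  \<open>mass_below (1 / y) \<ge> c y\<^bsup>-3/2\<^esup>\<close>, and \<open>y L y \<sim> y\<^sup>2 mass_below (1 / y)\<close>.\<close>
lemma times_L_at_top: "filterlim (\<lambda>y. y * L y) at_top at_top"
proof -
  obtain C x0 where C: "0 < C" "0 < x0" "\<And>y s. x0 \<le> y \<Longrightarrow> 1 \<le> s \<Longrightarrow> mass_below (s / y) \<le> C * s powr (3 / 2) * mass_below (1 / y)"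
      "\<And>y. x0 \<le> y \<Longrightarrow> 0 < mass_below (1 / y)"
    using mass_below_potter by blast
  define c where "c = mass_below (1 / x0) / (C * x0 powr (-3 / 2))"
  have c: "0 < c" using C by (auto simp: c_def)
  have inv: "((\<lambda>y. inverse (y * mass_below (1 / y) / L y)) \<longlongrightarrow> inverse 1) at_top"
    by (intro tendsto_inverse FL) auto
  have "filterlim (\<lambda>y. c * sqrt y) at_top at_top" using c by real_asymp
  then have "filterlim (\<lambda>y. y\<^sup>2 * mass_below (1 / y)) at_top at_top"
  proof (rule filterlim_at_top_mono)
    show "\<forall>\<^sub>F y in at_top. c * sqrt y \<le> y\<^sup>2 * mass_below (1 / y)"
      using eventually_ge_at_top[of x0]
    proof eventually_elim
      case (elim y)
      have yp: "0 < y" using elim C by simp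
      have "mass_below (1 / x0) = mass_below ((y / x0) / y)" using yp by simp
      also have "\<dots> \<le> C * (y / x0) powr (3 / 2) * mass_below (1 / y)"
        using elim C by (intro C(3)) auto
      also have "(y / x0) powr (3 / 2) = y powr (3 / 2) * x0 powr (- 3 / 2)"
        using yp C by (simp add: powr_divide powr_minus_divide)
      finally have "c \<le> y powr (3 / 2) * mass_below (1 / y)"
        using C yp by (simp add: c_def field_simps)
      then have "c * sqrt y \<le> (y powr (3 / 2) * mass_below (1 / y)) * sqrt y"
        using yp by (intro mult_right_mono) auto
      also have "y powr (3 / 2) * sqrt y = y\<^sup>2"
        using yp by (simp add: powr_half_sqrt[symmetric] powr_add[symmetric] powr_numeral)
      then have "(y powr (3 / 2) * mass_below (1 / y)) * sqrt y = y\<^sup>2 * mass_below (1 / y)" by (simp add: mult_ac)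
      finally show ?case .
    qed
  qed
  then have "filterlim (\<lambda>y. inverse (y * mass_below (1 / y) / L y) * (y\<^sup>2 * mass_below (1 / y))) at_top at_top"
    by (rule filterlim_tendsto_pos_mult_at_top[OF inv, rotated]) simp
  moreover have "\<forall>\<^sub>F y in at_top. inverse (y * mass_below (1 / y) / L y) * (y\<^sup>2 * mass_below (1 / y)) = y * L y"
    using eventually_ge_at_top[of x0] slowly_varying_pos[OF L]
  proof eventually_elim
    case (elim y)
    then show ?case using C(2) C(4)[of y] by (simp add: field_simps power2_eq_square)
  qed
  ultimately show ?thesis by (simp add: filterlim_cong)
qed

lemma kernel_integral_limit:
  assumes l: "0 < l" "l \<noteq> 1"
  shows "((\<lambda>y. y * kernel_integral l y / L y) \<longlongrightarrow> ln l / (l - 1)) at_top"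
proof -
  obtain C x0 where C: "0 < C" "0 < x0" "\<And>y s. x0 \<le> y \<Longrightarrow> 1 \<le> s \<Longrightarrow> mass_below (s / y) \<le> C * s powr (3 / 2) * mass_below (1 / y)"
      "\<And>y. x0 \<le> y \<Longrightarrow> 0 < mass_below (1 / y)"
    using mass_below_potter by blast
  obtain D where D: "\<And>s. 0 \<le> s \<Longrightarrow> log_kernel_density l s \<le> D / (1 + s) ^ 3"
    using log_kernel_density_bound[OF l(1)] by blast
  have D0: "0 \<le> D" using D[of 0] log_kernel_density_nonneg[OF l(1), of 0] by simp
  have Fm: "(\<lambda>s. mass_below (s / y)) \<in> borel_measurable borel" if "0 < y" for y
    using that by (intro borel_measurable_mono monoI mass_below_mono divide_right_mono) auto
  let ?w = "\<lambda>s. indicator {0..} s * (D * (2 * (C + 1)) * (1 + s) powr (- 3 / 2)) :: real"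
  \<comment> \<open>\<open>max 1 y\<close> keeps the integrand measurable in \<open>s\<close> for every \<open>y\<close>.\<close>
  let ?s = "\<lambda>y s. indicator {0<..} s * log_kernel_density l s * (mass_below (s / max 1 y) * (y / L y))"
  have "\<forall>\<^sub>F y in at_top. y * mass_below (1 / y) / L y < 2"
    by (rule order_tendstoD[OF FL]) simp
  then have bound: "\<forall>\<^sub>F y in at_top. AE s in lborel. norm (?s y s) \<le> ?w s"
    using eventually_ge_at_top[of x0] eventually_ge_at_top[of 1] slowly_varying_pos[OF L]
  proof eventually_elim
    case (elim y)
    have yp: "0 < y" and m: "max 1 y = y" using elim by auto
    have "mass_below (s / y) * (y / L y) \<le> 2 * (C + 1) * (1 + s) powr (3 / 2)" if s: "0 < s" for s
    proof -
      have p1: "1 \<le> (1 + s) powr (3 / 2)" using s by (intro ge_one_powr_ge_zero) auto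
      have "mass_below (s / y) \<le> (C + 1) * (1 + s) powr (3 / 2) * mass_below (1 / y)"
      proof (cases "1 \<le> s")
        case True
        have "mass_below (s / y) \<le> C * s powr (3 / 2) * mass_below (1 / y)" using C elim True by simp
        also have "\<dots> \<le> (C + 1) * (1 + s) powr (3 / 2) * mass_below (1 / y)"
          using s C by (intro mult_right_mono mult_mono powr_mono2) (auto simp: mass_below_nonneg)
        finally show ?thesis .
      next
        case False
        have "mass_below (s / y) \<le> 1 * 1 * mass_below (1 / y)" using False yp by (auto intro!: mass_below_mono divide_right_mono)
        also have "\<dots> \<le> (C + 1) * (1 + s) powr (3 / 2) * mass_below (1 / y)"
          using C p1 by (intro mult_right_mono mult_mono) (auto simp: mass_below_nonneg)
        finally show ?thesis .
      qed
      then have "mass_below (s / y) * (y / L y) \<le> (C + 1) * (1 + s) powr (3 / 2) * mass_below (1 / y) * (y / L y)"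
        using yp elim by (intro mult_right_mono) auto
      also have "\<dots> = (C + 1) * (1 + s) powr (3 / 2) * (y * mass_below (1 / y) / L y)" by simp
      also have "\<dots> \<le> (C + 1) * (1 + s) powr (3 / 2) * 2"
        using C elim by (intro mult_left_mono) auto
      finally show ?thesis by (simp only: mult_ac)
    qed
    note Fb = this
    have "norm (?s y s) \<le> ?w s" for s
    proof (cases "0 < s")
      case True
      have nn: "0 \<le> mass_below (s / y) * (y / L y)" using yp elim by (auto simp: mass_below_nonneg)
      have "log_kernel_density l s * (mass_below (s / y) * (y / L y)) \<le> D / (1 + s) ^ 3 * (2 * (C + 1) * (1 + s) powr (3 / 2))"
        by (rule mult_mono[OF D Fb[OF True] _ nn]) (use True D0 in auto)
      also have "(1 + s) ^ 3 = (1 + s) powr 3" using True by (simp add: powr_numeral)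
      also have "D / (1 + s) powr 3 * (2 * (C + 1) * (1 + s) powr (3 / 2))
          = D * (2 * (C + 1)) * ((1 + s) powr (3 / 2) / (1 + s) powr 3)" by simp
      also have "(1 + s) powr (3 / 2) / (1 + s) powr 3 = (1 + s) powr (- 3 / 2)"
        unfolding powr_diff[symmetric] by simp
      finally have "log_kernel_density l s * (mass_below (s / y) * (y / L y)) \<le> ?w s" using True by simp
      moreover have "?s y s = log_kernel_density l s * (mass_below (s / y) * (y / L y))" using True by (simp add: m)
      moreover have "0 \<le> log_kernel_density l s * (mass_below (s / y) * (y / L y))"
        using True by (intro mult_nonneg_nonneg[OF log_kernel_density_nonneg[OF l(1)] nn]) auto
      ultimately show ?thesis by (simp only: real_norm_def abs_of_nonneg)
    qed (use C D0 in \<open>auto simp: indicator_def\<close>)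
    then show ?case by (intro AE_I2)
  qed
  have "((\<lambda>y. LINT s|lborel. ?s y s) \<longlongrightarrow> (LINT s|lborel. indicator {0<..} s * log_kernel_density l s * s)) at_top"
  proof (rule integral_dominated_convergence_at_top[where w = ?w])
    show "integrable lborel ?w" using integrable_power_tail[of "D * (2 * (C + 1))"] by simp
    show "AE s in lborel. ((\<lambda>y. ?s y s) \<longlongrightarrow> indicator {0<..} s * log_kernel_density l s * s) at_top"
    proof (rule AE_I2)
      fix s :: real
      show "((\<lambda>y. ?s y s) \<longlongrightarrow> indicator {0<..} s * log_kernel_density l s * s) at_top"
      proof (cases "0 < s")
        case True
        have "((\<lambda>y. mass_below (s / max 1 y) * (y / L y)) \<longlongrightarrow> s) at_top"
          by (rule Lim_transform_eventually[OF mass_below_scaled[OF True]])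
             (auto intro!: eventually_mono[OF eventually_ge_at_top[of 1]])
        then show ?thesis by (intro tendsto_intros)
      qed auto
    qed
    show "?s y \<in> borel_measurable lborel" for y
      using Fm[of "max 1 y"] by simp
  qed (use bound in auto)
  also have "(LINT s|lborel. indicator {0<..} s * log_kernel_density l s * s)
     = enn2real (\<integral>\<^sup>+ s. ennreal (indicator {0<..} s * log_kernel_density l s * s) \<partial>lborel)"
    using l by (intro integral_eq_nn_integral) (auto intro!: AE_I2 mult_nonneg_nonneg log_kernel_density_nonneg simp: indicator_def)
  also have "(\<integral>\<^sup>+ s. ennreal (indicator {0<..} s * log_kernel_density l s * s) \<partial>lborel)
     = (\<integral>\<^sup>+ s. ennreal (s * log_kernel_density l s) * indicator {0..} s \<partial>lborel)"
    by (intro nn_integral_cong) (auto simp: indicator_def mult.commute)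
  also have "enn2real \<dots> = ln l / (l - 1)"
    unfolding log_kernel_density_moment[OF l] using l
    by (cases "l > 1") (auto simp: divide_nonpos_neg)
  finally have "((\<lambda>y. LINT s|lborel. ?s y s) \<longlongrightarrow> ln l / (l - 1)) at_top" .
  then show ?thesis
  proof (rule Lim_transform_eventually)
    show "\<forall>\<^sub>F y in at_top. (LINT s|lborel. ?s y s) = y * kernel_integral l y / L y"
      using eventually_ge_at_top[of 1]
    proof eventually_elim
      case (elim y)
      have "(LINT s|lborel. ?s y s) = (LINT s|lborel. y / L y * (indicator {0<..} s * log_kernel_density l s * mass_below (s / y)))"
        using elim by (intro Bochner_Integration.integral_cong refl) (simp add: max_def mult_ac)
      also have "\<dots> = y / L y * kernel_integral l y"
        using elim l by (simp only: integral_mult_right_zero kernel_integral_as_integral_of_mass)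
      finally show ?case by simp
    qed
  qed
qed

lemma increment_of_mass:
  assumes l: "0 < l"
  shows "((\<lambda>y. (levy_potential \<sigma> (l * y) - levy_potential \<sigma> y) / L y) \<longlongrightarrow> ln l) at_top"
proof (cases "l = 1")
  case False
  have "((\<lambda>y. (l - 1) * (y * kernel_integral l y / L y)) \<longlongrightarrow> (l - 1) * (ln l / (l - 1))) at_top"
    by (intro tendsto_intros kernel_integral_limit l False)
  then show ?thesis using kernel_integral_of_increment[OF times_L_at_top l] False by simp
qed simp

end

end

section \<open>Exponentials of functions in the class \<open>\<Pi>\<close>\<close>
lemma pos_meas_at_top_mono:
  assumes mono: "mono_on {a<..} f" and pos: "\<And>x. a < x \<Longrightarrow> 0 < f x"
  shows "pos_meas_at_top f"
proof -
  have "mono_on {a + 1..} f" using mono by (rule mono_on_subset) auto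
  then have "set_borel_measurable borel {a + 1..} f"
    unfolding set_borel_measurable_def
    by (subst borel_measurable_restrict_space_iff[symmetric]) (auto intro: borel_measurable_mono_on_fnc)
  then show ?thesis unfolding pos_meas_at_top_def using pos by (intro exI[of _ "a + 1"]) auto
qed

lemma pos_meas_at_top_mult:
  assumes "pos_meas_at_top f" "pos_meas_at_top g"
  shows "pos_meas_at_top (\<lambda>x. f x * g x)"
proof -
  obtain X Y where X: "set_borel_measurable borel {X..} f" "\<forall>x\<ge>X. 0 < f x"
    and Y: "set_borel_measurable borel {Y..} g" "\<forall>x\<ge>Y. 0 < g x"
    using assms unfolding pos_meas_at_top_def by blast
  define Z where "Z = max X Y"
  have "set_borel_measurable borel {Z..} f" "set_borel_measurable borel {Z..} g"
    using X Y by (auto intro: set_borel_measurable_subset simp: Z_def)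
  then have "(\<lambda>x. (indicator {Z..} x *\<^sub>R f x) * (indicator {Z..} x *\<^sub>R g x)) \<in> borel_measurable borel"
    unfolding set_borel_measurable_def by (rule borel_measurable_times)
  also have "(\<lambda>x. (indicator {Z..} x *\<^sub>R f x) * (indicator {Z..} x *\<^sub>R g x))
      = (\<lambda>x. indicator {Z..} x *\<^sub>R (f x * g x))"
    by (auto simp: indicator_def)
  finally have "set_borel_measurable borel {Z..} (\<lambda>x. f x * g x)"
    unfolding set_borel_measurable_def .
  then show ?thesis unfolding pos_meas_at_top_def using X Y
    by (intro exI[of _ Z]) (auto simp: Z_def)
qed

lemma asymp_equiv_iff_ratio:
  fixes f g :: "'a \<Rightarrow> real"
  assumes "\<forall>\<^sub>F x in F. g x \<noteq> 0"
  shows "f \<sim>[F] g \<longleftrightarrow> ((\<lambda>x. f x / g x) \<longlongrightarrow> 1) F"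
  unfolding asymp_equiv_def using assms
  by (intro tendsto_cong) (auto elim!: eventually_mono)

context levy_measure begin

lemma mass_below_asymp_iff:
  assumes L: "L \<in> reg_var 0"
  shows "(\<lambda>x. measure \<sigma> {0..<ennreal x}) \<sim>[at_right 0] (\<lambda>x. x * L (1 / x))
    \<longleftrightarrow> ((\<lambda>y. y * mass_below (1 / y) / L y) \<longlongrightarrow> 1) at_top"
proof -
  have "(\<lambda>x. measure \<sigma> {0..<ennreal x}) \<sim>[at_right 0] (\<lambda>x. x * L (1 / x))
    \<longleftrightarrow> (\<lambda>y. mass_below (1 / y)) \<sim>[at_top] (\<lambda>y. 1 / y * L y)"
    unfolding at_right_to_top asymp_equiv_filtermap_iff mass_below_def by (simp add: inverse_eq_divide)
  also have "\<dots> \<longleftrightarrow> ((\<lambda>y. mass_below (1 / y) / (1 / y * L y)) \<longlongrightarrow> 1) at_top"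
  proof (rule asymp_equiv_iff_ratio)
    show "\<forall>\<^sub>F y in at_top. 1 / y * L y \<noteq> 0"
      using slowly_varying_pos[OF L] eventually_gt_at_top[of 0] by eventually_elim auto
  qed
  finally show ?thesis by (simp add: mult.commute)
qed

lemma Pi_potential_iff:
  assumes L: "L \<in> reg_var 0"
    and v: "\<And>x. 1 < x \<Longrightarrow> v (- 1 / x) = \<gamma> - levy_potential \<sigma> (x - 1)"
  shows "(\<lambda>x. v (- 1 / x)) \<in> Pi_class L (- 1) \<longleftrightarrow>
    (\<forall>l>0. ((\<lambda>y. (levy_potential \<sigma> (l * y) - levy_potential \<sigma> y) / L y) \<longlongrightarrow> ln l) at_top)"
proof -
  let ?U = "levy_potential \<sigma>" and ?V = "\<lambda>x. levy_potential \<sigma> (x - 1)"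
  have V_mono: "mono_on {1<..} ?V"
    by (intro mono_onI mono_onD[OF levy_potential_mono]) auto
  have v_diff: "\<forall>\<^sub>F x in at_top. (v (- 1 / (l * x)) - v (- 1 / x)) / L x = - ((?V (l * x) - ?V x) / L x)"
    if l: "0 < l" for l
    using eventually_gt_at_top[of 1] eventually_at_top_scale[OF eventually_gt_at_top[of 1] l]
  proof eventually_elim
    case (elim x)
    then show ?case by (simp only: v) (simp add: minus_divide_left)
  qed
  have "(\<lambda>x. v (- 1 / x)) \<in> Pi_class L (- 1) \<longleftrightarrow>
     (\<forall>l>0. ((\<lambda>x. - ((?V (l * x) - ?V x) / L x)) \<longlongrightarrow> - ln l) at_top)"
    using L tendsto_cong[OF v_diff] by (simp add: Pi_class_def)
  also have "\<dots> \<longleftrightarrow> (\<forall>l>0. ((\<lambda>x. (?V (l * x) - ?V x) / L x) \<longlongrightarrow> 1 * ln l) at_top)"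
    by (simp only: tendsto_minus_cancel_left[symmetric] minus_minus mult_1_left)
  also have "\<dots> \<longleftrightarrow> (\<forall>l>0. ((\<lambda>x. (?U (l * x) - ?U x) / L x) \<longlongrightarrow> 1 * ln l) at_top)"
  proof (intro iffI allI impI)
    fix l :: real
    assume A: "\<forall>l>0. ((\<lambda>x. (?V (l * x) - ?V x) / L x) \<longlongrightarrow> 1 * ln l) at_top" and l: "0 < l"
    have "((\<lambda>x. (?V (l * x + 1) - ?V (x + 1)) / L x) \<longlongrightarrow> 1 * ln l) at_top"
      by (rule Pi_shift[OF V_mono L _ l]) (use A in blast)
    then show "((\<lambda>x. (?U (l * x) - ?U x) / L x) \<longlongrightarrow> 1 * ln l) at_top" by simp
  next
    fix l :: real
    assume A: "\<forall>l>0. ((\<lambda>x. (?U (l * x) - ?U x) / L x) \<longlongrightarrow> 1 * ln l) at_top" and l: "0 < l"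
    have "((\<lambda>x. (?U (l * x + - 1) - ?U (x + - 1)) / L x) \<longlongrightarrow> 1 * ln l) at_top"
      by (rule Pi_shift[OF levy_potential_mono L _ l]) (use A in blast)
    then show "((\<lambda>x. (?V (l * x) - ?V x) / L x) \<longlongrightarrow> 1 * ln l) at_top" by simp
  qed
  finally show ?thesis by simp
qed

end

lemma exp_Pi_ratio:
  fixes V T L :: "real \<Rightarrow> real"
  assumes T: "\<And>x. 1 < x \<Longrightarrow> T x = exp (V x)"
    and L_pos: "\<forall>\<^sub>F x in at_top. 0 < L x"
    and Pi: "((\<lambda>x. (V (l * x) - V x) / L x) \<longlongrightarrow> c) at_top"
    and l: "0 < l" and r: "(L \<longlongrightarrow> r) at_top"
  shows "((\<lambda>x. T (l * x) / T x) \<longlongrightarrow> exp (r * c)) at_top"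
proof -
  have "((\<lambda>x. exp (L x * ((V (l * x) - V x) / L x))) \<longlongrightarrow> exp (r * c)) at_top"
    by (intro tendsto_intros Pi r)
  then show ?thesis
  proof (rule Lim_transform_eventually)
    show "\<forall>\<^sub>F x in at_top. exp (L x * ((V (l * x) - V x) / L x)) = T (l * x) / T x"
      using L_pos eventually_gt_at_top[of 1] eventually_at_top_scale[OF eventually_gt_at_top[of 1] l]
      by eventually_elim (simp add: T exp_diff)
  qed
qed

lemma exp_Pi_reg_var:
  fixes V T L :: "real \<Rightarrow> real"
  assumes mono: "mono_on {1<..} V" and T: "\<And>x. 1 < x \<Longrightarrow> T x = exp (V x)"
    and L_pos: "\<forall>\<^sub>F x in at_top. 0 < L x"
    and Pi: "\<And>l. 0 < l \<Longrightarrow> ((\<lambda>x. (V (l * x) - V x) / L x) \<longlongrightarrow> ln l) at_top"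
    and r: "(L \<longlongrightarrow> r) at_top"
  shows "T \<in> reg_var r"
proof -
  have "mono_on {1<..} T" using mono T by (auto simp: mono_on_def)
  then have "pos_meas_at_top T" by (rule pos_meas_at_top_mono) (simp add: T)
  moreover have "((\<lambda>x. T (l * x) / T x) \<longlongrightarrow> l powr r) at_top" if "0 < l" for l
    using exp_Pi_ratio[OF T L_pos Pi[OF that] that r] that by (simp add: powr_def)
  ultimately show ?thesis by (simp add: reg_var_def)
qed

text \<open>With \<open>D = V (l x) - V x\<close>, both \<open>D\<close> and \<open>D exp D\<close> bound \<open>exp D - 1\<close>, and \<open>exp D \<rightarrow> 1\<close>.\<close>
lemma exp_Pi_Pi_class:
  fixes V T L :: "real \<Rightarrow> real"
  assumes mono: "mono_on {1<..} V" and T: "\<And>x. 1 < x \<Longrightarrow> T x = exp (V x)"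
    and L: "L \<in> reg_var 0"
    and Pi: "\<And>l. 0 < l \<Longrightarrow> ((\<lambda>x. (V (l * x) - V x) / L x) \<longlongrightarrow> ln l) at_top"
    and r: "(L \<longlongrightarrow> 0) at_top"
  shows "T \<in> Pi_class (\<lambda>x. L x * T x) 1"
proof -
  note Lp = slowly_varying_pos[OF L]
  have TR: "T \<in> reg_var 0" by (rule exp_Pi_reg_var[OF mono T Lp Pi r])
  have "(\<lambda>x. L x * T x) \<in> reg_var 0"
  proof -
    have "((\<lambda>x. (L (l * x) * T (l * x)) / (L x * T x)) \<longlongrightarrow> l powr 0) at_top" if l: "0 < l" for l
    proof -
      have "((\<lambda>x. (L (l * x) / L x) * (T (l * x) / T x)) \<longlongrightarrow> 1 * 1) at_top"
        by (intro tendsto_mult slowly_varyingD L TR l)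
      then show ?thesis using l by simp
    qed
    then show ?thesis using L TR by (auto simp: reg_var_def intro: pos_meas_at_top_mult)
  qed
  moreover have "((\<lambda>x. (T (l * x) - T x) / (L x * T x)) \<longlongrightarrow> ln l) at_top" if l: "0 < l" for l
  proof -
    let ?D = "\<lambda>x. V (l * x) - V x"
    have ub: "((\<lambda>x. ?D x / L x * (T (l * x) / T x)) \<longlongrightarrow> ln l * 1) at_top"
      by (intro tendsto_mult Pi l slowly_varyingD TR)
    have ev: "\<forall>\<^sub>F x in at_top. ?D x / L x \<le> (T (l * x) - T x) / (L x * T x) \<and>
        (T (l * x) - T x) / (L x * T x) \<le> ?D x / L x * (T (l * x) / T x)"
      using Lp eventually_gt_at_top[of 1] eventually_at_top_scale[OF eventually_gt_at_top[of 1] l]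
    proof eventually_elim
      case (elim x)
      have e: "(T (l * x) - T x) / (L x * T x) = (exp (?D x) - 1) / L x"
        and e': "T (l * x) / T x = exp (?D x)"
        using elim by (simp_all add: T exp_diff divide_simps)
      have "?D x \<le> exp (?D x) - 1" using exp_ge_add_one_self[of "?D x"] by linarith
      moreover have "exp (?D x) - 1 \<le> ?D x * exp (?D x)"
      proof -
        have "1 - ?D x \<le> exp (- ?D x)" using exp_ge_add_one_self[of "- ?D x"] by linarith
        then have "(1 - ?D x) * exp (?D x) \<le> exp (- ?D x) * exp (?D x)" by (rule mult_right_mono) simp
        also have "\<dots> = 1" by (simp flip: exp_add)
        finally show ?thesis by (simp add: left_diff_distrib)
      qed
      ultimately have "?D x / L x \<le> (exp (?D x) - 1) / L x" "(exp (?D x) - 1) / L x \<le> ?D x * exp (?D x) / L x"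
        using elim by (auto intro!: divide_right_mono)
      then show ?case unfolding e e' by simp
    qed
    show ?thesis
    proof (rule tendsto_sandwich)
      show "((\<lambda>x. ?D x / L x) \<longlongrightarrow> ln l) at_top" by (rule Pi[OF l])
      show "((\<lambda>x. ?D x / L x * (T (l * x) / T x)) \<longlongrightarrow> ln l) at_top" using ub by simp
      show "\<forall>\<^sub>F x in at_top. ?D x / L x \<le> (T (l * x) - T x) / (L x * T x)"
        using ev by eventually_elim simp
      show "\<forall>\<^sub>F x in at_top. (T (l * x) - T x) / (L x * T x) \<le> ?D x / L x * (T (l * x) / T x)"
        using ev by eventually_elim simp
    qed
  qed
  ultimately show ?thesis by (simp add: Pi_class_def)
qed

text \<open>Here \<open>T (k x) / T x \<rightarrow> \<infinity>\<close> for each \<open>k > 1\<close>. Choose \<open>k\<close> with \<open>k\<^bsup>-b\<^esup> = e\<close>, where \<open>e < 1\<close> is the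
  bound to be beaten: steps of ratio \<open>k\<close> gain the factor \<open>k\<^sup>b\<close>, and monotonicity loses at most the
  factor \<open>e\<close> on the last incomplete step. This is uniform in \<open>l \<ge> 1\<close>.\<close>
lemma exp_Pi_KR_infinity:
  fixes V T L :: "real \<Rightarrow> real"
  assumes mono: "mono_on {1<..} V" and T: "\<And>x. 1 < x \<Longrightarrow> T x = exp (V x)"
    and Pi: "\<And>l. 0 < l \<Longrightarrow> ((\<lambda>x. (V (l * x) - V x) / L x) \<longlongrightarrow> ln l) at_top"
    and L: "filterlim L at_top at_top"
  shows "T \<in> KR_infinity"
proof -
  have T_mono: "mono_on {1<..} T" using mono T by (auto simp: mono_on_def)
  have T_pos: "0 < T x" if "1 < x" for x using T[OF that] by simp
  have "1 \<le> Liminf at_top (\<lambda>x. INF l\<in>{1..}. ereal (T (l * x) / (l powr a * T x)))" for a :: real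
    unfolding le_Liminf_iff
  proof (intro allI impI)
    fix y :: ereal assume y: "y < 1"
    then obtain e0 where e0: "y < ereal e0" "e0 < 1"
      using ereal_dense2 by (metis ereal_less(3))
    define e where "e = max e0 (1 / 2)"
    have e: "y < ereal e" "0 < e" "e < 1"
      using e0 by (auto simp: e_def intro: less_le_trans)
    define b where "b = max a 1"
    define k where "k = e powr (- 1 / b)"
    have b: "0 < b" "a \<le> b" by (auto simp: b_def)
    have k: "1 < k" 
    proof -
      have "e powr 0 < e powr (- 1 / b)" using e b by (intro powr_less_mono') auto
      then show ?thesis using e by (simp add: k_def)
    qed
    have kb: "k powr b = 1 / e" unfolding k_def powr_powr using e b by (simp add: powr_minus_divide)
    have "filterlim (\<lambda>x. (V (k * x) - V x) / L x * L x) at_top at_top"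
      by (rule filterlim_tendsto_pos_mult_at_top[OF Pi[of k] _ L]) (use k in auto)
    then have "\<forall>\<^sub>F x in at_top. ln (k powr b) < (V (k * x) - V x) / L x * L x"
      by (simp add: filterlim_at_top_dense)
    moreover have "\<forall>\<^sub>F x in at_top. 0 < L x" using L by (simp add: filterlim_at_top_dense)
    ultimately have "\<forall>\<^sub>F x in at_top. 1 < x \<and> k powr b * T x \<le> T (k * x)"
      using eventually_gt_at_top[of 1]
    proof eventually_elim
      case (elim x)
      have "1 * 1 < k * x" using elim k by (intro mult_strict_mono) auto
      then have kx: "1 < k * x" by simp
      have "k powr b * T x = exp (ln (k powr b) + V x)" using k elim by (simp add: T exp_add powr_def)
      also have "\<dots> \<le> exp (V (k * x))" using elim by simp
      finally show ?case using elim kx by (simp add: T)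
    qed
    then obtain X where X: "\<And>x. X \<le> x \<Longrightarrow> 1 < x \<and> k powr b * T x \<le> T (k * x)"
      by (auto simp: eventually_at_top_linorder)
    have claim: "e * l powr b * T x \<le> T (l * x)" if "X \<le> x" "1 \<le> l" "l \<le> k ^ n" for n l x
      using that
    proof (induction n arbitrary: l x)
      case 0
      then have "l = 1" by simp
      then show ?case using e T_pos[of x] X[of x] 0 by simp
    next
      case (Suc n)
      note x = X[OF Suc.prems(1)]
      show ?case
      proof (cases "l \<le> k")
        case True
        have "l powr b \<le> k powr b" using True Suc.prems b by (intro powr_mono2) auto
        then have "e * l powr b \<le> 1" using e by (simp add: kb field_simps)
        then have "e * l powr b * T x \<le> 1 * T x" using T_pos x by (intro mult_right_mono) (auto intro: less_imp_le)
        also have "1 * T x \<le> T (l * x)"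
        proof -
          have "x * 1 \<le> x * l" using x Suc.prems by (intro mult_left_mono) auto
          then have "x \<le> l * x" by (simp add: mult.commute)
          then show ?thesis using x mono_onD[OF T_mono, of x "l * x"] by auto
        qed
        finally show ?thesis .
      next
        case False
        have "x * 1 \<le> x * k" using x k by (intro mult_left_mono) auto
        then have kx: "X \<le> k * x" using Suc.prems by (simp add: mult.commute)
        have "e * (l / k) powr b * T (k * x) \<le> T (l / k * (k * x))"
          using kx False k Suc.prems by (intro Suc.IH) (auto simp: field_simps)
        moreover have "e * (l / k) powr b * (k powr b * T x) \<le> e * (l / k) powr b * T (k * x)"
          using x e by (intro mult_left_mono) auto
        moreover have "e * (l / k) powr b * (k powr b * T x) = e * l powr b * T x"
          using False k by (simp add: powr_divide)
        ultimately show ?thesis using k by simp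
      qed
    qed
    show "\<forall>\<^sub>F x in at_top. y < (INF l\<in>{1..}. ereal (T (l * x) / (l powr a * T x)))"
      using eventually_ge_at_top[of X]
    proof eventually_elim
      case (elim x)
      have "ereal e \<le> (INF l\<in>{1..}. ereal (T (l * x) / (l powr a * T x)))"
      proof (rule INF_greatest)
        fix l :: real assume "l \<in> {1..}"
        then have l: "1 \<le> l" by simp
        obtain n where "l < k ^ n" using real_arch_pow[OF k] by blast
        then have "e * l powr b * T x \<le> T (l * x)" using elim l by (intro claim[of x l n]) auto
        moreover have "e * l powr a * T x \<le> e * l powr b * T x"
          using l b e T_pos[of x] X[OF elim] by (intro mult_right_mono mult_left_mono powr_mono) auto
        moreover have "0 < l powr a * T x" using l T_pos[of x] X[OF elim] by simp
        ultimately show "ereal e \<le> ereal (T (l * x) / (l powr a * T x))"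
          by (simp add: pos_le_divide_eq mult.assoc)
      qed
      with e(1) show ?case by (rule less_le_trans)
    qed
  qed
  then show ?thesis using pos_meas_at_top_mono[OF T_mono T_pos] by (simp add: KR_infinity_def)
qed

section \<open>The S-transform as an inverse function\<close>
locale nonneg_prob = prob_space \<mu> for \<mu> :: "real measure" +
  assumes sets_mu [measurable_cong]: "sets \<mu> = sets borel"
    and mass_neg: "emeasure \<mu> {..<0} = 0"
    and mass_zero: "measure \<mu> {0} = 0"
begin

lemma space_mu [simp]: "space \<mu> = UNIV"
  using sets_eq_imp_space_eq[OF sets_mu] by simp

lemma AE_pos: "AE t in \<mu>. 0 < t"
proof -
  have "emeasure \<mu> {..0} = emeasure \<mu> ({..<0} \<union> {0})" by (rule arg_cong[where f = "emeasure \<mu>"]) auto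
  also have "\<dots> \<le> emeasure \<mu> {..<0} + emeasure \<mu> {0}"
    by (rule emeasure_subadditive) auto
  also have "\<dots> = 0" using mass_neg mass_zero by (simp add: emeasure_eq_measure)
  finally have "{..0} \<in> null_sets \<mu>" by (auto simp: null_sets_def)
  then show ?thesis by (rule AE_I'[where N = "{..0}"]) auto
qed

text \<open>The function \<open>- psi \<mu> (- 1 / q)\<close>; it decreases from \<open>1\<close> to \<open>0\<close> on the positive half-line.\<close>
definition \<Phi> :: "real \<Rightarrow> real" where
  "\<Phi> q = (LINT t|\<mu>. indicator {0<..} t * (t / (q + t)))"

lemma kernel_bounds: "0 < q \<Longrightarrow> 0 < t \<Longrightarrow> 0 < t / (q + t) \<and> t / (q + t) < 1" for q t :: real
  by (simp add: divide_less_eq)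

lemma \<Phi>_integrable: "0 < q \<Longrightarrow> integrable \<mu> (\<lambda>t. indicator {0<..} t * (t / (q + t)))"
  using kernel_bounds[of q]
  by (intro integrable_const_bound[where B = 1]) (auto intro!: AE_I2 less_imp_le simp: indicator_def)

lemma psi_eq: assumes "0 < q" shows "psi \<mu> (- (1 / q)) = - \<Phi> q"
proof -
  have "psi \<mu> (- (1 / q)) = (LINT t|\<mu>. - (indicator {0<..} t * (t / (q + t))))"
    unfolding psi_def set_lebesgue_integral_def
  proof (rule integral_cong_AE)
    show "AE t in \<mu>. indicator {0..} t *\<^sub>R (- (1 / q) * t / (1 - - (1 / q) * t))
        = - (indicator {0<..} t * (t / (q + t)))"
      using AE_pos
    proof eventually_elim
      case (elim t)
      then have "0 < q + t" using assms by simp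
      then show ?case using elim assms by (simp add: divide_simps)
    qed
  qed auto
  then show ?thesis by (simp add: \<Phi>_def)
qed

lemma \<Phi>_diff:
  assumes "0 < p" "0 < q"
  shows "\<Phi> p - \<Phi> q = (LINT t|\<mu>. indicator {0<..} t * ((q - p) * t / ((p + t) * (q + t))))"
proof -
  have "\<Phi> p - \<Phi> q = (LINT t|\<mu>. indicator {0<..} t * (t / (p + t)) - indicator {0<..} t * (t / (q + t)))"
    unfolding \<Phi>_def using \<Phi>_integrable assms by simp
  also have "\<dots> = (LINT t|\<mu>. indicator {0<..} t * ((q - p) * t / ((p + t) * (q + t))))"
  proof (rule Bochner_Integration.integral_cong[OF refl])
    fix t :: real
    show "indicator {0<..} t * (t / (p + t)) - indicator {0<..} t * (t / (q + t))
        = indicator {0<..} t * ((q - p) * t / ((p + t) * (q + t)))"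
    proof (cases "0 < t")
      case True
      then have "p + t > 0" "q + t > 0" using assms by auto
      then show ?thesis by (simp add: divide_simps) (simp add: algebra_simps)
    qed simp
  qed
  finally show ?thesis .
qed

lemma \<Phi>_strict_antimono: assumes "0 < p" "p < q" shows "\<Phi> q < \<Phi> p"
  unfolding \<Phi>_def
proof (rule integral_less_AE_space)
  show "AE t in \<mu>. indicator {0<..} t * (t / (q + t)) < indicator {0<..} t * (t / (p + t))"
    using AE_pos by eventually_elim (use assms in \<open>auto intro!: divide_strict_left_mono mult_pos_pos\<close>)
qed (use assms \<Phi>_integrable in \<open>auto simp: emeasure_space_1[simplified]\<close>)

lemma \<Phi>_mono_iff: "0 < p \<Longrightarrow> 0 < q \<Longrightarrow> \<Phi> q < \<Phi> p \<longleftrightarrow> p < q"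
  using \<Phi>_strict_antimono[of p q] \<Phi>_strict_antimono[of q p] by (cases p q rule: linorder_cases) auto

lemma \<Phi>_inj: "0 < p \<Longrightarrow> 0 < q \<Longrightarrow> \<Phi> p = \<Phi> q \<longleftrightarrow> p = q"
  using \<Phi>_strict_antimono[of p q] \<Phi>_strict_antimono[of q p] by (cases p q rule: linorder_cases) auto

text \<open>The kernel of \<open>\<Phi> p - \<Phi> q\<close> in \<open>\<Phi>_diff\<close> is at most \<open>\<bar>q - p\<bar> / q\<close>.\<close>
lemma \<Phi>_continuous: "continuous_on {0<..} \<Phi>"
proof (rule continuous_at_imp_continuous_on, intro ballI)
  fix q :: real assume "q \<in> {0<..}"
  then have q: "0 < q" by simp
  have "((\<lambda>p. \<Phi> p - \<Phi> q) \<longlongrightarrow> 0) (at q)"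
  proof (rule Lim_null_comparison)
    have "((\<lambda>p. \<bar>q - p\<bar> / q) \<longlongrightarrow> \<bar>q - q\<bar> / q) (at q)" using q by (intro tendsto_intros) auto
    then show "((\<lambda>p. \<bar>q - p\<bar> / q) \<longlongrightarrow> 0) (at q)" by simp
    have "\<forall>\<^sub>F p in at q. p \<in> {0<..}"
      using q by (intro eventually_at_in_open') auto
    then show "\<forall>\<^sub>F p in at q. norm (\<Phi> p - \<Phi> q) \<le> \<bar>q - p\<bar> / q"
    proof eventually_elim
      case (elim p)
      then have p: "0 < p" by simp
      have "norm (\<Phi> p - \<Phi> q) \<le> (LINT t|\<mu>. norm (indicator {0<..} t * ((q - p) * t / ((p + t) * (q + t)))))"
        unfolding \<Phi>_diff[OF p q] by (rule integral_norm_bound)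
      also have "\<dots> \<le> (LINT t|\<mu>. \<bar>q - p\<bar> / q)"
      proof (rule integral_mono')
        fix t :: real
        show "norm (indicator {0<..} t * ((q - p) * t / ((p + t) * (q + t)))) \<le> \<bar>q - p\<bar> / q"
        proof (cases "0 < t")
          case True
          have "t / (p + t) * (1 / (q + t)) \<le> 1 * (1 / q)"
            using True p q by (intro mult_mono) (auto simp: divide_le_eq_1 intro!: frac_le)
          then have "\<bar>q - p\<bar> * (t / (p + t) * (1 / (q + t))) \<le> \<bar>q - p\<bar> * (1 * (1 / q))"
            by (intro mult_left_mono) auto
          then show ?thesis using True p q by (simp add: abs_mult)
        qed (use q in simp)
      qed (use q in auto)
      finally show ?case by (simp add: prob_space[simplified])
    qed
  qed
  then show "isCont \<Phi> q" unfolding isCont_def by (rule LIM_zero_cancel)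
qed

lemma \<Phi>_at_top: "(\<Phi> \<longlongrightarrow> 0) at_top"
proof -
  have "((\<lambda>q. LINT t|\<mu>. indicator {0<..} t * (t / (max 1 q + t))) \<longlongrightarrow> (LINT t|\<mu>. 0)) at_top"
  proof (rule integral_dominated_convergence_at_top[where w = "\<lambda>_. 1"])
    show "AE t in \<mu>. ((\<lambda>q. indicator {0<..} t * (t / (max 1 q + t))) \<longlongrightarrow> 0) at_top"
    proof (rule AE_I2)
      fix t :: real
      have "((\<lambda>q. t / (q + t)) \<longlongrightarrow> 0) at_top" by real_asymp
      then have "((\<lambda>q. t / (max 1 q + t)) \<longlongrightarrow> 0) at_top"
        by (rule Lim_transform_eventually) (auto intro: eventually_mono[OF eventually_ge_at_top[of 1]])
      from tendsto_mult_left[OF this, of "indicator {0<..} t"]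
      show "((\<lambda>q. indicator {0<..} t * (t / (max 1 q + t))) \<longlongrightarrow> 0) at_top" by simp
    qed
    show "\<forall>\<^sub>F q in at_top. AE t in \<mu>. norm (indicator {0<..} t * (t / (max 1 q + t))) \<le> 1"
      using kernel_bounds by (intro always_eventually allI AE_I2) (auto simp: indicator_def intro!: less_imp_le)
  qed auto
  then have "((\<lambda>q. LINT t|\<mu>. indicator {0<..} t * (t / (max 1 q + t))) \<longlongrightarrow> 0) at_top" by simp
  then show ?thesis
    by (rule Lim_transform_eventually)
       (auto intro!: eventually_mono[OF eventually_ge_at_top[of 1]] simp: \<Phi>_def max_def)
qed

lemma \<Phi>_at_zero: "((\<lambda>x. \<Phi> (1 / x)) \<longlongrightarrow> 1) at_top"
proof -
  have "((\<lambda>x. LINT t|\<mu>. indicator {0<..} t * (t / (1 / max 1 x + t))) \<longlongrightarrow> (LINT t|\<mu>. 1)) at_top"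
  proof (rule integral_dominated_convergence_at_top[where w = "\<lambda>_. 1"])
    show "AE t in \<mu>. ((\<lambda>x. indicator {0<..} t * (t / (1 / max 1 x + t))) \<longlongrightarrow> 1) at_top"
      using AE_pos
    proof eventually_elim
      case (elim t)
      have "((\<lambda>x. t / (1 / x + t)) \<longlongrightarrow> 1) at_top" using elim by real_asymp
      then have "((\<lambda>x. t / (1 / max 1 x + t)) \<longlongrightarrow> 1) at_top"
        by (rule Lim_transform_eventually) (auto intro!: eventually_mono[OF eventually_ge_at_top[of 1]] simp: max_def)
      then show ?case using elim by simp
    qed
    show "\<forall>\<^sub>F x in at_top. AE t in \<mu>. norm (indicator {0<..} t * (t / (1 / max 1 x + t))) \<le> 1"
    proof (intro always_eventually allI AE_I2)
      fix x t :: real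
      have "0 < 1 / max 1 x" by simp
      from kernel_bounds[OF this, of t]
      show "norm (indicator {0<..} t * (t / (1 / max 1 x + t))) \<le> 1"
        by (cases "0 < t") auto
    qed
  qed auto
  then have "((\<lambda>x. LINT t|\<mu>. indicator {0<..} t * (t / (1 / max 1 x + t))) \<longlongrightarrow> 1) at_top"
    by (simp add: prob_space[simplified])
  then show ?thesis
    by (rule Lim_transform_eventually)
       (auto intro!: eventually_mono[OF eventually_ge_at_top[of 1]] simp: \<Phi>_def max_def)
qed

lemma \<Phi>_surj: assumes "0 < y" "y < 1" shows "\<exists>q>0. \<Phi> q = y"
proof -
  have "\<forall>\<^sub>F q in at_top. \<Phi> q < y \<and> 1 \<le> q"
    using \<Phi>_at_top assms by (intro eventually_conj order_tendstoD eventually_ge_at_top) auto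
  then obtain b where b: "\<Phi> b < y" "1 \<le> b" using eventually_happens[of _ "at_top :: real filter"] by auto
  have "\<forall>\<^sub>F x in at_top. y < \<Phi> (1 / x) \<and> 1 \<le> x"
    using \<Phi>_at_zero assms by (intro eventually_conj order_tendstoD eventually_ge_at_top) auto
  then obtain x where x: "y < \<Phi> (1 / x)" "1 \<le> x"
    using eventually_happens[of _ "at_top :: real filter"] by auto
  define a where "a = 1 / x"
  have a: "0 < a" "a \<le> 1" "y < \<Phi> a" using x by (auto simp: a_def)
  have "\<exists>q. a \<le> q \<and> q \<le> b \<and> \<Phi> q = y"
    by (rule IVT2') (use a b in \<open>auto intro!: continuous_on_subset[OF \<Phi>_continuous]\<close>)
  then obtain q where "a \<le> q" "\<Phi> q = y" by blast
  then show ?thesis using a(1) by (intro exI[of _ q]) auto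
qed

lemma \<Phi>_range: assumes "0 < q" shows "0 < \<Phi> q" "\<Phi> q < 1"
proof -
  have "\<Phi> (q + 1) < \<Phi> q" using assms by (intro \<Phi>_strict_antimono) auto
  moreover have "0 \<le> \<Phi> (q + 1)" unfolding \<Phi>_def
    using kernel_bounds[of "q + 1"] assms by (intro integral_nonneg_AE AE_I2) (auto simp: indicator_def)
  ultimately show "0 < \<Phi> q" by simp
  have "\<Phi> q < \<Phi> (q / 2)" using assms by (intro \<Phi>_strict_antimono) auto
  moreover have "\<Phi> (q / 2) \<le> (LINT t|\<mu>. 1)" unfolding \<Phi>_def
    using kernel_bounds[of "q / 2"] assms \<Phi>_integrable[of "q / 2"]
    by (intro integral_mono) (auto simp: indicator_def intro!: less_imp_le)
  ultimately show "\<Phi> q < 1" by (simp add: prob_space[simplified])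
qed

lemma chi_spec:
  assumes z: "- 1 < z" "z < 0" shows "chi \<mu> z < 0" "psi \<mu> (chi \<mu> z) = z"
proof -
  have inj: "inj_on (psi \<mu>) {..<0}"
  proof (rule inj_onI)
    fix x y :: real assume xy: "x \<in> {..<0}" "y \<in> {..<0}" "psi \<mu> x = psi \<mu> y"
    define p q where "p = - 1 / x" and "q = - 1 / y"
    have pq: "0 < p" "0 < q" "x = - (1 / p)" "y = - (1 / q)" using xy by (auto simp: p_def q_def divide_neg_neg)
    then have "\<Phi> p = \<Phi> q" using xy by (simp add: psi_eq)
    then show "x = y" using pq \<Phi>_inj by simp
  qed
  obtain q where q: "0 < q" "\<Phi> q = - z" using \<Phi>_surj[of "- z"] z by auto
  then have "psi \<mu> (- (1 / q)) = z" by (simp add: psi_eq)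
  then have im: "z \<in> psi \<mu> ` {..<0}" using q by (auto intro!: image_eqI[of _ _ "- (1 / q)"])
  show "psi \<mu> (chi \<mu> z) = z" unfolding chi_def by (rule f_the_inv_into_f[OF inj im])
  show "chi \<mu> z < 0" unfolding chi_def using the_inv_into_into[OF inj im, of "{..<0}"] by auto
qed

text \<open>In terms of \<open>T x = 1 / S (- 1 / x)\<close> this is \<open>(x - 1) T x\<close>; it equals \<open>- 1 / chi \<mu> (- 1 / x)\<close>.\<close>
definition h :: "real \<Rightarrow> real" where "h x = (x - 1) / S_transform \<mu> (- 1 / x)"

lemma h_spec: assumes x: "1 < x" shows "0 < h x" "\<Phi> (h x) = 1 / x" "0 < S_transform \<mu> (- 1 / x)"
proof -
  have z: "- 1 < - 1 / x" "- 1 / x < 0" using x by (auto simp: field_simps)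
  note c = chi_spec[OF z]
  have S: "S_transform \<mu> (- 1 / x) = (x - 1) * - chi \<mu> (- 1 / x)"
    unfolding S_transform_def using x by (simp add: field_simps)
  have h: "h x = - 1 / chi \<mu> (- 1 / x)" unfolding h_def S using x c by simp
  show "0 < h x" unfolding h using c by (simp add: divide_neg_neg)
  show "0 < S_transform \<mu> (- 1 / x)" unfolding S using c x mult_pos_pos[of "x - 1" "- chi \<mu> (- 1 / x)"] by simp
  have "psi \<mu> (- (1 / h x)) = - 1 / x" using c by (simp add: h)
  then show "\<Phi> (h x) = 1 / x" using psi_eq[OF \<open>0 < h x\<close>] by simp
qed

text \<open>The inverse function of \<open>h\<close>.\<close>
definition g :: "real \<Rightarrow> real" where "g q = 1 / \<Phi> q"

lemma g_gt_1: "0 < q \<Longrightarrow> 1 < g q"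
  using \<Phi>_range[of q] by (simp add: g_def)

lemma h_g: "0 < q \<Longrightarrow> h (g q) = q"
  using h_spec[OF g_gt_1, of q] \<Phi>_inj[of "h (g q)" q] by (simp add: g_def)

lemma h_less_iff: "1 < x \<Longrightarrow> 1 < y \<Longrightarrow> h x < h y \<longleftrightarrow> x < y"
  using \<Phi>_mono_iff[of "h x" "h y"] h_spec[of x] h_spec[of y] by (simp add: field_simps)

lemma g_at_top: "filterlim g at_top at_top"
proof -
  have "\<forall>\<^sub>F q in at_top. 0 < \<Phi> q"
    using eventually_gt_at_top[of 0] by eventually_elim (rule \<Phi>_range)
  then have "filterlim (\<lambda>q. inverse (\<Phi> q)) at_top at_top"
    using \<Phi>_at_top by (rule filterlim_inverse_at_top[rotated])
  then show ?thesis by (simp add: g_def[abs_def] inverse_eq_divide)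
qed

lemma eventually_g: "eventually P at_top \<Longrightarrow> \<forall>\<^sub>F q in at_top. P (g q)"
  using g_at_top by (simp add: filterlim_iff)

text \<open>Inversion of asymptotics, for regular and rapid variation of \<open>h\<close> alike: the assumptions say that
  \<open>h\<close> is multiplied by \<open>l\<close> when its argument is multiplied by about \<open>c\<close>.\<close>
lemma g_ratio:
  assumes l: "0 < l" and c: "0 < c"
    and up: "\<And>a. c < a \<Longrightarrow> \<forall>\<^sub>F x in at_top. l * h x < h (a * x)"
    and lo: "\<And>a. 0 < a \<Longrightarrow> a < c \<Longrightarrow> \<forall>\<^sub>F x in at_top. h (a * x) < l * h x"
  shows "((\<lambda>q. g (l * q) / g q) \<longlongrightarrow> c) at_top"
proof (rule order_tendstoI)
  fix a :: real assume a: "a < c"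
  show "\<forall>\<^sub>F q in at_top. a < g (l * q) / g q"
  proof (cases "0 < a")
    case True
    have "\<forall>\<^sub>F q in at_top. 1 < a * g q"
      by (rule eventually_g[OF eventually_at_top_scale[OF eventually_gt_at_top True]])
    with eventually_g[OF lo[OF True a]] eventually_gt_at_top[of 0]
    show ?thesis
    proof eventually_elim
      case (elim q)
      have "h (a * g q) < h (g (l * q))" using elim l by (simp add: h_g)
      then have "a * g q < g (l * q)" using h_less_iff elim g_gt_1[of "l * q"] l by simp
      then show ?case using g_gt_1[of q] elim by (simp add: pos_less_divide_eq)
    qed
  next
    case False
    show ?thesis using eventually_gt_at_top[of 0]
    proof eventually_elim
      case (elim q)
      have "0 < g (l * q) / g q" using g_gt_1[of q] g_gt_1[of "l * q"] elim l by simp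
      then show ?case using False by linarith
    qed
  qed
next
  fix a :: real assume a: "c < a"
  then have a0: "0 < a" using c by simp
  have "\<forall>\<^sub>F q in at_top. 1 < a * g q"
    by (rule eventually_g[OF eventually_at_top_scale[OF eventually_gt_at_top a0]])
  with eventually_g[OF up[OF a]] eventually_gt_at_top[of 0]
  show "\<forall>\<^sub>F q in at_top. g (l * q) / g q < a"
  proof eventually_elim
    case (elim q)
    have "h (g (l * q)) < h (a * g q)" using elim l by (simp add: h_g)
    then have "g (l * q) < a * g q" using h_less_iff elim g_gt_1[of "l * q"] l by simp
    then show ?case using g_gt_1[of q] elim by (simp add: pos_divide_less_eq)
  qed
qed

lemma g_ratio_power:
  assumes r: "0 \<le> r" and T: "\<And>l. 0 < l \<Longrightarrow>
      ((\<lambda>x. (1 / S_transform \<mu> (- 1 / (l * x))) / (1 / S_transform \<mu> (- 1 / x))) \<longlongrightarrow> l powr r) at_top"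
    and l: "0 < l"
  shows "((\<lambda>q. g (l * q) / g q) \<longlongrightarrow> l powr (1 / (1 + r))) at_top"
proof (rule g_ratio[OF l])
  have h_lim: "((\<lambda>x. h (a * x) / h x) \<longlongrightarrow> a powr (1 + r)) at_top" if a: "0 < a" for a
  proof -
    have "((\<lambda>x. (a * x - 1) / (x - 1)) \<longlongrightarrow> a) at_top" using a by real_asymp
    from tendsto_mult[OF this T[OF a]]
    have "((\<lambda>x. (a * x - 1) / (x - 1) * ((1 / S_transform \<mu> (- 1 / (a * x))) / (1 / S_transform \<mu> (- 1 / x))))
        \<longlongrightarrow> a powr (1 + r)) at_top"
      using a by (simp add: powr_add)
    then show ?thesis by (simp add: h_def[abs_def] mult_ac)
  qed
  have h_pos: "\<forall>\<^sub>F x in at_top. 0 < h x"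
    using eventually_gt_at_top[of 1] by eventually_elim (rule h_spec)
  have pw: "(l powr (1 / (1 + r))) powr (1 + r) = l" using l r by (simp add: powr_powr)
  fix a :: real
  show "\<forall>\<^sub>F x in at_top. l * h x < h (a * x)" if a: "l powr (1 / (1 + r)) < a"
  proof -
    have a0: "0 < a" using a by (rule le_less_trans[rotated]) simp
    have "(l powr (1 / (1 + r))) powr (1 + r) < a powr (1 + r)"
      using a r by (intro powr_less_mono2) auto
    then have "\<forall>\<^sub>F x in at_top. l < h (a * x) / h x"
      unfolding pw by (rule order_tendstoD(1)[OF h_lim[OF a0]])
    then show ?thesis using h_pos by eventually_elim (simp add: pos_less_divide_eq)
  qed
  show "\<forall>\<^sub>F x in at_top. h (a * x) < l * h x" if a: "0 < a" "a < l powr (1 / (1 + r))"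
  proof -
    have "a powr (1 + r) < (l powr (1 / (1 + r))) powr (1 + r)"
      using a r by (intro powr_less_mono2) auto
    then have "\<forall>\<^sub>F x in at_top. h (a * x) / h x < l"
      unfolding pw by (rule order_tendstoD(2)[OF h_lim[OF a(1)]])
    then show ?thesis using h_pos by eventually_elim (simp add: pos_divide_less_eq)
  qed
qed (use l in simp)

text \<open>The assumption on \<open>1 / l\<close> handles arguments \<open>a x\<close> with \<open>a < 1\<close>, as \<open>x = (1 / a) (a x)\<close>.\<close>
lemma g_ratio_rapid:
  assumes T: "\<And>a. 1 < a \<Longrightarrow> \<forall>\<^sub>F x in at_top. l * (1 / S_transform \<mu> (- 1 / x)) < 1 / S_transform \<mu> (- 1 / (a * x))"
    "\<And>a. 1 < a \<Longrightarrow> \<forall>\<^sub>F x in at_top. 1 / l * (1 / S_transform \<mu> (- 1 / x)) < 1 / S_transform \<mu> (- 1 / (a * x))"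
    and l: "0 < l"
  shows "((\<lambda>q. g (l * q) / g q) \<longlongrightarrow> 1) at_top"
proof (rule g_ratio[OF l])
  have h_up: "\<forall>\<^sub>F x in at_top. k * h x < h (a * x)"
    if a: "1 < a" and k: "\<forall>\<^sub>F x in at_top. k * (1 / S_transform \<mu> (- 1 / x)) < 1 / S_transform \<mu> (- 1 / (a * x))" for k a
    using k eventually_gt_at_top[of 1]
  proof eventually_elim
    case (elim x)
    have ax: "x * 1 < x * a" using elim a by (intro mult_strict_left_mono) auto
    then have axx: "x < a * x" by (simp add: mult.commute)
    then have "1 < a * x" using elim by linarith
    note Sp = h_spec(3)[OF this]
    have "k * h x = (x - 1) * (k * (1 / S_transform \<mu> (- 1 / x)))" by (simp add: h_def)
    also have "\<dots> < (x - 1) * (1 / S_transform \<mu> (- 1 / (a * x)))"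
      using elim by (intro mult_strict_left_mono) auto
    also have "\<dots> \<le> (a * x - 1) * (1 / S_transform \<mu> (- 1 / (a * x)))"
      using axx Sp by (intro mult_right_mono) auto
    finally show ?case by (simp add: h_def)
  qed
  fix a :: real
  show "\<forall>\<^sub>F x in at_top. l * h x < h (a * x)" if a: "1 < a"
    by (rule h_up[OF a T(1)[OF a]])
  show "\<forall>\<^sub>F x in at_top. h (a * x) < l * h x" if a: "0 < a" "a < 1"
  proof -
    have a': "1 < 1 / a" using a by simp
    have "\<forall>\<^sub>F x in at_top. 1 / l * h (a * x) < h (1 / a * (a * x))"
      by (rule eventually_at_top_scale[OF h_up[OF a' T(2)[OF a']] a(1)])
    then show ?thesis by eventually_elim (use a l in \<open>simp add: field_simps\<close>)
  qed
qed simp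

end

section \<open>Tails of the measure\<close>

text \<open>The density of the limit law for index \<open>\<alpha>\<close> in the variable \<open>s\<close> with \<open>x = s / (1 + s)\<close>. Up to
  normalization the law of \<open>x\<close> is the beta distribution with parameters \<open>\<alpha>\<close> and \<open>1 - \<alpha>\<close>.\<close>
definition power_kernel :: "real \<Rightarrow> real \<Rightarrow> real" where
  "power_kernel \<alpha> s = indicator {0<..} s * (s powr (\<alpha> - 1) / (1 + s))"

lemma power_kernel_measurable [measurable]: "power_kernel \<alpha> \<in> borel_measurable borel"
  unfolding power_kernel_def[abs_def] by measurable

lemma power_kernel_nonneg: "0 \<le> power_kernel \<alpha> s"
  by (auto simp: power_kernel_def indicator_def)

lemma power_kernel_integrable:
  assumes a: "0 < \<alpha>" "\<alpha> < 1" shows "integrable lborel (power_kernel \<alpha>)"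
proof -
  have "((\<lambda>s. s powr (\<alpha> - 1)) has_integral (1 powr (\<alpha> - 1 + 1) / (\<alpha> - 1 + 1))) {0..1}"
    using a by (intro has_integral_powr_from_0) auto
  then have "((\<lambda>s. if s \<in> {0..1} then s powr (\<alpha> - 1) else 0) has_integral 1 / \<alpha>) UNIV"
    by (subst has_integral_restrict_UNIV) simp
  then have "((\<lambda>s. indicator {0..1} s * s powr (\<alpha> - 1)) has_integral 1 / \<alpha>) UNIV"
    by (rule has_integral_eq[rotated]) auto
  then have "(\<integral>\<^sup>+ s. ennreal (indicator {0..1} s * s powr (\<alpha> - 1)) \<partial>lborel) = ennreal (1 / \<alpha>)"
    by (intro nn_integral_has_integral_lborel) auto
  then have I0: "integrable lborel (\<lambda>s. indicator {0..1} s * s powr (\<alpha> - 1) :: real)"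
    by (intro integrableI_nonneg) (auto intro!: AE_I2)
  have "(\<integral>\<^sup>+ s. ennreal (s powr (\<alpha> - 2)) * indicator {1..} s \<partial>lborel) = ennreal (0 - 1 powr (\<alpha> - 1) / (\<alpha> - 1))"
  proof (rule nn_integral_FTC_atLeast[where F = "\<lambda>s. s powr (\<alpha> - 1) / (\<alpha> - 1)"])
    have "((\<lambda>s::real. s powr (\<alpha> - 1) / (\<alpha> - 1)) \<longlongrightarrow> 0 / (\<alpha> - 1)) at_top"
      using a by (intro tendsto_divide tendsto_neg_powr tendsto_const filterlim_ident) auto
    then show "((\<lambda>s::real. s powr (\<alpha> - 1) / (\<alpha> - 1)) \<longlongrightarrow> 0) at_top" by simp
    fix s :: real assume "1 \<le> s"
    then have "((\<lambda>s. s powr (\<alpha> - 1) / (\<alpha> - 1)) has_real_derivative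
        (\<alpha> - 1) * s powr (\<alpha> - 1 - 1) / (\<alpha> - 1)) (at s)"
      by (intro DERIV_cdivide has_real_derivative_powr) auto
    then show "((\<lambda>s. s powr (\<alpha> - 1) / (\<alpha> - 1)) has_real_derivative s powr (\<alpha> - 2)) (at s)"
      using a by simp
  qed auto
  then have I1: "integrable lborel (\<lambda>s. indicator {1..} s * s powr (\<alpha> - 2) :: real)"
    by (intro integrableI_nonneg)
       (auto intro!: AE_I2 simp: ennreal_mult'' ennreal_indicator mult.commute[of "indicator _ _"])
  show ?thesis
  proof (rule Bochner_Integration.integrable_bound[OF Bochner_Integration.integrable_add[OF I0 I1]])
    show "AE s in lborel. norm (power_kernel \<alpha> s) \<le>
        norm (indicator {0..1} s * s powr (\<alpha> - 1) + indicator {1..} s * s powr (\<alpha> - 2))"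
    proof (rule AE_I2)
      fix s :: real
      consider "s \<le> 0" | "0 < s" "s < 1" | "1 \<le> s" by linarith
      then show "norm (power_kernel \<alpha> s) \<le>
        norm (indicator {0..1} s * s powr (\<alpha> - 1) + indicator {1..} s * s powr (\<alpha> - 2))"
      proof cases
        case 2
        have "s powr (\<alpha> - 1) / (1 + s) \<le> s powr (\<alpha> - 1) / 1"
          using 2 by (intro divide_left_mono) auto
        then show ?thesis using 2 by (simp add: power_kernel_def)
      next
        case 3
        have "s powr (\<alpha> - 1) / (1 + s) \<le> s powr (\<alpha> - 1) / s"
          using 3 by (intro divide_left_mono) auto
        also have "\<dots> = s powr (\<alpha> - 2)" using 3 by (simp add: powr_diff power2_eq_square powr_numeral)
        finally show ?thesis using 3 by (auto simp: power_kernel_def indicator_def)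
      qed (auto simp: power_kernel_def)
    qed
  qed simp
qed

text \<open>In the variable \<open>s\<close> the transform of the limit law is computed by scaling, because
  \<open>1 + m s / (1 + s) = (1 + (1 + m) s) / (1 + s)\<close>.\<close>
lemma power_kernel_scaling:
  assumes l: "0 < l"
  shows "(LINT s|lborel. indicator {0<..} s * (s powr (\<alpha> - 1) / (1 + l * s)))
    = l powr (- \<alpha>) * (LINT s|lborel. power_kernel \<alpha> s)"
proof -
  have "(LINT s|lborel. power_kernel \<alpha> s) = \<bar>l\<bar> *\<^sub>R (LINT s|lborel. power_kernel \<alpha> (0 + l * s))"
    using l by (intro lborel_integral_real_affine) simp
  also have "(LINT s|lborel. power_kernel \<alpha> (0 + l * s))
      = (LINT s|lborel. l powr (\<alpha> - 1) * (indicator {0<..} s * (s powr (\<alpha> - 1) / (1 + l * s))))"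
    using l by (intro Bochner_Integration.integral_cong refl)
      (auto simp: power_kernel_def powr_mult indicator_def zero_less_mult_iff)
  also have "\<dots> = l powr (\<alpha> - 1) * (LINT s|lborel. indicator {0<..} s * (s powr (\<alpha> - 1) / (1 + l * s)))"
    by (rule integral_mult_right_zero)
  finally have "(LINT s|lborel. power_kernel \<alpha> s)
     = l powr \<alpha> * (LINT s|lborel. indicator {0<..} s * (s powr (\<alpha> - 1) / (1 + l * s)))"
    using l by (simp add: powr_diff)
  then show ?thesis using l by (simp add: powr_minus field_simps)
qed

context nonneg_prob begin

definition tail :: "real \<Rightarrow> real" where "tail x = measure \<mu> {x<..}"

lemma tail_antimono: "x \<le> y \<Longrightarrow> tail y \<le> tail x"
  unfolding tail_def by (intro finite_measure_mono) auto

lemma pos_meas_tail: assumes "\<forall>\<^sub>F x in at_top. 0 < tail x" shows "pos_meas_at_top tail"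
proof -
  have "mono (\<lambda>x. - tail x)" by (auto intro!: monoI tail_antimono)
  then have "(\<lambda>x. - (- tail x)) \<in> borel_measurable borel"
    by (intro borel_measurable_uminus borel_measurable_mono)
  then have [measurable]: "tail \<in> borel_measurable borel" by simp
  obtain X where "\<And>x. X \<le> x \<Longrightarrow> 0 < tail x"
    using assms by (auto simp: eventually_at_top_linorder)
  moreover have "set_borel_measurable borel {X..} tail"
    unfolding set_borel_measurable_def by measurable
  ultimately show ?thesis unfolding pos_meas_at_top_def by blast
qed

lemma tail_reg_varI:
  assumes lim: "((\<lambda>q. tail q / k q) \<longlongrightarrow> C) at_top" and C: "0 < C"
    and k_pos: "\<forall>\<^sub>F q in at_top. 0 < k q"
    and k: "\<And>l. 0 < l \<Longrightarrow> ((\<lambda>q. k (l * q) / k q) \<longlongrightarrow> l powr \<rho>) at_top"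
  shows "tail \<in> reg_var \<rho>"
proof -
  have "\<forall>\<^sub>F q in at_top. 0 < tail q / k q" by (rule order_tendstoD(1)[OF lim C])
  then have tail_pos: "\<forall>\<^sub>F q in at_top. 0 < tail q"
    using k_pos by eventually_elim (auto simp: zero_less_divide_iff)
  have "((\<lambda>q. tail (l * q) / tail q) \<longlongrightarrow> l powr \<rho>) at_top" if l: "0 < l" for l
  proof -
    have "((\<lambda>q. (tail (l * q) / k (l * q)) / (tail q / k q) * (k (l * q) / k q)) \<longlongrightarrow> C / C * l powr \<rho>) at_top"
      using C by (intro tendsto_intros lim k l tendsto_at_top_scale[OF lim l]) auto
    moreover have "\<forall>\<^sub>F q in at_top. (tail (l * q) / k (l * q)) / (tail q / k q) * (k (l * q) / k q)
        = tail (l * q) / tail q"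
      using k_pos eventually_at_top_scale[OF k_pos l] tail_pos
      by eventually_elim (simp add: field_simps)
    ultimately show ?thesis
      by (rule Lim_transform_eventually[THEN tendsto_eq_rhs]) (use C in simp)
  qed
  then show ?thesis using pos_meas_tail[OF tail_pos] by (simp add: reg_var_def)
qed

text \<open>Take \<open>X = q / (q + t)\<close> with weight \<open>t / ((q + t) \<Phi> q)\<close>. Then \<open>W / (1 + m X)\<close> integrates to
  \<open>\<Phi> ((1 + m) q) / \<Phi> q\<close>, the event \<open>X < 1 / 2\<close> is \<open>t > q\<close>, and \<open>1 / (1 - X)\<close> cancels the factor
  \<open>t / (q + t)\<close>. The constant \<open>B\<close> is the total mass of the limit law, which is not normalized.\<close>
lemma tail_over_\<Phi>:
  fixes N :: "'b measure"
  assumes N: "finite_measure N" and Y: "Y \<in> borel_measurable N" "\<And>s. s \<in> space N \<Longrightarrow> 0 \<le> Y s \<and> Y s \<le> 1"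
    and B: "0 < B"
    and transform: "\<And>m. 0 < \<bar>m\<bar> \<Longrightarrow> \<bar>m\<bar> < 1 / 2 \<Longrightarrow> (LINT s|N. 1 / (1 + m * Y s)) = B * (1 + m) powr (- \<alpha>)"
    and no_atom: "measure N {s \<in> space N. Y s = 1 / 2} = 0"
    and ratio: "\<And>l. 0 < l \<Longrightarrow> ((\<lambda>q. \<Phi> (l * q) / \<Phi> q) \<longlongrightarrow> l powr (- \<alpha>)) at_top"
  shows "((\<lambda>q. B * (tail q / \<Phi> q)) \<longlongrightarrow>
    (LINT s|N. 1 / max (1 - Y s) (1 / 2) * indicator {..<1 / 2} (Y s))) at_top"
proof -
  define W where "W q t = B / \<Phi> q * (indicator {0<..} t * (t / (q + t)))" for q t
  define X where "X q t = indicator {0<..} t * (q / (q + t))" for q t :: real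
  interpret N: finite_measure N by (rule N)
  interpret stieltjes_limit N \<mu> at_top W X Y
  proof
    show "\<forall>\<^sub>F q in at_top. integrable \<mu> (W q) \<and> X q \<in> borel_measurable \<mu> \<and>
      (\<forall>t\<in>space \<mu>. 0 \<le> W q t \<and> 0 \<le> X q t \<and> X q t \<le> 1)"
      using eventually_gt_at_top[of 0]
    proof eventually_elim
      case (elim q)
      have "integrable \<mu> (W q)" unfolding W_def[abs_def]
        by (intro integrable_mult_right \<Phi>_integrable elim)
      moreover have "X q \<in> borel_measurable \<mu>" unfolding X_def[abs_def] by measurable
      moreover have "0 \<le> W q t \<and> 0 \<le> X q t \<and> X q t \<le> 1" for t
        using \<Phi>_range[OF elim] elim B by (cases "0 < t") (auto simp: W_def X_def divide_le_eq_1)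
      ultimately show ?case by simp
    qed
    fix m :: real assume m: "0 < \<bar>m\<bar>" "\<bar>m\<bar> < 1 / 2"
    then have m1: "0 < 1 + m" by linarith
    have "((\<lambda>q. B * (\<Phi> ((1 + m) * q) / \<Phi> q)) \<longlongrightarrow> B * (1 + m) powr (- \<alpha>)) at_top"
      by (intro tendsto_intros ratio m1)
    then show "((\<lambda>q. LINT t|\<mu>. W q t / (1 + m * X q t)) \<longlongrightarrow> (LINT s|N. 1 / (1 + m * Y s))) at_top"
      unfolding transform[OF m]
    proof (rule Lim_transform_eventually)
      show "\<forall>\<^sub>F q in at_top. B * (\<Phi> ((1 + m) * q) / \<Phi> q) = (LINT t|\<mu>. W q t / (1 + m * X q t))"
        using eventually_gt_at_top[of 0]
      proof eventually_elim
        case (elim q)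
        have "(LINT t|\<mu>. W q t / (1 + m * X q t))
            = (LINT t|\<mu>. B / \<Phi> q * (indicator {0<..} t * (t / ((1 + m) * q + t))))"
        proof (rule Bochner_Integration.integral_cong[OF refl])
          fix t :: real
          show "W q t / (1 + m * X q t) = B / \<Phi> q * (indicator {0<..} t * (t / ((1 + m) * q + t)))"
          proof (cases "0 < t")
            case True
            have p: "0 < q + t" "0 < (1 + m) * q + t" using True elim m1 by (auto intro: add_pos_pos)
            have "1 + m * X q t = ((1 + m) * q + t) / (q + t)"
              using True p by (simp add: X_def divide_simps) (simp add: algebra_simps)
            then show ?thesis using True p by (simp add: W_def)
          qed (simp add: W_def)
        qed
        also have "\<dots> = B / \<Phi> q * \<Phi> ((1 + m) * q)"
          unfolding \<Phi>_def[of "(1 + m) * q"] by (rule integral_mult_right_zero)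
        finally show ?case by simp
      qed
    qed
  qed (use Y in auto)
  have "((\<lambda>q. LINT t|\<mu>. W q t * (1 / max (1 - X q t) (1 / 2) * indicator {..<1 / 2} (X q t))) \<longlongrightarrow>
      (LINT s|N. 1 / max (1 - Y s) (1 / 2) * indicator {..<1 / 2} (Y s))) at_top"
  proof (rule truncated_tendsto[OF _ _ no_atom])
    show "continuous_on UNIV (\<lambda>x. 1 / max (1 - x) (1 / 2) :: real)"
      by (intro continuous_intros) (auto simp: max_def)
  qed (auto simp: max_def)
  then show ?thesis
  proof (rule Lim_transform_eventually)
    show "\<forall>\<^sub>F q in at_top. (LINT t|\<mu>. W q t * (1 / max (1 - X q t) (1 / 2) * indicator {..<1 / 2} (X q t)))
        = B * (tail q / \<Phi> q)"
      using eventually_gt_at_top[of 0]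
    proof eventually_elim
      case (elim q)
      have "(LINT t|\<mu>. W q t * (1 / max (1 - X q t) (1 / 2) * indicator {..<1 / 2} (X q t)))
         = (LINT t|\<mu>. B / \<Phi> q * indicator {q<..} t)"
      proof (rule Bochner_Integration.integral_cong[OF refl])
        fix t :: real
        show "W q t * (1 / max (1 - X q t) (1 / 2) * indicator {..<1 / 2} (X q t)) = B / \<Phi> q * indicator {q<..} t"
        proof (cases "0 < t")
          case True
          have p: "0 < q + t" using True elim by simp
          have X1: "1 - X q t = t / (q + t)" using True p by (simp add: X_def divide_simps)
          have X2: "indicator {..<1 / 2} (X q t) = (indicator {q<..} t :: real)"
            using True p by (auto simp: X_def indicator_def field_simps)
          have "max (t / (q + t)) (1 / 2) = t / (q + t)" if "q < t"
            using that p by (auto simp: max_def field_simps)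
          then show ?thesis unfolding X1 X2 using True p by (auto simp: W_def indicator_def)
        qed (use elim in \<open>simp add: W_def\<close>)
      qed
      then show ?case by (simp add: tail_def)
    qed
  qed
qed

text \<open>For \<open>\<alpha> = 0\<close> the limit law is the point mass at \<open>0\<close>. In both cases it charges \<open>[0, 1/2)\<close>, so that
  the tail is asymptotically a positive multiple of \<open>\<Phi>\<close>.\<close>
lemma tail_reg_var_power:
  assumes a: "0 \<le> \<alpha>" "\<alpha> < 1"
    and ratio: "\<And>l. 0 < l \<Longrightarrow> ((\<lambda>q. g (l * q) / g q) \<longlongrightarrow> l powr \<alpha>) at_top"
  shows "tail \<in> reg_var (- \<alpha>)"
proof -
  have ratio': "((\<lambda>q. \<Phi> (l * q) / \<Phi> q) \<longlongrightarrow> l powr (- \<alpha>)) at_top" if l: "0 < l" for l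
    using tendsto_inverse[OF ratio[OF l]] l by (simp add: g_def powr_minus)
  have \<Phi>_pos: "\<forall>\<^sub>F q in at_top. 0 < \<Phi> q"
    using eventually_gt_at_top[of 0] by eventually_elim (rule \<Phi>_range)
  show ?thesis
  proof (cases "\<alpha> = 0")
    case True
    have "((\<lambda>q. 1 * (tail q / \<Phi> q)) \<longlongrightarrow>
      (LINT s|return borel (0::real). 1 / max (1 - 0) (1 / 2) * indicator {..<1 / 2} (0::real))) at_top"
    proof (rule tail_over_\<Phi>[where Y = "\<lambda>_. 0"])
      show "finite_measure (return borel (0::real))"
        by (intro prob_space.finite_measure prob_space_return) simp
      show "(LINT s|return borel (0::real). 1 / (1 + m * 0)) = 1 * (1 + m) powr (- \<alpha>)"
        if "0 < \<bar>m\<bar>" "\<bar>m\<bar> < 1 / 2" for m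
        using that True by (simp add: measure_return)
    qed (use ratio' in auto)
    then have "((\<lambda>q. tail q / \<Phi> q) \<longlongrightarrow> 1) at_top" by (simp add: measure_return)
    then show ?thesis by (rule tail_reg_varI[OF _ _ \<Phi>_pos ratio']) auto
  next
    case False
    with a have a': "0 < \<alpha>" "\<alpha> < 1" by auto
    note I = power_kernel_integrable[OF a']
    define N where "N = density lborel (\<lambda>s. ennreal (power_kernel \<alpha> s))"
    define Y where "Y s = max 0 s / (1 + max 0 s)" for s :: real
    define B where "B = (LINT s|lborel. power_kernel \<alpha> s)"
    have Y01: "0 \<le> Y s" "Y s \<le> 1" for s by (auto simp: Y_def divide_le_eq_1)
    have Ym[measurable]: "Y \<in> borel_measurable borel" unfolding Y_def by measurable
    have N_int: "(LINT s|N. f s) = (LINT s|lborel. power_kernel \<alpha> s * f s)"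
      if "f \<in> borel_measurable borel" for f :: "real \<Rightarrow> real"
      unfolding N_def using that by (subst integral_density) (auto intro!: AE_I2 power_kernel_nonneg)
    have N: "finite_measure N"
    proof (rule finite_measureI)
      have "emeasure N (space N) = (\<integral>\<^sup>+ s. ennreal (power_kernel \<alpha> s) \<partial>lborel)"
        unfolding N_def by (subst emeasure_density) auto
      also have "\<dots> < \<infinity>"
        using I by (simp add: integrable_iff_bounded power_kernel_nonneg)
      finally show "emeasure N (space N) \<noteq> \<infinity>" by simp
    qed
    have half: "indicator {0<..<1} s * (1 / 2) \<le> power_kernel \<alpha> s" for s :: real
    proof (cases "s \<in> {0<..<1}")
      case True
      have "1 powr (\<alpha> - 1) \<le> s powr (\<alpha> - 1)" using True a' by (intro powr_mono2') auto
      then have "1 / 2 \<le> s powr (\<alpha> - 1) / (1 + s)" using True by (intro frac_le) auto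
      then show ?thesis using True by (simp add: power_kernel_def)
    qed (simp add: power_kernel_nonneg)
    have half_int: "integrable lborel (\<lambda>s::real. indicator {0<..<1} s * (1 / 2) :: real)"
      "(LINT s::real|lborel. indicator {0<..<1} s * (1 / 2) :: real) = 1 / 2"
      by (intro integrable_mult_left integrable_real_indicator) auto
    have B: "0 < B"
    proof -
      have "(LINT s::real|lborel. indicator {0<..<1} s * (1 / 2)) \<le> B"
        unfolding B_def by (rule integral_mono[OF half_int(1) I half])
      then show ?thesis using half_int(2) by linarith
    qed
    define C where "C = (LINT s|N. 1 / max (1 - Y s) (1 / 2) * indicator {..<1 / 2} (Y s))"
    have C: "0 < C"
    proof -
      have "(LINT s::real|lborel. indicator {0<..<1} s * (1 / 2))
        \<le> (LINT s|lborel. power_kernel \<alpha> s * (1 / max (1 - Y s) (1 / 2) * indicator {..<1 / 2} (Y s)))"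
      proof (rule integral_mono[OF half_int(1)])
        have le2: "1 / max (1 - Y s) (1 / 2) * indicator {..<1 / 2} (Y s) \<le> 2" 
             "0 \<le> 1 / max (1 - Y s) (1 / 2) * indicator {..<1 / 2} (Y s)" for s
          by (auto simp: indicator_def max_def divide_simps)
        show "integrable lborel (\<lambda>s. power_kernel \<alpha> s * (1 / max (1 - Y s) (1 / 2) * indicator {..<1 / 2} (Y s)))"
        proof (rule Bochner_Integration.integrable_bound[OF integrable_mult_right[OF I, of 2]])
          show "AE s in lborel. norm (power_kernel \<alpha> s * (1 / max (1 - Y s) (1 / 2) * indicator {..<1 / 2} (Y s)))
              \<le> norm (2 * power_kernel \<alpha> s)"
          proof (rule AE_I2)
            fix s
            have "power_kernel \<alpha> s * (1 / max (1 - Y s) (1 / 2) * indicator {..<1 / 2} (Y s)) \<le> power_kernel \<alpha> s * 2"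
              by (intro mult_left_mono le2 power_kernel_nonneg)
            moreover have "0 \<le> power_kernel \<alpha> s * (1 / max (1 - Y s) (1 / 2) * indicator {..<1 / 2} (Y s))"
              by (intro mult_nonneg_nonneg le2 power_kernel_nonneg)
            ultimately show "norm (power_kernel \<alpha> s * (1 / max (1 - Y s) (1 / 2) * indicator {..<1 / 2} (Y s)))
              \<le> norm (2 * power_kernel \<alpha> s)" by (simp only: real_norm_def abs_of_nonneg)
          qed
        qed measurable
        fix s :: real
        show "indicator {0<..<1} s * (1 / 2)
           \<le> power_kernel \<alpha> s * (1 / max (1 - Y s) (1 / 2) * indicator {..<1 / 2} (Y s))"
        proof (cases "s \<in> {0<..<1}")
          case True
          then have "Y s < 1 / 2" by (simp add: Y_def divide_less_eq)
          moreover have "1 \<le> 1 / max (1 - Y s) (1 / 2)" using Y01[of s] by (simp add: max_def)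
          ultimately have "power_kernel \<alpha> s * 1 \<le> power_kernel \<alpha> s * (1 / max (1 - Y s) (1 / 2) * indicator {..<1 / 2} (Y s))"
            by (intro mult_left_mono power_kernel_nonneg) auto
          then show ?thesis using half[of s] by linarith
        next
          case False
          have "0 \<le> power_kernel \<alpha> s * (1 / max (1 - Y s) (1 / 2) * indicator {..<1 / 2} (Y s))"
            by (intro mult_nonneg_nonneg le2 power_kernel_nonneg)
          moreover have "indicator {0<..<1} s = (0::real)" using False by simp
          ultimately show ?thesis by (simp only: mult_zero_left)
        qed
      qed
      also have "\<dots> = C" unfolding C_def by (rule N_int[symmetric]) measurable
      finally show ?thesis using half_int(2) by linarith
    qed
    have "((\<lambda>q. B * (tail q / \<Phi> q)) \<longlongrightarrow> C) at_top"
      unfolding C_def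
    proof (rule tail_over_\<Phi>[OF N _ _ B])
      show "Y \<in> borel_measurable N" by (simp add: N_def)
      fix m :: real assume m: "0 < \<bar>m\<bar>" "\<bar>m\<bar> < 1 / 2"
      have "(LINT s|N. 1 / (1 + m * Y s)) = (LINT s|lborel. power_kernel \<alpha> s * (1 / (1 + m * Y s)))"
        by (rule N_int) measurable
      also have "\<dots> = (LINT s|lborel. indicator {0<..} s * (s powr (\<alpha> - 1) / (1 + (1 + m) * s)))"
      proof (rule Bochner_Integration.integral_cong[OF refl])
        fix s :: real
        show "power_kernel \<alpha> s * (1 / (1 + m * Y s)) = indicator {0<..} s * (s powr (\<alpha> - 1) / (1 + (1 + m) * s))"
        proof (cases "0 < s")
          case True
          have "0 < (1 + m) * s" using True m by (intro mult_pos_pos) auto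
          then have p: "0 < 1 + s" "0 < 1 + (1 + m) * s" using True by auto
          have "1 + m * Y s = (1 + (1 + m) * s) / (1 + s)"
            using True p by (simp add: Y_def divide_simps) (simp add: algebra_simps)
          then show ?thesis using True p by (simp add: power_kernel_def)
        qed (simp add: power_kernel_def)
      qed
      also have "\<dots> = (1 + m) powr (- \<alpha>) * B"
        unfolding B_def using m by (intro power_kernel_scaling) auto
      finally show "(LINT s|N. 1 / (1 + m * Y s)) = B * (1 + m) powr (- \<alpha>)" by simp
    next
      have "{s \<in> space N. Y s = 1 / 2} = {1}"
        by (auto simp: N_def Y_def max_def field_simps split: if_splits)
      moreover have "AE s in lborel. s \<in> {1} \<longrightarrow> ennreal (power_kernel \<alpha> s) = 0"
        using AE_lborel_singleton[of "1::real"] by eventually_elim simp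
      then have "{1} \<in> null_sets N" unfolding N_def by (subst null_sets_density_iff) auto
      ultimately show "measure N {s \<in> space N. Y s = 1 / 2} = 0"
        by (simp add: null_sets_def measure_def)
    qed (use Y01 ratio' in auto)
    then have "((\<lambda>q. B * (tail q / \<Phi> q) / B) \<longlongrightarrow> C / B) at_top" using B by (intro tendsto_intros) auto
    then have "((\<lambda>q. tail q / \<Phi> q) \<longlongrightarrow> C / B) at_top" using B by simp
    then show ?thesis by (rule tail_reg_varI[OF _ _ \<Phi>_pos ratio']) (use B C in auto)
  qed
qed

text \<open>The truncated mean \<open>\<integral> q t / (q + t) d\<mu>\<close>.\<close>
definition Q :: "real \<Rightarrow> real" where "Q q = q * \<Phi> q"

lemma Q_diff:
  assumes q: "0 < q" and l: "0 < l"
  shows "Q (l * q) - Q q = (LINT t|\<mu>. indicator {0<..} t * ((l - 1) * q * t\<^sup>2 / ((l * q + t) * (q + t))))"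
proof -
  have lq: "0 < l * q" using q l by simp
  have "Q (l * q) - Q q = (LINT t|\<mu>. l * q * (indicator {0<..} t * (t / (l * q + t))) - q * (indicator {0<..} t * (t / (q + t))))"
    unfolding Q_def \<Phi>_def
    using integrable_mult_right[OF \<Phi>_integrable[OF q], of q]
      integrable_mult_right[OF \<Phi>_integrable[OF lq], of "l * q"]
    by (subst Bochner_Integration.integral_diff) (simp_all only: integral_mult_right_zero)
  also have "\<dots> = (LINT t|\<mu>. indicator {0<..} t * ((l - 1) * q * t\<^sup>2 / ((l * q + t) * (q + t))))"
  proof (rule Bochner_Integration.integral_cong[OF refl])
    fix t :: real
    show "l * q * (indicator {0<..} t * (t / (l * q + t))) - q * (indicator {0<..} t * (t / (q + t)))
        = indicator {0<..} t * ((l - 1) * q * t\<^sup>2 / ((l * q + t) * (q + t)))"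
    proof (cases "0 < t")
      case True
      then have "l * q + t > 0" "q + t > 0" using q lq by auto
      then show ?thesis by (simp add: divide_simps power2_eq_square) (simp add: algebra_simps)
    qed simp
  qed
  finally show ?thesis .
qed

lemma Q_mono: assumes "0 < p" "p \<le> q" shows "Q p \<le> Q q"
proof -
  have "0 \<le> (LINT t|\<mu>. indicator {0<..} t * ((q / p - 1) * p * t\<^sup>2 / ((q / p * p + t) * (p + t))))"
    using assms by (intro integral_nonneg_AE AE_I2) (auto simp: indicator_def intro!: divide_nonneg_nonneg mult_nonneg_nonneg)
  also have "\<dots> = Q (q / p * p) - Q p" using assms by (subst Q_diff) auto
  finally show ?thesis using assms by simp
qed

text \<open>The kernel of \<open>Q (l q) - Q q\<close> is that of the increments of \<open>levy_potential\<close> with \<open>1 / t\<close> in place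
  of \<open>t\<close>; with \<open>X = q / (q + t)\<close> the event \<open>X < 1 / 2\<close> is \<open>t > q\<close>.\<close>
lemma tail_of_Q_increments:
  assumes k_pos: "\<forall>\<^sub>F q in at_top. 0 < k q"
    and Pi: "\<And>l. 0 < l \<Longrightarrow> ((\<lambda>q. (Q (l * q) - Q q) / k q) \<longlongrightarrow> ln l) at_top"
  shows "((\<lambda>q. q * tail q / k q) \<longlongrightarrow> 1) at_top"
proof -
  define W where "W q t = indicator {0<..} t * (q * (t / (q + t))\<^sup>2 / k q)" for q t
  define X where "X q t = indicator {0<..} t * (q / (q + t))" for q t :: real
  have "((\<lambda>q. LINT t|\<mu>. W q t * (1 / (max (1 - X q t) (1 / 2))\<^sup>2 * indicator {..<1 / 2} (X q t))) \<longlongrightarrow> 1) at_top"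
  proof (rule log_tauberian)
    show "\<forall>\<^sub>F q in at_top. integrable \<mu> (W q) \<and> X q \<in> borel_measurable \<mu> \<and>
      (\<forall>t\<in>space \<mu>. 0 \<le> W q t \<and> 0 \<le> X q t \<and> X q t \<le> 1)"
      using eventually_gt_at_top[of 0] k_pos
    proof eventually_elim
      case (elim q)
      have W_le: "0 \<le> W q t" "W q t \<le> q / k q" for t
      proof -
        have "(t / (q + t))\<^sup>2 \<le> 1" if "0 < t" using kernel_bounds[of q t] that elim
          by (intro power_le_one) auto
        then have "q * (t / (q + t))\<^sup>2 \<le> q * 1" if "0 < t" using that elim by (intro mult_left_mono) auto
        then show "0 \<le> W q t" "W q t \<le> q / k q"
          using elim by (cases "0 < t"; auto simp: W_def intro!: divide_right_mono)+
      qed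
      have "integrable \<mu> (W q)"
      proof (rule integrable_const_bound[where B = "q / k q"])
        show "W q \<in> borel_measurable \<mu>" unfolding W_def[abs_def] by measurable
      qed (use W_le in auto)
      moreover have "X q \<in> borel_measurable \<mu>" unfolding X_def[abs_def] by measurable
      moreover have "0 \<le> X q t \<and> X q t \<le> 1" for t
        using elim by (cases "0 < t") (auto simp: X_def divide_le_eq_1)
      ultimately show ?case using W_le by simp
    qed
    fix l :: real assume l: "0 < l"
    show "((\<lambda>q. (l - 1) * (LINT t|\<mu>. W q t / (1 + (l - 1) * X q t))) \<longlongrightarrow> ln l) at_top"
    proof (rule Lim_transform_eventually[OF Pi[OF l]])
      show "\<forall>\<^sub>F q in at_top. (Q (l * q) - Q q) / k q = (l - 1) * (LINT t|\<mu>. W q t / (1 + (l - 1) * X q t))"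
        using eventually_gt_at_top[of 0] k_pos
      proof eventually_elim
        case (elim q)
        have "(l - 1) * (LINT t|\<mu>. W q t / (1 + (l - 1) * X q t)) = (LINT t|\<mu>. (l - 1) * (W q t / (1 + (l - 1) * X q t)))"
          by (rule integral_mult_right_zero[symmetric])
        also have "\<dots> = (LINT t|\<mu>. (1 / k q) * (indicator {0<..} t * ((l - 1) * q * t\<^sup>2 / ((l * q + t) * (q + t)))))"
        proof (rule Bochner_Integration.integral_cong[OF refl])
          fix t :: real
          show "(l - 1) * (W q t / (1 + (l - 1) * X q t))
            = (1 / k q) * (indicator {0<..} t * ((l - 1) * q * t\<^sup>2 / ((l * q + t) * (q + t))))"
          proof (cases "0 < t")
            case True
            have p: "0 < q + t" "0 < l * q + t" using True elim l by (auto intro: add_pos_pos)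
            have "1 + (l - 1) * X q t = (l * q + t) / (q + t)"
              using True p by (simp add: X_def divide_simps) (simp add: algebra_simps)
            then show ?thesis using True p by (simp add: W_def power2_eq_square mult_ac)
          qed (simp add: W_def)
        qed
        also have "\<dots> = 1 / k q * (Q (l * q) - Q q)"
          unfolding Q_diff[OF elim(1) l] by (rule integral_mult_right_zero)
        finally show ?case by simp
      qed
    qed
  qed
  then show ?thesis
  proof (rule Lim_transform_eventually)
    show "\<forall>\<^sub>F q in at_top. (LINT t|\<mu>. W q t * (1 / (max (1 - X q t) (1 / 2))\<^sup>2 * indicator {..<1 / 2} (X q t)))
        = q * tail q / k q"
      using eventually_gt_at_top[of 0]
    proof eventually_elim
      case (elim q)
      have "(LINT t|\<mu>. W q t * (1 / (max (1 - X q t) (1 / 2))\<^sup>2 * indicator {..<1 / 2} (X q t)))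
         = (LINT t|\<mu>. q / k q * indicator {q<..} t)"
      proof (rule Bochner_Integration.integral_cong[OF refl])
        fix t :: real
        show "W q t * (1 / (max (1 - X q t) (1 / 2))\<^sup>2 * indicator {..<1 / 2} (X q t)) = q / k q * indicator {q<..} t"
        proof (cases "0 < t")
          case True
          have p: "0 < q + t" using True elim by simp
          have X1: "1 - X q t = t / (q + t)" using True p by (simp add: X_def divide_simps)
          have X2: "indicator {..<1 / 2} (X q t) = (indicator {q<..} t :: real)"
            using True p by (auto simp: X_def indicator_def field_simps)
          have "max (t / (q + t)) (1 / 2) = t / (q + t)" if "q < t"
            using that p by (auto simp: max_def field_simps)
          then show ?thesis unfolding X1 X2 using True p by (auto simp: W_def indicator_def power2_eq_square)
        qed (use elim in \<open>simp add: W_def\<close>)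
      qed
      then show ?case by (simp add: tail_def)
    qed
  qed
qed

text \<open>Since \<open>\<Phi> (h x) = 1 / x\<close>, one has \<open>Q (h x) = h x / x = (1 - 1 / x) T x\<close>, or \<open>Q = P \<circ> g\<close> with
  \<open>P x = T x - T x / x\<close>. The term \<open>T x / x\<close> is negligible on the scale \<open>M = L T\<close> because \<open>x L x \<rightarrow> \<infinity>\<close>,
  so \<open>P\<close> belongs to \<open>\<Pi>\<close> with auxiliary function \<open>M\<close>. As \<open>g (l q) / g q \<rightarrow> l\<close> and \<open>P\<close> is monotone, the
  increments of \<open>Q\<close> on the scale \<open>k = M \<circ> g\<close> tend to \<open>ln l\<close>. They also show that \<open>k\<close> varies slowly,
  since \<open>k q\<close> is asymptotic to \<open>(Q (2 q) - Q q) / ln 2\<close>. Hence the tail behaves like \<open>k q / q\<close>.\<close>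
lemma tail_reg_var_slow:
  assumes L: "L \<in> reg_var 0" and xL: "filterlim (\<lambda>x. x * L x) at_top at_top"
    and T_ratio: "\<And>l. 0 < l \<Longrightarrow> ((\<lambda>x. (1 / S_transform \<mu> (- 1 / (l * x))) / (1 / S_transform \<mu> (- 1 / x))) \<longlongrightarrow> 1) at_top"
    and T_Pi: "\<And>l. 0 < l \<Longrightarrow> ((\<lambda>x. (1 / S_transform \<mu> (- 1 / (l * x)) - 1 / S_transform \<mu> (- 1 / x))
        / (L x / S_transform \<mu> (- 1 / x))) \<longlongrightarrow> ln l) at_top"
  shows "tail \<in> reg_var (- 1)"
proof -
  define T where "T x = 1 / S_transform \<mu> (- 1 / x)" for x
  define M where "M x = L x * T x" for x
  define P where "P x = h x / x" for x
  note Lp = slowly_varying_pos[OF L]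
  have T_pos: "0 < T x" if "1 < x" for x using h_spec(3)[OF that] by (simp add: T_def)
  have M_pos: "\<forall>\<^sub>F x in at_top. 0 < M x"
    using Lp eventually_gt_at_top[of 1] by eventually_elim (simp add: M_def T_pos)
  have Tr: "((\<lambda>x. T (l * x) / T x) \<longlongrightarrow> 1) at_top" if "0 < l" for l
    using T_ratio[OF that] by (simp add: T_def[abs_def])
  have TP: "((\<lambda>x. (T (l * x) - T x) / M x) \<longlongrightarrow> ln l) at_top" if "0 < l" for l
    using T_Pi[OF that] by (simp add: T_def[abs_def] M_def[abs_def])
  have g_lim: "((\<lambda>q. g (l * q) / g q) \<longlongrightarrow> l) at_top" if l: "0 < l" for l
    using g_ratio_power[of 0 l] T_ratio l by simp
  have PT: "P x = T x - T x / x" if "0 < x" for x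
  proof -
    have "P x = (x - 1) / x * T x" by (simp add: P_def h_def T_def mult.commute)
    also have "(x - 1) / x = 1 - 1 / x" using that by (simp add: diff_divide_distrib)
    finally show ?thesis by (simp add: left_diff_distrib)
  qed
  have P_Pi: "((\<lambda>x. (P (l * x) - P x) / M x) \<longlongrightarrow> ln l) at_top" if l: "0 < l" for l
  proof -
    have "((\<lambda>x. (T (l * x) - T x) / M x - (T (l * x) / T x / l - 1) / (x * L x)) \<longlongrightarrow> ln l - 0) at_top"
    proof (intro tendsto_diff TP l)
      have "((\<lambda>x. T (l * x) / T x / l - 1) \<longlongrightarrow> 1 / l - 1) at_top"
        using l by (intro tendsto_diff tendsto_divide Tr tendsto_const) auto
      then show "((\<lambda>x. (T (l * x) / T x / l - 1) / (x * L x)) \<longlongrightarrow> 0) at_top"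
        by (rule tendsto_divide_0[OF _ filterlim_at_top_imp_at_infinity[OF xL]])
    qed
    moreover have "\<forall>\<^sub>F x in at_top. (T (l * x) - T x) / M x - (T (l * x) / T x / l - 1) / (x * L x)
        = (P (l * x) - P x) / M x"
      using Lp eventually_gt_at_top[of 1]
    proof eventually_elim
      case (elim x)
      then have "0 < T x" "0 < l * x" using T_pos l by auto
      then show ?case using elim l by (simp add: PT M_def divide_simps) (simp add: algebra_simps)
    qed
    ultimately show ?thesis by (rule Lim_transform_eventually[THEN tendsto_eq_rhs]) simp
  qed
  have QP: "Q q = P (g q)" if "0 < q" for q
    using that g_gt_1[OF that] by (simp add: P_def h_g) (simp add: Q_def g_def)
  have P_mono: "P x \<le> P y" if "1 < x" "x \<le> y" for x y
  proof -
    have "Q (h x) = P x" "Q (h y) = P y" using that h_spec(2)[of x] h_spec(2)[of y] by (simp_all add: Q_def P_def)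
    moreover have "h x \<le> h y" using that h_less_iff[of y x] by (auto simp: not_less[symmetric])
    ultimately show ?thesis using Q_mono[of "h x" "h y"] h_spec(1)[of x] that by simp
  qed
  define k where "k q = M (g q)" for q
  have k_pos: "\<forall>\<^sub>F q in at_top. 0 < k q" unfolding k_def by (rule eventually_g[OF M_pos])
  have P_g: "((\<lambda>q. (P (a * g q) - P (g q)) / k q) \<longlongrightarrow> ln a) at_top" if "0 < a" for a
    unfolding k_def by (rule filterlim_compose[OF P_Pi[OF that] g_at_top])
  have Q_Pi: "((\<lambda>q. (Q (l * q) - Q q) / k q) \<longlongrightarrow> ln l) at_top" if l: "0 < l" for l
  proof (rule order_tendstoI)
    fix c assume c: "ln l < c"
    \<comment> \<open>\<open>ln a\<close> is the midpoint of \<open>ln l\<close> and \<open>c\<close>.\<close>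
    define a where "a = exp ((c + ln l) / 2)"
    have a: "0 < a" "ln a < c" "ln l < ln a" using c by (auto simp: a_def)
    then have "l < a" using l by simp
    then have "\<forall>\<^sub>F q in at_top. g (l * q) / g q < a" by (rule order_tendstoD[OF g_lim[OF l]])
    moreover have "\<forall>\<^sub>F q in at_top. (P (a * g q) - P (g q)) / k q < c"
      using a by (intro order_tendstoD[OF P_g]) auto
    ultimately show "\<forall>\<^sub>F q in at_top. (Q (l * q) - Q q) / k q < c"
      using k_pos eventually_gt_at_top[of 0]
    proof eventually_elim
      case (elim q)
      have gq: "1 < g q" "1 < g (l * q)" using elim l by (auto intro: g_gt_1)
      then have "g (l * q) \<le> a * g q" using elim by (simp add: pos_divide_less_eq)
      then have "P (g (l * q)) \<le> P (a * g q)" using gq by (intro P_mono) auto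
      then have "(Q (l * q) - Q q) / k q \<le> (P (a * g q) - P (g q)) / k q"
        using elim l by (intro divide_right_mono) (auto simp: QP)
      then show ?case using elim by linarith
    qed
  next
    fix c assume c: "c < ln l"
    define a where "a = exp ((c + ln l) / 2)"
    have a: "0 < a" "c < ln a" "ln a < ln l" using c by (auto simp: a_def)
    then have "a < l" using l by simp
    then have "\<forall>\<^sub>F q in at_top. a < g (l * q) / g q" by (rule order_tendstoD[OF g_lim[OF l]])
    moreover have "\<forall>\<^sub>F q in at_top. c < (P (a * g q) - P (g q)) / k q"
      using a by (intro order_tendstoD[OF P_g]) auto
    moreover have "\<forall>\<^sub>F q in at_top. 1 < a * g q"
      by (rule eventually_g[OF eventually_at_top_scale[OF eventually_gt_at_top a(1)]])
    ultimately show "\<forall>\<^sub>F q in at_top. c < (Q (l * q) - Q q) / k q"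
      using k_pos eventually_gt_at_top[of 0]
    proof eventually_elim
      case (elim q)
      have gq: "1 < g q" "1 < g (l * q)" using elim l by (auto intro: g_gt_1)
      then have "a * g q \<le> g (l * q)" using elim by (simp add: pos_less_divide_eq)
      then have "P (a * g q) \<le> P (g (l * q))" using elim by (intro P_mono) auto
      then have "(P (a * g q) - P (g q)) / k q \<le> (Q (l * q) - Q q) / k q"
        using elim l by (intro divide_right_mono) (auto simp: QP)
      then show ?case using elim by linarith
    qed
  qed
  note main = tail_of_Q_increments[OF k_pos Q_Pi]
  \<comment> \<open>\<open>Q (2 l q) - Q (l q)\<close> is an increment from \<open>l q\<close> on the scale \<open>k (l q)\<close>, and a difference of two
    increments from \<open>q\<close> on the scale \<open>k q\<close>; both have limit \<open>ln 2\<close>.\<close>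
  have k_ratio: "((\<lambda>q. k (l * q) / k q) \<longlongrightarrow> 1) at_top" if l: "0 < l" for l
  proof -
    have "((\<lambda>q. ((Q (2 * l * q) - Q q) / k q - (Q (l * q) - Q q) / k q) / ((Q (2 * (l * q)) - Q (l * q)) / k (l * q)))
        \<longlongrightarrow> (ln (2 * l) - ln l) / ln 2) at_top"
      using l by (intro tendsto_intros Q_Pi tendsto_at_top_scale[OF Q_Pi[of 2] l]) auto
    moreover have "\<forall>\<^sub>F q in at_top. (Q (2 * (l * q)) - Q (l * q)) / k (l * q) > 0"
      by (rule order_tendstoD(1)[OF tendsto_at_top_scale[OF Q_Pi[of 2] l]]) auto
    then have "\<forall>\<^sub>F q in at_top. ((Q (2 * l * q) - Q q) / k q - (Q (l * q) - Q q) / k q) / ((Q (2 * (l * q)) - Q (l * q)) / k (l * q))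
        = k (l * q) / k q"
      using k_pos eventually_at_top_scale[OF k_pos l]
    proof eventually_elim
      case (elim q)
      have "Q (2 * (l * q)) - Q (l * q) \<noteq> 0" using elim by auto
      then show ?case using elim by (simp add: mult.assoc flip: diff_divide_distrib)
    qed
    ultimately show ?thesis
      by (rule Lim_transform_eventually[THEN tendsto_eq_rhs]) (use l in \<open>simp add: ln_mult\<close>)
  qed
  show ?thesis
  proof (rule tail_reg_varI[where k = "\<lambda>q. k q / q" and C = 1])
    show "((\<lambda>q. tail q / (k q / q)) \<longlongrightarrow> 1) at_top" using main by (simp add: mult.commute)
    show "\<forall>\<^sub>F q in at_top. 0 < k q / q" using k_pos eventually_gt_at_top[of 0] by eventually_elim simp
    fix l :: real assume l: "0 < l"
    have "((\<lambda>q. k (l * q) / k q / l) \<longlongrightarrow> 1 / l) at_top" using l by (intro tendsto_intros k_ratio) auto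
    then show "((\<lambda>q. k (l * q) / (l * q) / (k q / q)) \<longlongrightarrow> l powr (- 1)) at_top"
    proof (rule Lim_transform_eventually[THEN tendsto_eq_rhs])
      show "\<forall>\<^sub>F q in at_top. k (l * q) / k q / l = k (l * q) / (l * q) / (k q / q)"
        using eventually_gt_at_top[of 0] by eventually_elim simp
    qed (use l in \<open>simp add: powr_minus_divide\<close>)
  qed simp
qed

end

section \<open>The equivalence and its consequences\<close>
lemma KR_infinity_exceeds:
  assumes T: "T \<in> KR_infinity" and a: "1 < a"
  shows "\<forall>\<^sub>F x in at_top. k * T x < T (a * x)"
proof -
  define b where "b = ln (2 * (\<bar>k\<bar> + 1)) / ln a"
  have ab: "a powr b = 2 * (\<bar>k\<bar> + 1)" using a by (simp add: b_def powr_def)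
  have "1 \<le> Liminf at_top (\<lambda>x. INF l\<in>{1..}. ereal (T (l * x) / (l powr b * T x)))"
    using T by (simp add: KR_infinity_def)
  then have "\<forall>\<^sub>F x in at_top. ereal (1 / 2) < (INF l\<in>{1..}. ereal (T (l * x) / (l powr b * T x)))"
    unfolding le_Liminf_iff by auto
  moreover have "\<forall>\<^sub>F x in at_top. 0 < T x"
    using T by (auto simp: KR_infinity_def intro: pos_meas_at_top_eventually_pos)
  ultimately show ?thesis
  proof eventually_elim
    case (elim x)
    have "(INF l\<in>{1..}. ereal (T (l * x) / (l powr b * T x))) \<le> ereal (T (a * x) / (a powr b * T x))"
      using a by (intro INF_lower) auto
    with elim(1) have "ereal (1 / 2) < ereal (T (a * x) / (a powr b * T x))" by (rule less_le_trans)
    then have "1 / 2 < T (a * x) / (2 * (\<bar>k\<bar> + 1) * T x)" by (simp only: ab ereal_less(1)) simp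
    moreover have "0 < 2 * (\<bar>k\<bar> + 1) * T x" using elim by (intro mult_pos_pos) auto
    ultimately have "1 / 2 * (2 * (\<bar>k\<bar> + 1) * T x) < T (a * x)" by (subst (asm) pos_less_divide_eq) auto
    then have 1: "\<bar>k\<bar> * T x + T x < T (a * x)" by (simp add: distrib_right)
    have "k * T x \<le> \<bar>k\<bar> * T x" using elim by (intro mult_right_mono) auto
    with 1 elim show ?case by linarith
  qed
qed

text \<open>Recovers the increments of \<open>v\<close> from those of \<open>T\<close>, by \<open>1 - 1 / u \<le> ln u \<le> u - 1\<close> for
  \<open>u = T (l x) / T x\<close>.\<close>
lemma ln_increment_of_Pi:
  fixes T L :: "real \<Rightarrow> real"
  assumes T_pos: "\<And>x. 1 < x \<Longrightarrow> 0 < T x" and l: "0 < l"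
    and L_pos: "\<forall>\<^sub>F x in at_top. 0 < L x"
    and Pi: "((\<lambda>x. (T (l * x) - T x) / (L x * T x)) \<longlongrightarrow> c) at_top"
    and ratio: "((\<lambda>x. T (l * x) / T x) \<longlongrightarrow> 1) at_top"
  shows "((\<lambda>x. (ln (T (l * x)) - ln (T x)) / L x) \<longlongrightarrow> c) at_top"
proof -
  have ev: "\<forall>\<^sub>F x in at_top.
      (T (l * x) - T x) / (L x * T x) / (T (l * x) / T x) \<le> (ln (T (l * x)) - ln (T x)) / L x \<and>
      (ln (T (l * x)) - ln (T x)) / L x \<le> (T (l * x) - T x) / (L x * T x)"
    using L_pos eventually_gt_at_top[of 1] eventually_at_top_scale[OF eventually_gt_at_top[of 1] l]
  proof eventually_elim
    case (elim x)
    note p = T_pos[OF elim(2)] T_pos[OF elim(3)]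
    have 1: "(T (l * x) - T x) / (L x * T x) = (T (l * x) / T x - 1) / L x"
      and 2: "(T (l * x) - T x) / (L x * T x) / (T (l * x) / T x) = (1 - T x / T (l * x)) / L x"
      using p elim by (simp_all add: field_simps)
    have "ln (T (l * x)) - ln (T x) = ln (T (l * x) / T x)" "ln (T x / T (l * x)) = - ln (T (l * x) / T x)"
      using p by (simp_all add: ln_div)
    moreover have "ln (T (l * x) / T x) \<le> T (l * x) / T x - 1" "ln (T x / T (l * x)) \<le> T x / T (l * x) - 1"
      using p by (auto intro!: ln_le_minus_one)
    ultimately show ?case unfolding 2 unfolding 1 using elim by (auto intro!: divide_right_mono)
  qed
  have lo: "((\<lambda>x. (T (l * x) - T x) / (L x * T x) / (T (l * x) / T x)) \<longlongrightarrow> c / 1) at_top"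
    by (intro tendsto_divide Pi ratio) simp
  show ?thesis
    by (rule tendsto_sandwich[OF _ _ _ Pi, of "\<lambda>x. (T (l * x) - T x) / (L x * T x) / (T (l * x) / T x)"])
       (use ev lo in \<open>auto elim!: eventually_mono\<close>)
qed

theorem theorem6p4:
  fixes L :: "real \<Rightarrow> real" and \<sigma> :: "ennreal measure" and \<gamma> :: real and v :: "real \<Rightarrow> real"
  assumes L: "L \<in> reg_var 0"
    and \<sigma>: "finite_measure \<sigma>" "sets \<sigma> = sets borel"
    and v: "\<And>z. z < 0 \<Longrightarrow> v (z / (1 - z)) = \<gamma> + (LINT t|\<sigma>. lk_kernel z t)"
  shows
    "((\<lambda>x. measure \<sigma> {0..<ennreal x}) \<sim>[at_right 0] (\<lambda>x. x * L (1 / x))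
        \<longleftrightarrow> (\<lambda>x. v (- 1 / x)) \<in> Pi_class L (- 1)) \<and>
     (\<forall>d::ereal. \<forall>\<mu>::real measure.
        ((\<lambda>x. ereal (L x)) \<longlongrightarrow> d) at_top \<longrightarrow>
        has_S_transform \<mu> {-1<..<0} (\<lambda>z. exp (v z)) \<longrightarrow>
        (\<lambda>x. measure \<sigma> {0..<ennreal x}) \<sim>[at_right 0] (\<lambda>x. x * L (1 / x))
          \<or> (\<lambda>x. v (- 1 / x)) \<in> Pi_class L (- 1) \<longrightarrow>
        (\<lambda>x. 1 / S_transform \<mu> (- 1 / x)) \<in> inv_S_class d L \<mu>) \<and>
     (\<forall>d::ereal. \<forall>\<mu>::real measure.
        ((\<lambda>x. ereal (L x)) \<longlongrightarrow> d) at_top \<longrightarrow>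
        has_S_transform \<mu> {-1<..<0} (\<lambda>z. exp (v z)) \<longrightarrow>
        (d = 0 \<longrightarrow> (\<integral>\<^sup>+t\<in>{0<..<\<infinity>}. inverse t \<partial>\<sigma>) = \<infinity>) \<longrightarrow>
        (\<lambda>x. 1 / S_transform \<mu> (- 1 / x)) \<in> inv_S_class d L \<mu> \<longrightarrow>
        (\<lambda>x. measure \<mu> {x<..})
          \<in> reg_var (if d = \<infinity> then 0 else - 1 / (1 + real_of_ereal d)))"
proof -
  interpret levy_measure \<sigma>
    using \<sigma> by (intro levy_measure.intro levy_measure_axioms.intro)
  note Lp = slowly_varying_pos[OF L]
  have vU: "v (- 1 / x) = \<gamma> - levy_potential \<sigma> (x - 1)" if x: "1 < x" for x
  proof -
    have "- (1 / (x - 1)) / (1 - - (1 / (x - 1))) = - 1 / x" using x by (simp add: divide_simps)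
    then show ?thesis using v[of "- (1 / (x - 1))"] x by (simp add: levy_potential_def)
  qed
  have Pi_iff: "(\<lambda>x. v (- 1 / x)) \<in> Pi_class L (- 1) \<longleftrightarrow>
    (\<forall>l>0. ((\<lambda>y. (levy_potential \<sigma> (l * y) - levy_potential \<sigma> y) / L y) \<longlongrightarrow> ln l) at_top)"
    using L vU by (rule Pi_potential_iff)
  have part1: "(\<lambda>x. measure \<sigma> {0..<ennreal x}) \<sim>[at_right 0] (\<lambda>x. x * L (1 / x))
        \<longleftrightarrow> (\<lambda>x. v (- 1 / x)) \<in> Pi_class L (- 1)"
    unfolding mass_below_asymp_iff[OF L] Pi_iff
  proof (rule iffI)
    assume A: "((\<lambda>y. y * mass_below (1 / y) / L y) \<longlongrightarrow> 1) at_top"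
    show "\<forall>l>0. ((\<lambda>y. (levy_potential \<sigma> (l * y) - levy_potential \<sigma> y) / L y) \<longlongrightarrow> ln l) at_top"
      by (intro allI impI increment_of_mass[OF L A])
  next
    assume A: "\<forall>l>0. ((\<lambda>y. (levy_potential \<sigma> (l * y) - levy_potential \<sigma> y) / L y) \<longlongrightarrow> ln l) at_top"
    show "((\<lambda>y. y * mass_below (1 / y) / L y) \<longlongrightarrow> 1) at_top"
      by (rule mass_below_of_increment[OF L]) (use A in simp)
  qed
  have d_cases: "d = \<infinity> \<and> filterlim L at_top at_top \<or> (\<exists>r\<ge>0. d = ereal r \<and> (L \<longlongrightarrow> r) at_top)"
    if d: "((\<lambda>x. ereal (L x)) \<longlongrightarrow> d) at_top" for d
  proof -
    have "0 \<le> d" by (rule tendsto_lowerbound[OF d]) (use Lp in \<open>auto elim!: eventually_mono\<close>)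
    then show ?thesis using d by (cases d) (auto simp: tendsto_PInfty filterlim_at_top_dense)
  qed
  have S_exp: "1 / S_transform \<mu> (- 1 / x) = exp (- v (- 1 / x))"
    if "has_S_transform \<mu> {-1<..<0} (\<lambda>z. exp (v z))" "1 < x" for \<mu> x
  proof -
    have "- 1 / x \<in> {-1<..<0}" using that(2) by (auto simp: field_simps)
    then show ?thesis using that(1) unfolding has_S_transform_def by (simp add: exp_minus inverse_eq_divide)
  qed
  have V_mono: "mono_on {1<..} (\<lambda>x. - v (- 1 / x))"
  proof (rule mono_onI)
    fix x y :: real assume xy: "x \<in> {1<..}" "y \<in> {1<..}" "x \<le> y"
    then have "levy_potential \<sigma> (x - 1) \<le> levy_potential \<sigma> (y - 1)"
      by (intro mono_onD[OF levy_potential_mono]) auto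
    then show "- v (- 1 / x) \<le> - v (- 1 / y)" using xy vU[of x] vU[of y] by simp
  qed
  have part2: "(\<lambda>x. 1 / S_transform \<mu> (- 1 / x)) \<in> inv_S_class d L \<mu>"
    if d: "((\<lambda>x. ereal (L x)) \<longlongrightarrow> d) at_top"
      and S: "has_S_transform \<mu> {-1<..<0} (\<lambda>z. exp (v z))"
      and Pi: "(\<lambda>x. v (- 1 / x)) \<in> Pi_class L (- 1)" for d \<mu>
  proof -
    have neg_quotient: "- ((a - b) / k) = (- a - - b) / k" for a b k :: real
      by (cases "k = 0") (simp_all add: field_simps)
    let ?V = "\<lambda>x. - v (- 1 / x)" and ?T = "\<lambda>x. 1 / S_transform \<mu> (- 1 / x)"
    have V_Pi: "((\<lambda>x. (?V (l * x) - ?V x) / L x) \<longlongrightarrow> ln l) at_top" if "0 < l" for l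
    proof -
      have "((\<lambda>x. (v (- 1 / (l * x)) - v (- 1 / x)) / L x) \<longlongrightarrow> - 1 * ln l) at_top"
        using Pi that unfolding Pi_class_def by blast
      from tendsto_minus[OF this] have "((\<lambda>x. (?V (l * x) - ?V x) / L x) \<longlongrightarrow> - (- 1 * ln l)) at_top"
        unfolding neg_quotient .
      then show ?thesis by simp
    qed
    from d_cases[OF d] show ?thesis
    proof (elim disjE conjE exE)
      assume "d = \<infinity>" "filterlim L at_top at_top"
      then show ?thesis
        using exp_Pi_KR_infinity[where V = ?V and T = ?T, OF V_mono S_exp[OF S] V_Pi]
        by (simp add: inv_S_class_def)
    next
      fix r assume r: "0 \<le> r" "d = ereal r" "(L \<longlongrightarrow> r) at_top"
      show ?thesis
      proof (cases "r = 0")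
        case True
        have "(\<lambda>x. 1 / S_transform \<mu> (- 1 / x)) \<in> Pi_class (\<lambda>x. L x * (1 / S_transform \<mu> (- 1 / x))) 1"
          by (rule exp_Pi_Pi_class[where V = ?V and T = ?T, OF V_mono S_exp[OF S] L V_Pi]) (use r True in auto)
        then show ?thesis using r True by (simp add: inv_S_class_def)
      next
        case False
        have "(\<lambda>x. 1 / S_transform \<mu> (- 1 / x)) \<in> reg_var r"
          by (rule exp_Pi_reg_var[where V = ?V and T = ?T, OF V_mono S_exp[OF S] Lp V_Pi r(3)])
        then show ?thesis using r False by (simp add: inv_S_class_def)
      qed
    qed
  qed
  have part3: "(\<lambda>x. measure \<mu> {x<..}) \<in> reg_var (if d = \<infinity> then 0 else - 1 / (1 + real_of_ereal d))"
    if d: "((\<lambda>x. ereal (L x)) \<longlongrightarrow> d) at_top"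
      and S: "has_S_transform \<mu> {-1<..<0} (\<lambda>z. exp (v z))"
      and cls: "(\<lambda>x. 1 / S_transform \<mu> (- 1 / x)) \<in> inv_S_class d L \<mu>" for d \<mu>
  proof -
    have "measure \<mu> {0} = 0"
      using S unfolding has_S_transform_def by (auto simp: greaterThanLessThan_eq_iff)
    then interpret \<mu>: nonneg_prob \<mu>
      using S unfolding has_S_transform_def prob_on_nonneg_def
      by (intro nonneg_prob.intro nonneg_prob_axioms.intro) auto
    have tail: "(\<lambda>x. measure \<mu> {x<..}) = \<mu>.tail" by (auto simp: \<mu>.tail_def)
    let ?T = "\<lambda>x. 1 / S_transform \<mu> (- 1 / x)"
    from d_cases[OF d] show ?thesis
    proof (elim disjE conjE exE)
      assume "d = \<infinity>"
      then have K: "?T \<in> KR_infinity" using cls by (simp add: inv_S_class_def)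
      have "\<mu>.tail \<in> reg_var (- 0)"
      proof (rule \<mu>.tail_reg_var_power)
        fix l :: real assume l: "0 < l"
        have "((\<lambda>q. \<mu>.g (l * q) / \<mu>.g q) \<longlongrightarrow> 1) at_top"
          by (rule \<mu>.g_ratio_rapid[OF KR_infinity_exceeds[OF K] KR_infinity_exceeds[OF K] l])
        then show "((\<lambda>q. \<mu>.g (l * q) / \<mu>.g q) \<longlongrightarrow> l powr 0) at_top" using l by simp
      qed auto
      then show ?thesis using \<open>d = \<infinity>\<close> by (simp add: tail)
    next
      fix r assume r: "0 \<le> r" "d = ereal r" "(L \<longlongrightarrow> r) at_top"
      show ?thesis
      proof (cases "r = 0")
        case False
        then have "?T \<in> reg_var r" using cls r by (simp add: inv_S_class_def)
        then have T: "((\<lambda>x. ?T (l * x) / ?T x) \<longlongrightarrow> l powr r) at_top" if "0 < l" for l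
          using that unfolding reg_var_def by blast
        have "\<mu>.tail \<in> reg_var (- (1 / (1 + r)))"
          using r False by (intro \<mu>.tail_reg_var_power \<mu>.g_ratio_power T) auto
        then show ?thesis using r by (simp add: tail)
      next
        case True
        have P: "?T \<in> Pi_class (\<lambda>x. L x / S_transform \<mu> (- 1 / x)) 1"
          using cls r True by (simp add: inv_S_class_def)
        then have T_Pi: "((\<lambda>x. (?T (l * x) - ?T x) / (L x / S_transform \<mu> (- 1 / x))) \<longlongrightarrow> ln l) at_top"
          if "0 < l" for l
          using that unfolding Pi_class_def by force
        have T_pos: "0 < ?T x" if "1 < x" for x using S_exp[OF S that] by simp
        have T_ratio: "((\<lambda>x. ?T (l * x) / ?T x) \<longlongrightarrow> 1) at_top" if l: "0 < l" for l
        proof -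
          have "((\<lambda>x. (?T (l * x) - ?T x) / (L x / S_transform \<mu> (- 1 / x)) * L x + 1) \<longlongrightarrow> ln l * 0 + 1) at_top"
            using r True by (intro tendsto_intros T_Pi l) auto
          then show ?thesis
          proof (rule Lim_transform_eventually[THEN tendsto_eq_rhs])
            show "\<forall>\<^sub>F x in at_top. (?T (l * x) - ?T x) / (L x / S_transform \<mu> (- 1 / x)) * L x + 1 = ?T (l * x) / ?T x"
              using Lp eventually_gt_at_top[of 1]
            proof eventually_elim
              case (elim x)
              have eq: "(b - c) / (k * c) * k + 1 = b / c" if "0 < c" "0 < k" for b c k :: real
                using that by (simp add: field_simps)
              from eq[OF T_pos[OF elim(2)] elim(1), of "?T (l * x)"] show ?case by simp
            qed
          qed simp
        qed
        \<comment> \<open>Taking logarithms puts \<open>v (- 1 / x)\<close> into the class \<open>\<Pi>\<close>, which gives \<open>x L x \<rightarrow> \<infinity>\<close>.\<close>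
        have "((\<lambda>x. (ln (?T (l * x)) - ln (?T x)) / L x) \<longlongrightarrow> ln l) at_top" if l: "0 < l" for l
          by (rule ln_increment_of_Pi[OF T_pos l Lp _ T_ratio[OF l]]) (use T_Pi[OF l] in simp_all)
        then have "((\<lambda>x. (v (- 1 / (l * x)) - v (- 1 / x)) / L x) \<longlongrightarrow> - 1 * ln l) at_top" if l: "0 < l" for l
        proof -
          have "((\<lambda>x. - ((ln (?T (l * x)) - ln (?T x)) / L x)) \<longlongrightarrow> - ln l) at_top"
            by (intro tendsto_minus \<open>\<And>l. 0 < l \<Longrightarrow> ((\<lambda>x. (ln (?T (l * x)) - ln (?T x)) / L x) \<longlongrightarrow> ln l) at_top\<close> l)
          then show ?thesis
          proof (rule Lim_transform_eventually[THEN tendsto_eq_rhs])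
            show "\<forall>\<^sub>F x in at_top. - ((ln (?T (l * x)) - ln (?T x)) / L x) = (v (- 1 / (l * x)) - v (- 1 / x)) / L x"
              using eventually_gt_at_top[of 1] eventually_at_top_scale[OF eventually_gt_at_top[of 1] l]
            proof eventually_elim
              case (elim x)
              have "- ((- a - - b) / k) = (a - b) / k" for a b k :: real
                by (cases "k = 0") (simp_all add: field_simps)
              then show ?case using elim by (simp only: S_exp[OF S] ln_exp)
            qed
          qed simp
        qed
        then have "(\<lambda>x. v (- 1 / x)) \<in> Pi_class L (- 1)" using L by (simp add: Pi_class_def)
        then have "filterlim (\<lambda>x. x * L x) at_top at_top"
          unfolding Pi_iff by (intro times_slowly_varying_at_top[OF L]) blast
        from \<mu>.tail_reg_var_slow[OF L this T_ratio T_Pi]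
        show ?thesis using r True by (simp add: tail)
      qed
    qed
  qed
  show ?thesis using part1 part2 part3 by blast
qed

end
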